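(* Let $\{S_n\}_{n\ge0}$ be the SRRW-RVM with memory sequence $\{\mu_n\}$ (regularly varying of index $\gamma>-1$), recollection probability $p$, and zero mean innovation sequence $\{\xi_n\}_{n\ge1}$ satisfying $\mathbb{E}\xi_1^2=1$. If $\{v_n\}$ is bounded and $p\in[p_c,1]$ (with $p\ge 0$), then $$a_n\mu_nS_n\to\frac{p(\gamma+1)}{p(\gamma+1)-\gamma}\,M_\infty\quad\text{in }L^2\text{ and almost surely},$$ where $M_\infty$ is the almost sure and $L^2$ limit of the martingale $M_n$. Additionally, when the innovations are symmetric Rademacher, the limiting random variable $M_\infty$ is platykurtic, that is, its kurtosis $\mathbb{E}M_\infty^4/(\mathbb{E}M_\infty^2)^2$ is strictly smaller than $3$, and $M_\infty$ is not Gaussian.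
   Context: Model (SRRW-RVM). Fix $p\in[0,1]$ (recollection probability) and $\gamma>-1$. Let $\{\mu_n\}_{n\ge1}$ (memory sequence) be a sequence of positive reals, regularly varying of index $\gamma$: $\mu_{\lfloor\lambda n\rfloor}/\mu_n\to\lambda^\gamma$ for every $\lambda>0$. Put $\nu_n=\sum_{k=1}^n\mu_k$. Let $\{\xi_n\}_{n\ge1}$ (innovation sequence) be i.i.d. real random variables with mean $0$; $\{\alpha_n\}_{n\ge2}$ i.i.d. Bernoulli($p$); $\{\beta_n\}_{n\ge2}$ independent with $\mathbb{P}(\beta_n=k)=\mu_k/\nu_{n-1}$ for $1\le k\le n-1$; the three sequences are independent of each other. Set $X_1=\xi_1$ and, for $n\ge1$, $X_{n+1}=\alpha_{n+1}X_{\beta_{n+1}}+(1-\alpha_{n+1})\xi_{n+1}$. The walk is $S_0=0$, $S_n=\sum_{k=1}^nX_k$. Notation. $a_n=\prod_{i=1}^{n-1}\left(1+p\frac{\mu_{i+1}}{\nu_i}\right)^{-1}$ for $n\ge1$ (so $a_1=1$); $v_n^2=\sum_{k=1}^na_k^2\mu_k^2$ ($v_n\ge0$); $p_c=(\gamma+\frac12)/(\gamma+1)$. $M_n=a_n\sum_{k=1}^n\mu_kX_k$ is a martingale, with respect to the filtration $\mathcal{F}_n=\sigma(\xi_1,\ldots,\xi_n,\beta_2,\ldots,\beta_n,\alpha_2,\ldots,\alpha_n)$; when $\{v_n\}$ is bounded it is $L^2$-bounded and $M_\infty$ denotes its almost sure and $L^2$ limit. A symmetric Rademacher variable takes values $\pm1$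 with probability $1/2$ each. *)

theory Defs
  imports "HOL-Probability.Probability"
begin

(* All sequences of the model start at index 1 (or 2); their values at smaller indices are
   unconstrained. The argument of mu below is 0 only for finitely many n. *)
definition regularly_varying :: "(nat \<Rightarrow> real) \<Rightarrow> real \<Rightarrow> bool" where
  "regularly_varying \<mu> \<gamma> \<longleftrightarrow>
     (\<forall>l>0. (\<lambda>n. \<mu> (nat \<lfloor>l * real n\<rfloor>) / \<mu> n) \<longlonglongrightarrow> l powr \<gamma>)"

definition mem_sum :: "(nat \<Rightarrow> real) \<Rightarrow> nat \<Rightarrow> real" where
  "mem_sum \<mu> n = (\<Sum>k=1..n. \<mu> k)"

definition coeff_a :: "real \<Rightarrow> (nat \<Rightarrow> real) \<Rightarrow> nat \<Rightarrow> real" where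
  "coeff_a p \<mu> n = (\<Prod>i=1..<n. inverse (1 + p * (\<mu> (i + 1) / mem_sum \<mu> i)))"

definition coeff_v :: "real \<Rightarrow> (nat \<Rightarrow> real) \<Rightarrow> nat \<Rightarrow> real" where
  "coeff_v p \<mu> n = sqrt (\<Sum>k=1..n. (coeff_a p \<mu> k)\<^sup>2 * (\<mu> k)\<^sup>2)"

definition p_crit :: "real \<Rightarrow> real" where
  "p_crit \<gamma> = (\<gamma> + 1/2) / (\<gamma> + 1)"

(* The sigma-algebra generated by the N-valued random variables Y i, i in I. *)
definition sigma_gen_by ::
    "'a measure \<Rightarrow> 'b measure \<Rightarrow> (nat \<Rightarrow> 'a \<Rightarrow> 'b) \<Rightarrow> nat set \<Rightarrow> 'a set set" where
  "sigma_gen_by P N Y I =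
     sigma_sets (space P) {Y i -` A \<inter> space P | i A. i \<in> I \<and> A \<in> sets N}"

(* Since beta n lies in {1..n-1} only almost surely, the recursion is required almost surely,
   and the steps X n are required to be random variables. *)
locale srrw_rvm = prob_space P for P :: "'a measure" +
  fixes p \<gamma> :: real
    and \<mu> :: "nat \<Rightarrow> real"
    and \<xi> :: "nat \<Rightarrow> 'a \<Rightarrow> real"
    and \<alpha> :: "nat \<Rightarrow> 'a \<Rightarrow> bool"
    and \<beta> :: "nat \<Rightarrow> 'a \<Rightarrow> nat"
    and X :: "nat \<Rightarrow> 'a \<Rightarrow> real"
  assumes p_range: "0 \<le> p" "p \<le> 1"
    and gamma_gt: "\<gamma> > -1"
    and mu_pos: "\<And>n. n \<ge> 1 \<Longrightarrow> \<mu> n > 0"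
    and mu_regvar: "regularly_varying \<mu> \<gamma>"
    and xi_indep: "indep_vars (\<lambda>_. borel) \<xi> {1..}"
    and xi_ident: "\<And>n. n \<ge> 1 \<Longrightarrow> distr P borel (\<xi> n) = distr P borel (\<xi> 1)"
    and xi_integrable: "integrable P (\<xi> 1)"
    and xi_mean: "expectation (\<xi> 1) = 0"
    and alpha_indep: "indep_vars (\<lambda>_. count_space UNIV) \<alpha> {2..}"
    and alpha_distr: "\<And>n. n \<ge> 2 \<Longrightarrow>
           distr P (count_space UNIV) (\<alpha> n) = measure_pmf (bernoulli_pmf p)"
    and beta_indep: "indep_vars (\<lambda>_. count_space UNIV) \<beta> {2..}"
    and beta_distr: "\<And>n k. n \<ge> 2 \<Longrightarrow> 1 \<le> k \<Longrightarrow> k \<le> n - 1 \<Longrightarrow>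
           prob {\<omega> \<in> space P. \<beta> n \<omega> = k} = \<mu> k / mem_sum \<mu> (n - 1)"
    and seqs_indep: "indep_sets
           (nth [sigma_gen_by P borel \<xi> {1..},
                 sigma_gen_by P (count_space UNIV) \<alpha> {2..},
                 sigma_gen_by P (count_space UNIV) \<beta> {2..}]) {0, 1, 2}"
    and X_rv: "\<And>n. n \<ge> 1 \<Longrightarrow> random_variable borel (X n)"
    and X_init: "AE \<omega> in P. X 1 \<omega> = \<xi> 1 \<omega>"
    and X_step: "\<And>n. n \<ge> 1 \<Longrightarrow> AE \<omega> in P.
           X (n + 1) \<omega> = of_bool (\<alpha> (n + 1) \<omega>) * X (\<beta> (n + 1) \<omega>) \<omega>
                        + (1 - of_bool (\<alpha> (n + 1) \<omega>)) * \<xi> (n + 1) \<omega>"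

definition walk :: "(nat \<Rightarrow> 'a \<Rightarrow> real) \<Rightarrow> nat \<Rightarrow> 'a \<Rightarrow> real" where
  "walk X n \<omega> = (\<Sum>k=1..n. X k \<omega>)"

definition mart ::
    "real \<Rightarrow> (nat \<Rightarrow> real) \<Rightarrow> (nat \<Rightarrow> 'a \<Rightarrow> real) \<Rightarrow> nat \<Rightarrow> 'a \<Rightarrow> real" where
  "mart p \<mu> X n \<omega> = coeff_a p \<mu> n * (\<Sum>k=1..n. \<mu> k * X k \<omega>)"

definition square_integrable :: "'a measure \<Rightarrow> ('a \<Rightarrow> real) \<Rightarrow> bool" where
  "square_integrable P f \<longleftrightarrow> f \<in> borel_measurable P \<and> integrable P (\<lambda>\<omega>. (f \<omega>)\<^sup>2)"

definition converges_L2 ::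
    "'a measure \<Rightarrow> (nat \<Rightarrow> 'a \<Rightarrow> real) \<Rightarrow> ('a \<Rightarrow> real) \<Rightarrow> bool" where
  "converges_L2 P f g \<longleftrightarrow> (\<forall>n. square_integrable P (f n)) \<and> square_integrable P g \<and>
     (\<lambda>n. \<integral>\<omega>. (f n \<omega> - g \<omega>)\<^sup>2 \<partial>P) \<longlonglongrightarrow> 0"

definition converges_AE ::
    "'a measure \<Rightarrow> (nat \<Rightarrow> 'a \<Rightarrow> real) \<Rightarrow> ('a \<Rightarrow> real) \<Rightarrow> bool" where
  "converges_AE P f g \<longleftrightarrow> (AE \<omega> in P. (\<lambda>n. f n \<omega>) \<longlonglongrightarrow> g \<omega>)"

(* A version of the almost sure limit; its value is irrelevant where the sequence diverges. *)
definition mart_lim ::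
    "real \<Rightarrow> (nat \<Rightarrow> real) \<Rightarrow> (nat \<Rightarrow> 'a \<Rightarrow> real) \<Rightarrow> 'a \<Rightarrow> real" where
  "mart_lim p \<mu> X \<omega> = lim (\<lambda>n. mart p \<mu> X n \<omega>)"

definition symmetric_rademacher :: "'a measure \<Rightarrow> ('a \<Rightarrow> real) \<Rightarrow> bool" where
  "symmetric_rademacher P Y \<longleftrightarrow> Y \<in> borel_measurable P \<and>
     measure P {\<omega> \<in> space P. Y \<omega> = 1} = 1/2 \<and>
     measure P {\<omega> \<in> space P. Y \<omega> = -1} = 1/2"

(* Kurtosis of a centred random variable. *)
definition kurtosis :: "'a measure \<Rightarrow> ('a \<Rightarrow> real) \<Rightarrow> real" where
  "kurtosis P Y = (\<integral>\<omega>. (Y \<omega>) ^ 4 \<partial>P) / (\<integral>\<omega>. (Y \<omega>)\<^sup>2 \<partial>P)\<^sup>2"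

(* The first three conjuncts say that the kurtosis is meaningful: in HOL the integral of a
   non-integrable function and x / 0 are both 0. *)
definition platykurtic :: "'a measure \<Rightarrow> ('a \<Rightarrow> real) \<Rightarrow> bool" where
  "platykurtic P Y \<longleftrightarrow> Y \<in> borel_measurable P \<and> integrable P (\<lambda>\<omega>. (Y \<omega>) ^ 4) \<and>
     (\<integral>\<omega>. (Y \<omega>)\<^sup>2 \<partial>P) > 0 \<and> kurtosis P Y < 3"

(* Point masses count as (degenerate) Gaussians. *)
definition gaussian :: "'a measure \<Rightarrow> ('a \<Rightarrow> real) \<Rightarrow> bool" where
  "gaussian P Y \<longleftrightarrow> (\<exists>m. AE \<omega> in P. Y \<omega> = m) \<or>
     (\<exists>m \<sigma>. \<sigma> > 0 \<and> distributed P lborel Y (\<lambda>x. ennreal (normal_density m \<sigma> x)))"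

end

(* Regular variation enters through Karamata's theorem n mu_n / nu_n -> gamma + 1 alone. With
   c_n = 1 / (a_n nu_n) and b_n = n c_n it gives (b_{n+1} - b_n) / c_n -> rho = p (gamma + 1) - gamma > 0,
   so by the Stolz-Cesaro theorem sum_{k<n} c_k ~ b_n / rho, while a_n mu_n b_n -> gamma + 1.

   The variables e_n = X_{n+1} - p Y_n / nu_n, where Y_n = sum_{k<=n} mu_k X_k, are martingale differences
   with second moment at most 1, M_n is the series of a_{k+1} mu_{k+1} e_k, and
     S_n = sum_{k<n} e_k + p sum_{1<=k<n} c_k M_k.
   A maximal inequality makes M_n and the series of e_k / b_{k+1} converge. By Kronecker's lemma the
   first summand is o(b_n); the second is a weighted average of the convergent M_k.

   For Rademacher innovations the moments A_n = E M_n^2 and B_n = E M_n^4 satisfy a closed recursion along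
   which 3 A_n^2 - B_n does not decrease, and it starts at 2 mu_1^4 > 0. Fatou's lemma gives
   E M^4 < 3 (E M^2)^2 for the limit M. *)
theory Submission
  imports Defs "HOL-Real_Asymp.Real_Asymp"
begin

section \<open>Regularly varying sequences\<close>

text \<open>Regular variation is a limit for each ratio separately, whereas Karamata's theorem needs
  uniformity over the indices between n/2 and n; a measure argument on the set of ratios supplies
  it. Boundedness of v_n is summability of the squares of a_n mu_n. As a_n mu_n b_n tends to a
  positive constant, the squares of 1 / b_n are summable too, so one assumption serves the
  martingale and the series in Kronecker's lemma. It also gives n (a_n mu_n)^2 -> 0, which disposes
  of the noise in L2. The recursion for X holds only almost surely, so X_n need not be measurable
  for the sigma-algebra of the first n inputs; the filtration is enlarged by null events. The
  martingale property is used as orthogonality to square-integrable functions of the past, which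
  avoids conditional expectations. For the kurtosis the difference 3 A_n^2 - B_n is tracked, not the
  ratio: a fixed positive lower bound on it keeps the inequality strict in the limit, and Fatou's
  lemma bounds the fourth moment on the side that is wanted.\<close>

lemma stolz_cesaro:
  fixes x y :: "nat \<Rightarrow> real"
  assumes inc: "eventually (\<lambda>n. y n < y (Suc n)) sequentially"
    and top: "filterlim y at_top sequentially"
    and lim: "(\<lambda>n. (x (Suc n) - x n) / (y (Suc n) - y n)) \<longlonglongrightarrow> L"
  shows "(\<lambda>n. x n / y n) \<longlonglongrightarrow> L"
proof (rule LIMSEQ_I)
  fix r :: real assume r: "r > 0"
  define e where "e = r / 2"
  have e: "e > 0" using r by (simp add: e_def)
  \<comment> \<open>\<open>z\<close> is the deviation from exact proportionality. Its increments are
    at most \<open>e\<close> times those of \<open>y\<close>, so telescoping bounds it by e y n plus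
    a constant; r = 2 e leaves room for the constant.\<close>
  define z where "z n = x n - L * y n" for n
  have "eventually (\<lambda>n. \<bar>(x (Suc n) - x n) / (y (Suc n) - y n) - L\<bar> < e) sequentially"
    using tendstoD[OF lim e] by (simp add: dist_real_def)
  with inc have "eventually (\<lambda>n. \<bar>z (Suc n) - z n\<bar> \<le> e * (y (Suc n) - y n)) sequentially"
  proof eventually_elim
    case (elim n)
    have "z (Suc n) - z n = ((x (Suc n) - x n) / (y (Suc n) - y n) - L) * (y (Suc n) - y n)"
      using elim by (simp add: z_def field_simps)
    then show ?case
      using elim by (simp add: abs_mult mult_right_mono less_imp_le)
  qed
  then obtain N where N: "\<And>n. n \<ge> N \<Longrightarrow> \<bar>z (Suc n) - z n\<bar> \<le> e * (y (Suc n) - y n)"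
    by (auto simp: eventually_sequentially)
  have bound: "\<bar>z n\<bar> \<le> \<bar>z N\<bar> + e * (y n - y N)" if "n \<ge> N" for n
    using that
  proof (induction n rule: dec_induct)
    case (step n)
    then show ?case using N[of n] by (simp add: algebra_simps)
  qed simp
  have "eventually (\<lambda>n. y n > max 1 ((\<bar>z N\<bar> + e * \<bar>y N\<bar> + 1) / e)) sequentially"
    using filterlim_at_top_dense[THEN iffD1, OF top] by blast
  then obtain N' where N': "\<And>n. n \<ge> N' \<Longrightarrow> y n > 1"
      "\<And>n. n \<ge> N' \<Longrightarrow> y n > (\<bar>z N\<bar> + e * \<bar>y N\<bar> + 1) / e"
    by (auto simp: eventually_sequentially)
  show "\<exists>no. \<forall>n\<ge>no. norm (x n / y n - L) < r"
  proof (intro exI allI impI)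
    fix n assume n: "n \<ge> max N N'"
    have y: "y n > 0" using N'(1)[of n] n by simp
    have "\<bar>z N\<bar> + e * \<bar>y N\<bar> < e * y n"
      using N'(2)[of n] n e by (simp add: field_simps)
    moreover have "\<bar>z n\<bar> \<le> \<bar>z N\<bar> + e * y n + e * \<bar>y N\<bar>"
    proof -
      have "e * (y n - y N) \<le> e * y n + e * \<bar>y N\<bar>"
        using mult_left_mono[OF abs_ge_minus_self[of "y N"] less_imp_le[OF e]]
        by (simp only: right_diff_distrib mult_minus_right)
      with bound[of n] n show ?thesis by simp
    qed
    ultimately have "\<bar>z n\<bar> < r * y n" by (simp add: e_def)
    moreover have "x n / y n - L = z n / y n" using y by (simp add: z_def field_simps)
    ultimately show "norm (x n / y n - L) < r" using y by (simp add: field_simps)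
  qed
qed

text \<open>Each use of the recursion halves the index, so an index beyond 2^j N admits j
  contractions by a fixed factor below 1.\<close>

lemma halving_contraction_tendsto_0:
  fixes x th ep :: "nat \<Rightarrow> real"
  assumes nonneg: "\<And>n. 0 \<le> x n"
    and rec: "eventually (\<lambda>n. x n \<le> th n * x (n div 2) + ep n) sequentially"
    and th: "th \<longlonglongrightarrow> \<theta>" "\<theta> < 1" and ep: "ep \<longlonglongrightarrow> 0"
  shows "x \<longlonglongrightarrow> 0"
proof (rule LIMSEQ_I)
  fix r :: real assume r: "r > 0"
  define e where "e = r / 2"
  have e: "e > 0" using r by (simp add: e_def)
  \<comment> \<open>Halfway between \<open>max \<theta> 0\<close> and 1: above the limit of
    \<open>th\<close>, below 1, and positive even if \<theta> is not.\<close>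
  define q where "q = (1 + max \<theta> 0) / 2"
  have q: "\<theta> < q" "0 < q" "q < 1" using th(2) by (auto simp: q_def)
  have ep': "eventually (\<lambda>n. ep n < e * (1 - q)) sequentially"
    using order_tendstoD(2)[OF ep, of "e * (1 - q)"] e q by simp
  from rec order_tendstoD(2)[OF th(1) q(1)] ep'
  have "eventually (\<lambda>n. x n - e \<le> q * (x (n div 2) - e)) sequentially"
  proof eventually_elim
    case (elim n)
    have "th n * x (n div 2) \<le> q * x (n div 2)"
      using elim nonneg by (intro mult_right_mono) auto
    with elim show ?case by (simp add: algebra_simps)
  qed
  then obtain N where N: "\<And>n. n \<ge> N \<Longrightarrow> x n - e \<le> q * (x (n div 2) - e)"
    by (auto simp: eventually_sequentially)
  \<comment> \<open>The excess over \<open>e\<close> contracts by \<open>q\<close> with no additive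
    term, because \<open>ep n\<close> is eventually below e (1 - q).\<close>
  define y where "y n = max (x n - e) 0" for n
  have y: "y n \<le> q * y (n div 2)" if "n \<ge> N" for n
  proof -
    have "q * (x (n div 2) - e) \<le> q * y (n div 2)" "0 \<le> q * y (n div 2)"
      using q by (auto simp: y_def)
    then show ?thesis using N[OF that] by (simp add: y_def)
  qed
  define K where "K = Max (y ` {..Suc N})"
  have K: "y n \<le> K" for n
  proof (induction n rule: less_induct)
    case (less n)
    show ?case
    proof (cases "n \<le> Suc N")
      case True then show ?thesis by (auto simp: K_def intro!: Max_ge)
    next
      case False
      then have "y n \<le> q * y (n div 2)" "y (n div 2) \<le> K" using y less by auto
      moreover have "q * y (n div 2) \<le> 1 * y (n div 2)"
        using q by (intro mult_right_mono) (auto simp: y_def)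
      ultimately show ?thesis by simp
    qed
  qed
  have pow: "y n \<le> q ^ j * K" if "n \<ge> 2 ^ j * N" for n j
    using that
  proof (induction j arbitrary: n)
    case 0 then show ?case using K by simp
  next
    case (Suc j)
    have "1 * N \<le> 2 ^ Suc j * N" by (intro mult_right_mono) (auto simp del: power_Suc)
    then have "n \<ge> N" using Suc.prems by linarith
    moreover have "y (n div 2) \<le> q ^ j * K"
      by (rule Suc.IH) (use Suc.prems in auto)
    then have "q * y (n div 2) \<le> q * (q ^ j * K)" using q by (intro mult_left_mono) auto
    ultimately show ?case using y[of n] by (simp add: mult.assoc)
  qed
  have "(\<lambda>j. q ^ j * K) \<longlonglongrightarrow> 0 * K"
    by (intro tendsto_mult_right LIMSEQ_power_zero) (use q in auto)
  then have "eventually (\<lambda>j. q ^ j * K < e) sequentially"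
    using e by (intro order_tendstoD(2)) auto
  then obtain j where j: "q ^ j * K < e" by (auto simp: eventually_sequentially)
  show "\<exists>no. \<forall>n\<ge>no. norm (x n - 0) < r"
  proof (intro exI allI impI)
    fix n assume "n \<ge> 2 ^ j * N"
    from pow[OF this] j nonneg[of n] show "norm (x n - 0) < r"
      by (auto simp: y_def e_def)
  qed
qed

text \<open>The cell of j at scale m is the set of x for which x m has integer part j. Cells are
  disjoint of length 1 / m, so counting integers amounts to measuring ratios.\<close>

lemma card_disjoint_cells_less:
  fixes B :: "real set" and m :: nat
  assumes m: "m > 0" and J: "finite J"
    and B: "B \<in> sets lborel" "emeasure lborel B \<noteq> \<infinity>" "measure lborel B < c"
    and sub: "\<And>j. j \<in> J \<Longrightarrow> {real j / real m..<real (Suc j) / real m} \<subseteq> B"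
  shows "real (card J) < c * real m"
proof -
  define I where "I j = {real j / real m..<real (Suc j) / real m}" for j
  have disj: "disjoint_family_on I J"
  proof -
    have "I i \<inter> I j = {}" if "i < j" for i j
    proof -
      have "real (Suc i) / real m \<le> real j / real m"
        using that by (intro divide_right_mono) auto
      then show ?thesis unfolding I_def by auto
    qed
    then show ?thesis unfolding disjoint_family_on_def
      by (metis inf_commute linorder_neqE_nat)
  qed
  have meas: "measure lborel (I j) = 1 / real m" for j
    using m by (simp add: I_def field_simps)
  have "real (card J) / real m = (\<Sum>j\<in>J. measure lborel (I j))"
    by (simp add: meas)
  also have "\<dots> = measure lborel (\<Union>j\<in>J. I j)"
    by (rule measure_finite_Union[symmetric]) (use J disj in \<open>auto simp: I_def[abs_def] divide_right_mono\<close>)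
  also have "\<dots> \<le> measure lborel B"
    by (rule measure_mono_fmeasurable)
       (use sub J B in \<open>auto simp: I_def fmeasurable_def less_top\<close>)
  also have "\<dots> < c" by fact
  finally show ?thesis using m by (simp add: field_simps)
qed

text \<open>The uniform convergence theorem for slow variation, in logarithmic form.
  \<open>l n\<close> and \<open>l k\<close> are compared through a common index j, the integer part
  of both x n and x' k, where x and x' are ratios at which convergence has already set in. A measure
  count shows that such a j exists.\<close>

lemma slowly_varying_uniform:
  fixes l :: "nat \<Rightarrow> real"
  assumes conv: "\<And>c. c > 0 \<Longrightarrow> (\<lambda>n. l (nat \<lfloor>c * real n\<rfloor>) - l n) \<longlonglongrightarrow> 0"
    and e: "e > 0"
  shows "\<exists>N. \<forall>n\<ge>N. \<forall>k\<in>{n..2 * n}. \<bar>l k - l n\<bar> \<le> e"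
proof -
  \<comment> \<open>Ratios whose deviation has settled from N on. The interval from 1 to 4 holds all
    j / n and j / k with j from 2 n to below 4 n and k from n to 2 n.\<close>
  define E where "E N = {c \<in> {1..<4::real}. \<forall>n\<in>{N..}. \<bar>l (nat \<lfloor>c * real n\<rfloor>) - l n\<bar> \<le> e / 2}" for N
  have meas [measurable]: "E N \<in> sets borel" for N
  proof -
    have "{c \<in> space borel. c \<in> {1..<4::real} \<and> (\<forall>n\<in>{N..}. \<bar>l (nat \<lfloor>c * real n\<rfloor>) - l n\<bar> \<le> e / 2)} \<in> sets borel"
      by measurable
    then show ?thesis by (simp add: E_def)
  qed
  have inc: "incseq E" by (auto simp: incseq_def E_def)
  have un: "(\<Union>N. E N) = {1..<4}"
  proof -
    have "\<exists>N. x \<in> E N" if x: "x \<in> {1..<4}" for x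
    proof -
      have "eventually (\<lambda>n. dist (l (nat \<lfloor>x * real n\<rfloor>) - l n) 0 < e / 2) sequentially"
        using x e by (intro tendstoD conv) auto
      then show ?thesis using x
        by (auto simp: E_def eventually_sequentially dist_real_def intro: less_imp_le)
    qed
    then show ?thesis by (auto simp: E_def)
  qed
  have sub: "E N \<subseteq> {1..<4}" for N by (auto simp: E_def)
  have fin: "emeasure lborel (E N) \<noteq> \<infinity>" for N
    using emeasure_mono[OF sub[of N], of lborel] by (auto simp: top_unique)
  have "(\<lambda>N. measure lborel (E N)) \<longlonglongrightarrow> measure lborel (\<Union>N. E N)"
    by (rule Lim_measure_incseq) (use inc un in auto)
  then have "(\<lambda>N. measure lborel (E N)) \<longlonglongrightarrow> 3" by (simp add: un)
  from order_tendstoD(1)[OF this, of "5/2"]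
  obtain N where N: "measure lborel (E N) > 5/2" by (auto simp: eventually_sequentially)
  define B where "B = {1..<4} - E N"
  have B: "B \<in> sets lborel" "emeasure lborel B \<noteq> \<infinity>" "measure lborel B < 1/2"
  proof -
    show "B \<in> sets lborel" by (simp add: B_def)
    show "emeasure lborel B \<noteq> \<infinity>"
      using emeasure_mono[of B "{1..<4}" lborel] by (auto simp: top_unique B_def)
    have "measure lborel B = measure lborel {1..<4::real} - measure lborel (E N)"
      unfolding B_def by (rule measure_Diff) (use fin sub in auto)
    then show "measure lborel B < 1/2" using N by simp
  qed
  have "\<bar>l k - l n\<bar> \<le> e" if n: "n \<ge> Suc N" and k: "k \<in> {n..2 * n}" for n k
  proof -
    have n0: "n > 0" "k > 0" using n k by auto
    \<comment> \<open>\<open>J m\<close> collects the j whose cell at scale m misses every settled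
      ratio. The exceptional set has measure below 1/2, so fewer than n / 2 candidates are lost at
      scale n and fewer than k / 2 \<le> n at scale k, out of 2 n.\<close>
    define J where "J m = {j \<in> {2*n..<4*n}. {real j / real m..<real (Suc j) / real m} \<inter> E N = {}}" for m
    have JB: "{real j / real m..<real (Suc j) / real m} \<subseteq> B" if "j \<in> J m" "m \<in> {n, k}" for j m
    proof -
      have m: "m > 0" "m \<le> 2 * n" "n \<le> m" using that k n0 by auto
      have "1 \<le> real j / real m" using that m by (simp add: J_def)
      moreover have "Suc j \<le> 4 * m" using that m by (simp add: J_def)
      then have "real (Suc j) / real m \<le> 4"
        using m by (simp add: divide_le_eq)
      ultimately show ?thesis using that by (force simp: J_def B_def)
    qed
    have "real (card (J n)) < 1/2 * real n"
      by (rule card_disjoint_cells_less[OF _ _ B]) (use JB n0 in \<open>auto simp: J_def\<close>)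
    moreover have "real (card (J k)) < 1/2 * real k"
      by (rule card_disjoint_cells_less[OF _ _ B]) (use JB n0 in \<open>auto simp: J_def\<close>)
    moreover have "real k \<le> 2 * real n" using k by auto
    moreover have "card (J n \<union> J k) \<le> card (J n) + card (J k)" by (rule card_Un_le)
    ultimately have "card (J n \<union> J k) < 2 * n" by linarith
    moreover have "card {2*n..<4*n} = 2 * n" by simp
    moreover have "J n \<union> J k \<subseteq> {2*n..<4*n}" by (auto simp: J_def)
    ultimately obtain j where j: "j \<in> {2*n..<4*n}" "j \<notin> J n" "j \<notin> J k" by (metis UnCI less_irrefl subset_antisym subsetI)
    have cell: "nat \<lfloor>x * real m\<rfloor> = j"
      if "x \<in> {real j / real m..<real (Suc j) / real m}" "m > 0" for x m
    proof -
      have "real j \<le> x * real m" "x * real m < real j + 1"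
        using that by (auto simp: field_simps)
      then have "\<lfloor>x * real m\<rfloor> = int j" by (simp add: floor_eq_iff)
      then show ?thesis by simp
    qed
    have "{real j / real n..<real (Suc j) / real n} \<inter> E N \<noteq> {}"
        "{real j / real k..<real (Suc j) / real k} \<inter> E N \<noteq> {}"
      using j unfolding J_def by blast+
    then obtain x x' where x: "x \<in> {real j / real n..<real (Suc j) / real n}" "x \<in> E N"
        and x': "x' \<in> {real j / real k..<real (Suc j) / real k}" "x' \<in> E N"
      by blast
    have "N \<le> n" "N \<le> k" using n k by auto
    have "\<bar>l (nat \<lfloor>x * real n\<rfloor>) - l n\<bar> \<le> e / 2" "\<bar>l (nat \<lfloor>x' * real k\<rfloor>) - l k\<bar> \<le> e / 2"
      using x(2) x'(2) \<open>N \<le> n\<close> \<open>N \<le> k\<close> unfolding E_def by blast+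
    then have "\<bar>l j - l n\<bar> \<le> e / 2" "\<bar>l j - l k\<bar> \<le> e / 2"
      using cell[OF x(1) n0(1)] cell[OF x'(1) n0(2)] by simp_all
    then show ?thesis by linarith
  qed
  then show ?thesis by blast
qed

lemma mem_sum_Suc: "mem_sum \<mu> (Suc n) = mem_sum \<mu> n + \<mu> (Suc n)"
  by (simp add: mem_sum_def)

lemma power_sum_asymptotics:
  assumes "\<gamma> > (-1::real)"
  shows "(\<lambda>n. mem_sum (\<lambda>k. real k powr \<gamma>) n / real n powr (\<gamma> + 1)) \<longlonglongrightarrow> 1 / (\<gamma> + 1)"
proof (rule stolz_cesaro)
  have g: "\<gamma> + 1 > 0" using assms by simp
  show "eventually (\<lambda>n. real n powr (\<gamma> + 1) < real (Suc n) powr (\<gamma> + 1)) sequentially"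
    by (intro always_eventually allI powr_less_mono2) (use g in auto)
  show "filterlim (\<lambda>n. real n powr (\<gamma> + 1)) at_top sequentially"
    using g by real_asymp
  have "(\<lambda>n. (real (Suc n) powr \<gamma>) / (real (Suc n) powr (\<gamma> + 1) - real n powr (\<gamma> + 1))) \<longlonglongrightarrow> 1 / (\<gamma> + 1)"
    using g by (simp add: divide_inverse) real_asymp
  then show "(\<lambda>n. (mem_sum (\<lambda>k. real k powr \<gamma>) (Suc n) - mem_sum (\<lambda>k. real k powr \<gamma>) n) /
      (real (Suc n) powr (\<gamma> + 1) - real n powr (\<gamma> + 1))) \<longlonglongrightarrow> 1 / (\<gamma> + 1)"
    by (simp add: mem_sum_Suc)
qed

text \<open>Write \<mu> n as n^\<gamma> exp (l n) with \<open>l\<close> slowly varying. The quotient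
  \<open>r n\<close> of the sum by n \<mu> n satisfies r n = th n r (n div 2) + h n, where
  \<open>th\<close> tends to (1/2)^(\<gamma>+1) < 1 and \<open>h\<close> comes from the indices
  above n div 2. There \<open>l\<close> is uniformly close to \<open>l n\<close>, so
  \<open>h\<close> has the limit it has for pure powers, and 1 / (\<gamma> + 1) is the fixed point
  of the limiting relation.\<close>

lemma regularly_varying_sum:
  assumes pos: "\<And>n. n \<ge> 1 \<Longrightarrow> \<mu> n > 0"
    and rv: "regularly_varying \<mu> \<gamma>" and g: "\<gamma> > -1"
  shows regularly_varying_ratio: "(\<lambda>n. \<mu> (Suc n) / \<mu> n) \<longlonglongrightarrow> 1"
    and regularly_varying_karamata: "(\<lambda>n. real n * \<mu> n / mem_sum \<mu> n) \<longlonglongrightarrow> \<gamma> + 1"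
proof -
  define l where "l n = ln (\<mu> n) - \<gamma> * ln (real n)" for n
  have mu_l: "\<mu> n = real n powr \<gamma> * exp (l n)" if "n \<ge> 1" for n
    using pos[OF that] that by (simp add: l_def powr_def exp_diff)
  have l0: "(\<lambda>n. l (nat \<lfloor>c * real n\<rfloor>) - l n) \<longlonglongrightarrow> 0" if c: "c > 0" for c
  proof -
    have "(\<lambda>n. \<mu> (nat \<lfloor>c * real n\<rfloor>) / \<mu> n) \<longlonglongrightarrow> c powr \<gamma>"
      using rv c by (simp add: regularly_varying_def)
    then have 1: "(\<lambda>n. ln (\<mu> (nat \<lfloor>c * real n\<rfloor>) / \<mu> n)) \<longlonglongrightarrow> ln (c powr \<gamma>)"
      using c by (intro tendsto_ln) auto
    have "(\<lambda>n. real_of_int \<lfloor>c * real n\<rfloor> / real n) \<longlonglongrightarrow> c"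
      using c by real_asymp
    then have 2: "(\<lambda>n. ln (real_of_int \<lfloor>c * real n\<rfloor> / real n)) \<longlonglongrightarrow> ln c"
      using c by (intro tendsto_ln) auto
    have "filterlim (\<lambda>n. c * real n) at_top sequentially"
      using c by real_asymp
    then have "eventually (\<lambda>n. c * real n \<ge> 1) sequentially"
      by (simp add: filterlim_at_top)
    with eventually_ge_at_top[of 1]
    have "eventually (\<lambda>n. ln (\<mu> (nat \<lfloor>c * real n\<rfloor>) / \<mu> n) - \<gamma> * ln (real_of_int \<lfloor>c * real n\<rfloor> / real n)
        = l (nat \<lfloor>c * real n\<rfloor>) - l n) sequentially"
    proof eventually_elim
      case (elim n)
      define m where "m = nat \<lfloor>c * real n\<rfloor>"
      have m: "real_of_int \<lfloor>c * real n\<rfloor> = real m" "m \<ge> 1"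
        using elim by (auto simp: m_def le_nat_iff)
      show ?case unfolding m m_def[symmetric]
        using m elim pos[of m] pos[of n] by (simp add: l_def ln_div algebra_simps)
    qed
    moreover have "(\<lambda>n. ln (\<mu> (nat \<lfloor>c * real n\<rfloor>) / \<mu> n) - \<gamma> * ln (real_of_int \<lfloor>c * real n\<rfloor> / real n)) \<longlonglongrightarrow> 0"
      using tendsto_diff[OF 1 tendsto_mult_left[OF 2, of \<gamma>]] c by (simp add: ln_powr)
    ultimately show ?thesis by (rule Lim_transform_eventually[rotated])
  qed
  have UC: "\<exists>N. \<forall>n\<ge>N. \<forall>k\<in>{n..2 * n}. \<bar>l k - l n\<bar> \<le> e" if "e > 0" for e
    by (rule slowly_varying_uniform[OF l0 that])

  have "(\<lambda>n. l (Suc n) - l n) \<longlonglongrightarrow> 0"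
  proof (rule LIMSEQ_I)
    fix r :: real assume "r > 0"
    then obtain N where N: "\<And>n k. n \<ge> N \<Longrightarrow> k \<in> {n..2 * n} \<Longrightarrow> \<bar>l k - l n\<bar> \<le> r / 2"
      using UC[of "r / 2"] by (metis half_gt_zero)
    have "norm (l (Suc n) - l n - 0) < r" if "n \<ge> max 1 N" for n
      using N[of n "Suc n"] that \<open>r > 0\<close> by auto
    then show "\<exists>no. \<forall>n\<ge>no. norm (l (Suc n) - l n - 0) < r" by blast
  qed
  then have 1: "(\<lambda>n. exp (l (Suc n) - l n)) \<longlonglongrightarrow> exp 0" by (rule tendsto_exp)
  have 2: "(\<lambda>n. (real (Suc n) / real n) powr \<gamma>) \<longlonglongrightarrow> 1" by real_asymp
  have "eventually (\<lambda>n. (real (Suc n) / real n) powr \<gamma> * exp (l (Suc n) - l n) = \<mu> (Suc n) / \<mu> n) sequentially"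
    using eventually_ge_at_top[of 1]
    by eventually_elim (simp add: mu_l powr_divide exp_diff)
  from Lim_transform_eventually[OF tendsto_mult[OF 2 1] this]
  show "(\<lambda>n. \<mu> (Suc n) / \<mu> n) \<longlonglongrightarrow> 1" by simp

  define q where "q = (1/2) powr (\<gamma> + 1)"
  define D where "D n = real n * \<mu> n" for n
  define r where "r n = mem_sum \<mu> n / D n" for n
  define P where "P = mem_sum (\<lambda>k. real k powr \<gamma>)"
  define Q where "Q n = (P n - P (n div 2)) / real n powr (\<gamma> + 1)" for n
  define th where "th n = D (n div 2) / D n" for n
  define h where "h n = (mem_sum \<mu> n - mem_sum \<mu> (n div 2)) / D n" for n
  have q: "q < 1" using powr_less_mono'[of "1/2" 0 "\<gamma> + 1"] g by (simp add: q_def)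
  have half: "filterlim (\<lambda>n::nat. n div 2) at_top sequentially" by real_asymp
  have half': "(\<lambda>n. real (n div 2) / real n) \<longlonglongrightarrow> 1/2" by real_asymp
  have floor_half: "nat \<lfloor>(1/2) * real n\<rfloor> = n div 2" for n
    using floor_divide_of_nat_eq[of n 2, where ?'a = real] by simp
  have th: "th \<longlonglongrightarrow> q"
  proof -
    have "(\<lambda>n. \<mu> (nat \<lfloor>(1/2) * real n\<rfloor>) / \<mu> n) \<longlonglongrightarrow> (1/2) powr \<gamma>"
      using rv[unfolded regularly_varying_def, rule_format, of "1/2"] by simp
    from tendsto_mult[OF half' this[unfolded floor_half]]
    show ?thesis by (simp add: th_def[abs_def] D_def q_def powr_add mult.commute)
  qed
  have Q: "Q \<longlonglongrightarrow> (1 - q) / (\<gamma> + 1)"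
  proof -
    have 1: "(\<lambda>n. P n / real n powr (\<gamma> + 1)) \<longlonglongrightarrow> 1 / (\<gamma> + 1)"
      unfolding P_def by (rule power_sum_asymptotics[OF g])
    have 2: "(\<lambda>n. (real (n div 2) / real n) powr (\<gamma> + 1)) \<longlonglongrightarrow> q"
      unfolding q_def by (intro tendsto_powr half') auto
    have 3: "(\<lambda>n. P (n div 2) / real (n div 2) powr (\<gamma> + 1)) \<longlonglongrightarrow> 1 / (\<gamma> + 1)"
      by (rule filterlim_compose[OF 1 half])
    have ev: "eventually (\<lambda>n. P n / real n powr (\<gamma> + 1) - (real (n div 2) / real n) powr (\<gamma> + 1) *
        (P (n div 2) / real (n div 2) powr (\<gamma> + 1)) = Q n) sequentially"
      using eventually_ge_at_top[of 2]
    proof eventually_elim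
      case (elim n)
      then have "real (n div 2) > 0" "real n > 0" by auto
      then show ?case by (simp add: Q_def powr_divide diff_divide_distrib)
    qed
    show ?thesis
      using Lim_transform_eventually[OF tendsto_diff[OF 1 tendsto_mult[OF 2 3]] ev]
      by (simp add: diff_divide_distrib)
  qed
  have block: "mem_sum f n - mem_sum f (n div 2) = sum f {n div 2<..n}" for f :: "nat \<Rightarrow> real" and n
  proof -
    have "{1..n} = {1..n div 2} \<union> {n div 2<..n}" by auto
    then have "sum f {1..n} = sum f {1..n div 2} + sum f {n div 2<..n}"
      by (simp only:) (rule sum.union_disjoint; auto)
    then show ?thesis by (simp add: mem_sum_def)
  qed
  have hQ: "(\<lambda>n. h n - Q n) \<longlonglongrightarrow> 0"
  proof (rule LIMSEQ_I)
    fix s :: real assume s: "s > 0"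
    \<comment> \<open>An eventual upper bound for \<open>Q\<close>. The oscillation \<open>e\<close>
      is then chosen so that the relative error exp e - 1 costs less than \<open>s\<close>.\<close>
    define B where "B = (1 - q) / (\<gamma> + 1) + 1"
    have B: "B > 0" using q g by (simp add: B_def add_pos_pos)
    have "eventually (\<lambda>n. Q n < B) sequentially"
      using Q by (rule order_tendstoD) (simp add: B_def)
    then obtain N1 where N1: "\<And>n. n \<ge> N1 \<Longrightarrow> Q n < B" by (auto simp: eventually_sequentially)
    have "((\<lambda>x. (exp x - 1) * B) \<longlongrightarrow> (exp 0 - 1) * B) (at_right (0::real))"
      by (intro tendsto_intros)
    then have "eventually (\<lambda>x::real. (exp x - 1) * B < s) (at_right 0)"
      using s by (intro order_tendstoD) auto
    then obtain e where e: "e > 0" "(exp e - 1) * B < s"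
      by (metis (no_types, lifting) eventually_at_right_field field_lbound_gt_zero zero_less_one dense)
    from UC[OF e(1)] obtain N where N: "\<And>n k. n \<ge> N \<Longrightarrow> k \<in> {n..2 * n} \<Longrightarrow> \<bar>l k - l n\<bar> \<le> e"
      by blast
    have "norm (h n - Q n - 0) < s" if n: "n \<ge> 2 * N + N1 + 2" for n
    proof -
      have n0: "n > 0" using n by simp
      have summand: "\<bar>\<mu> k / D n - real k powr \<gamma> / real n powr (\<gamma> + 1)\<bar>
          \<le> (exp e - 1) * (real k powr \<gamma> / real n powr (\<gamma> + 1))" if k: "k \<in> {n div 2<..n}" for k
      proof -
        have "\<bar>l n - l k\<bar> \<le> e" using k n by (intro N) auto
        then have le: "l k - l n \<le> e" "- e \<le> l k - l n" by auto
        have "exp (l k - l n) - 1 \<le> exp e - 1" using le by simp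
        \<comment> \<open>The downward deviation 1 - exp (-e) is at most e, and e is at most exp e -
          1.\<close>
        moreover have "1 - exp (l k - l n) \<le> exp e - 1"
        proof -
          have "1 - e \<le> exp (- e)" "1 + e \<le> exp e" "exp (- e) \<le> exp (l k - l n)"
            using exp_ge_add_one_self[of "- e"] exp_ge_add_one_self[of e] le by auto
          then show ?thesis by linarith
        qed
        ultimately have "\<bar>exp (l k - l n) - 1\<bar> \<le> exp e - 1" by linarith
        moreover have "\<mu> k / D n - real k powr \<gamma> / real n powr (\<gamma> + 1)
            = (exp (l k - l n) - 1) * (real k powr \<gamma> / real n powr (\<gamma> + 1))"
          using k n0 by (simp add: mu_l D_def powr_add exp_diff field_simps)
        ultimately show ?thesis
          by (simp only: abs_mult) (simp add: mult_right_mono divide_right_mono)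
      qed
      have "\<bar>h n - Q n\<bar> = \<bar>\<Sum>k\<in>{n div 2<..n}. \<mu> k / D n - real k powr \<gamma> / real n powr (\<gamma> + 1)\<bar>"
        by (simp add: h_def Q_def P_def block sum_divide_distrib sum_subtractf)
      also have "\<dots> \<le> (\<Sum>k\<in>{n div 2<..n}. (exp e - 1) * (real k powr \<gamma> / real n powr (\<gamma> + 1)))"
        by (rule order_trans[OF sum_abs sum_mono]) (rule summand)
      also have "\<dots> = (exp e - 1) * Q n"
        by (simp add: Q_def P_def block sum_divide_distrib sum_distrib_left)
      also have "\<dots> \<le> (exp e - 1) * B"
        using N1[of n] n e by (intro mult_left_mono) auto
      also have "\<dots> < s" by (fact e)
      finally show ?thesis by simp
    qed
    then show "\<exists>no. \<forall>n\<ge>no. norm (h n - Q n - 0) < s" by blast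
  qed
  have h: "h \<longlonglongrightarrow> (1 - q) / (\<gamma> + 1)"
    using tendsto_add[OF hQ Q] by simp
  have "(\<lambda>n. \<bar>r n - 1 / (\<gamma> + 1)\<bar>) \<longlonglongrightarrow> 0"
  proof (rule halving_contraction_tendsto_0[OF _ _ th q])
    show "(\<lambda>n. \<bar>th n * (1 / (\<gamma> + 1)) + h n - 1 / (\<gamma> + 1)\<bar>) \<longlonglongrightarrow> 0"
    proof -
      have "(\<lambda>n. th n * (1 / (\<gamma> + 1)) + h n - 1 / (\<gamma> + 1)) \<longlonglongrightarrow> q * (1 / (\<gamma> + 1)) + (1 - q) / (\<gamma> + 1) - 1 / (\<gamma> + 1)"
        by (intro tendsto_intros th h)
      also have "q * (1 / (\<gamma> + 1)) + (1 - q) / (\<gamma> + 1) - 1 / (\<gamma> + 1) = 0"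
        by (simp add: add_divide_distrib[symmetric] diff_divide_distrib[symmetric])
      finally show ?thesis by (rule tendsto_rabs_zero)
    qed
    show "eventually (\<lambda>n. \<bar>r n - 1 / (\<gamma> + 1)\<bar> \<le> th n * \<bar>r (n div 2) - 1 / (\<gamma> + 1)\<bar> +
        \<bar>th n * (1 / (\<gamma> + 1)) + h n - 1 / (\<gamma> + 1)\<bar>) sequentially"
      using eventually_ge_at_top[of 2]
    proof eventually_elim
      case (elim n)
      have D: "D n > 0" "D (n div 2) > 0" using elim pos[of n] pos[of "n div 2"] by (auto simp: D_def)
      have th0: "th n > 0" using D by (simp add: th_def)
      have "r n = th n * r (n div 2) + h n"
        using D by (simp add: r_def th_def h_def field_simps)
      then have "r n - 1 / (\<gamma> + 1) = th n * (r (n div 2) - 1 / (\<gamma> + 1)) + (th n * (1 / (\<gamma> + 1)) + h n - 1 / (\<gamma> + 1))"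
        by (simp add: algebra_simps)
      then have "\<bar>r n - 1 / (\<gamma> + 1)\<bar> \<le> \<bar>th n * (r (n div 2) - 1 / (\<gamma> + 1))\<bar> + \<bar>th n * (1 / (\<gamma> + 1)) + h n - 1 / (\<gamma> + 1)\<bar>"
        by (simp only: abs_triangle_ineq)
      then show ?case using th0 by (simp only: abs_mult abs_of_pos)
    qed
  qed auto
  then have "r \<longlonglongrightarrow> 1 / (\<gamma> + 1)"
    using tendsto_rabs_zero_cancel LIM_zero_iff by blast
  then have "(\<lambda>n. inverse (r n)) \<longlonglongrightarrow> inverse (1 / (\<gamma> + 1))"
    by (rule tendsto_inverse) (use g in auto)
  then show "(\<lambda>n. real n * \<mu> n / mem_sum \<mu> n) \<longlonglongrightarrow> \<gamma> + 1"
    by (simp add: r_def[abs_def] D_def)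
qed

section \<open>Kronecker's lemma and weighted averages\<close>

lemma kronecker:
  fixes b x :: "nat \<Rightarrow> real"
  assumes inc: "eventually (\<lambda>n. b n < b (Suc n)) sequentially"
    and top: "filterlim b at_top sequentially"
    and conv: "convergent (\<lambda>n. \<Sum>k<n. x k)"
  shows "(\<lambda>n. (\<Sum>k<n. b (Suc k) * x k) / b n) \<longlonglongrightarrow> 0"
proof -
  define R where "R n = (\<Sum>k<n. x k)" for n
  from conv obtain r where R: "R \<longlonglongrightarrow> r" by (auto simp: convergent_def R_def[abs_def])
  \<comment> \<open>Summation by parts: the increment of \<open>Z\<close> is that of
    \<open>b\<close> times \<open>R n\<close>, so Stolz-Cesaro gives \<open>Z n / b n\<close> the
    same limit as \<open>R\<close>, and the two cancel.\<close>
  define Z where "Z n = b n * R n - (\<Sum>k<n. b (Suc k) * x k)" for n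
  have "Z (Suc n) - Z n = (b (Suc n) - b n) * R n" for n
    by (simp add: Z_def R_def algebra_simps)
  then have "eventually (\<lambda>n. R n = (Z (Suc n) - Z n) / (b (Suc n) - b n)) sequentially"
    using inc by (auto elim!: eventually_mono)
  from stolz_cesaro[OF inc top Lim_transform_eventually[OF R this]]
  have "(\<lambda>n. R n - Z n / b n) \<longlonglongrightarrow> r - r" by (intro tendsto_diff R)
  moreover have "eventually (\<lambda>n. R n - Z n / b n = (\<Sum>k<n. b (Suc k) * x k) / b n) sequentially"
    using filterlim_at_top_dense[THEN iffD1, OF top, rule_format, of 0]
    by eventually_elim (simp add: Z_def field_simps)
  ultimately show ?thesis by (simp add: Lim_transform_eventually)
qed

lemma weighted_average_tendsto:
  fixes c m :: "nat \<Rightarrow> real"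
  assumes pos: "\<And>n. n \<ge> 1 \<Longrightarrow> c n > 0"
    and top: "filterlim (\<lambda>n. \<Sum>k=1..<n. c k) at_top sequentially"
    and m: "m \<longlonglongrightarrow> L"
  shows "(\<lambda>n. (\<Sum>k=1..<n. c k * m k) / (\<Sum>k=1..<n. c k)) \<longlonglongrightarrow> L"
proof (rule stolz_cesaro[OF _ top])
  have step: "(\<Sum>k=1..<Suc n. f k) = (\<Sum>k=1..<n. f k) + f n" if "n \<ge> 1" for f :: "nat \<Rightarrow> real" and n
    using that by (rule sum.atLeastLessThan_Suc)
  show "\<forall>\<^sub>F n in sequentially. (\<Sum>k=1..<n. c k) < (\<Sum>k=1..<Suc n. c k)"
    using eventually_ge_at_top[of 1] by eventually_elim (simp only: step pos less_add_same_cancel1)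
  show "(\<lambda>n. ((\<Sum>k=1..<Suc n. c k * m k) - (\<Sum>k=1..<n. c k * m k)) /
            ((\<Sum>k=1..<Suc n. c k) - (\<Sum>k=1..<n. c k))) \<longlonglongrightarrow> L"
  proof (rule Lim_transform_eventually[OF m])
    show "\<forall>\<^sub>F n in sequentially. m n = ((\<Sum>k=1..<Suc n. c k * m k) - (\<Sum>k=1..<n. c k * m k)) /
            ((\<Sum>k=1..<Suc n. c k) - (\<Sum>k=1..<n. c k))"
      using eventually_ge_at_top[of 1]
    proof eventually_elim
      case (elim n)
      then show ?case using pos[of n] by (simp only: step) simp
    qed
  qed
qed

section \<open>Growth of the normalising sequences\<close>

locale memory_sequence =
  fixes p \<gamma> :: real and \<mu> :: "nat \<Rightarrow> real"
  assumes p_bounds: "0 \<le> p" "p \<le> 1"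
    and gamma_bound: "\<gamma> > -1"
    and memory_pos: "\<And>n. n \<ge> 1 \<Longrightarrow> \<mu> n > 0"
    and memory_regvar: "regularly_varying \<mu> \<gamma>"
begin

abbreviation "\<nu> \<equiv> mem_sum \<mu>"
abbreviation "a \<equiv> coeff_a p \<mu>"

definition "c n = 1 / (a n * \<nu> n)"
definition "b n = real n * c n"
text \<open>The squares of \<open>d\<close>, summed from index 1, are the square of
  \<open>coeff_v\<close>; boundedness of v_n is their summability.\<close>

definition "d n = a n * \<mu> n"
definition "\<rho> = p * (\<gamma> + 1) - \<gamma>"

lemma mem_sum_pos: "n \<ge> 1 \<Longrightarrow> \<nu> n > 0"
  unfolding mem_sum_def by (rule sum_pos) (auto intro: memory_pos)

lemma growth_factor_pos: "n \<ge> 1 \<Longrightarrow> 1 + p * (\<mu> (Suc n) / \<nu> n) > 0"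
  using p_bounds memory_pos[of "Suc n"] mem_sum_pos[of n]
  by (intro add_pos_nonneg mult_nonneg_nonneg divide_nonneg_nonneg) auto

lemma coeff_a_pos: "a n > 0"
  unfolding coeff_a_def using growth_factor_pos by (intro prod_pos) auto

lemma coeff_a_Suc:
  assumes "n \<ge> 1" shows "a (Suc n) * (1 + p * (\<mu> (Suc n) / \<nu> n)) = a n"
proof -
  have "a (Suc n) = a n * inverse (1 + p * (\<mu> (Suc n) / \<nu> n))"
    unfolding coeff_a_def using assms by (subst prod.atLeastLessThan_Suc) auto
  then show ?thesis using growth_factor_pos[OF assms] by simp
qed

lemma d_pos: "n \<ge> 1 \<Longrightarrow> d n > 0"
  by (simp add: d_def coeff_a_pos memory_pos)

lemma c_pos: "n \<ge> 1 \<Longrightarrow> c n > 0"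
  by (simp add: c_def coeff_a_pos mem_sum_pos)

lemma b_pos: "n \<ge> 1 \<Longrightarrow> b n > 0"
  by (simp add: b_def c_pos)

lemma memory_share_limit: "(\<lambda>n. real n * (\<mu> (Suc n) / \<nu> n)) \<longlonglongrightarrow> \<gamma> + 1"
proof -
  note lim = regularly_varying_ratio[OF memory_pos memory_regvar gamma_bound]
    regularly_varying_karamata[OF memory_pos memory_regvar gamma_bound]
  have "eventually (\<lambda>n. (\<mu> (Suc n) / \<mu> n) * (real n * \<mu> n / \<nu> n) = real n * (\<mu> (Suc n) / \<nu> n)) sequentially"
    using eventually_ge_at_top[of 1]
    by eventually_elim (use memory_pos in \<open>force simp: field_simps\<close>)
  from Lim_transform_eventually[OF tendsto_mult[OF lim] this] show ?thesis by simp
qed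

lemma d_b_limit: "(\<lambda>n. d n * b n) \<longlonglongrightarrow> \<gamma> + 1"
proof -
  have "d n * b n = real n * \<mu> n / \<nu> n" for n
    using coeff_a_pos[of n] by (simp add: d_def b_def c_def field_simps)
  then show ?thesis
    using regularly_varying_karamata[OF memory_pos memory_regvar gamma_bound] by simp
qed

text \<open>With \<delta> = \<mu> (n+1) / \<nu> n one has c (n+1) / c n = (1 + p \<delta>) / (1 +
  \<delta>). Since n \<delta> tends to \<gamma> + 1, the numerator (n+1) (1 + p \<delta>) - n (1 +
  \<delta>) tends to 1 + p (\<gamma> + 1) - (\<gamma> + 1) = \<rho>.\<close>

lemma b_increment_limit: "(\<lambda>n. (b (Suc n) - b n) / c n) \<longlonglongrightarrow> \<rho>"
proof -
  define \<delta> where "\<delta> n = \<mu> (Suc n) / \<nu> n" for n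
  have 1: "(\<lambda>n. real n * \<delta> n) \<longlonglongrightarrow> \<gamma> + 1"
    using memory_share_limit by (simp add: \<delta>_def)
  have "(\<lambda>n. (real n * \<delta> n) * (1 / real n)) \<longlonglongrightarrow> (\<gamma> + 1) * 0"
    by (intro tendsto_mult 1) real_asymp
  moreover have "eventually (\<lambda>n. (real n * \<delta> n) * (1 / real n) = \<delta> n) sequentially"
    using eventually_ge_at_top[of 1] by eventually_elim simp
  ultimately have 2: "\<delta> \<longlonglongrightarrow> 0" by (simp add: Lim_transform_eventually)
  have "(\<lambda>n. (1 + p * (real n * \<delta> n) + p * \<delta> n - real n * \<delta> n) / (1 + \<delta> n))
      \<longlonglongrightarrow> (1 + p * (\<gamma> + 1) + p * 0 - (\<gamma> + 1)) / (1 + 0)"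
    by (intro tendsto_intros 1 2) auto
  moreover have "eventually (\<lambda>n. (1 + p * (real n * \<delta> n) + p * \<delta> n - real n * \<delta> n) / (1 + \<delta> n)
      = (b (Suc n) - b n) / c n) sequentially"
    using eventually_ge_at_top[of 1]
  proof eventually_elim
    case (elim n)
    have \<nu>: "\<nu> n > 0" using elim by (simp add: mem_sum_pos)
    have \<delta>: "\<delta> n > 0" using elim memory_pos[of "Suc n"] \<nu> by (simp add: \<delta>_def)
    have "\<nu> (Suc n) = \<nu> n * (1 + \<delta> n)" using \<nu> by (simp add: mem_sum_Suc \<delta>_def field_simps)
    moreover have "a n = a (Suc n) * (1 + p * \<delta> n)"
      using coeff_a_Suc[OF elim] by (simp add: \<delta>_def)
    moreover have "1 + p * \<delta> n > 0" using growth_factor_pos[OF elim] by (simp add: \<delta>_def)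
    ultimately have "c (Suc n) / c n = (1 + p * \<delta> n) / (1 + \<delta> n)"
      using \<nu> coeff_a_pos[of "Suc n"] by (simp add: c_def)
    moreover have "(b (Suc n) - b n) / c n = real (Suc n) * (c (Suc n) / c n) - real n"
      using c_pos[OF elim] by (simp add: b_def diff_divide_distrib)
    ultimately have "(b (Suc n) - b n) / c n = real (Suc n) * ((1 + p * \<delta> n) / (1 + \<delta> n)) - real n"
      by simp
    then show ?case using \<delta> by (simp add: field_simps)
  qed
  ultimately show ?thesis by (simp add: Lim_transform_eventually \<rho>_def)
qed

context
  assumes \<rho>_pos: "\<rho> > 0"
begin

lemma b_eventually_increasing: "eventually (\<lambda>n. b n < b (Suc n)) sequentially"
  using order_tendstoD(1)[OF b_increment_limit \<rho>_pos] eventually_ge_at_top[of 1]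
  by eventually_elim (use c_pos in \<open>auto simp: zero_less_divide_iff dest: less_asym\<close>)

text \<open>As \<open>b\<close> eventually increases, c n = b n / n stays above a multiple of 1 / n,
  and the harmonic series diverges.\<close>

lemma sum_c_at_top: "filterlim (\<lambda>n. \<Sum>k=1..<n. c k) at_top sequentially"
proof -
  obtain N0 where N0: "\<And>n. n \<ge> N0 \<Longrightarrow> b n < b (Suc n)"
    using b_eventually_increasing by (auto simp: eventually_sequentially)
  define N where "N = max 1 N0"
  have "b N \<le> b n" if "n \<ge> N" for n
    using that by (induction rule: dec_induct) (use N0 in \<open>force simp: N_def\<close>)+
  then have lower: "b N * (1 / real n) \<le> c n" if "n \<ge> N" for n
    using that by (simp add: b_def N_def field_simps)
  have bN: "b N > 0" by (simp add: b_pos N_def)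
  have ns: "\<not> summable c"
  proof
    assume "summable c"
    then have "summable (\<lambda>n. b N * (1 / real n))"
      by (rule summable_comparison_test'[where N = N]) (use lower bN in auto)
    then have "summable (\<lambda>n. 1 / real n)" using bN by (subst (asm) summable_cmult_iff) auto
    then show False using not_summable_harmonic[where 'a = real] by (simp add: inverse_eq_divide)
  qed
  have c0: "c n \<ge> 0" for n by (cases "n = 0") (use c_pos[of n] in \<open>auto simp: c_def mem_sum_def\<close>)
  \<comment> \<open>Index 0 contributes nothing: \<nu> 0 = 0, and division by zero makes c 0 =
    0.\<close>
  have shift: "(\<Sum>k<n. c k) = (\<Sum>k=1..<n. c k)" for n
  proof (rule sum.mono_neutral_right)
    show "\<forall>i\<in>{..<n} - {1..<n}. c i = 0" by (auto simp: c_def mem_sum_def not_le)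
  qed auto
  have "filterlim (\<lambda>n. \<Sum>k<n. c k) at_top sequentially"
    unfolding filterlim_at_top
  proof
    fix Z
    have "\<exists>n. (\<Sum>k<n. c k) > Z"
    proof (rule ccontr)
      assume "\<not> ?thesis"
      then have "summable c" using c0 by (intro bounded_imp_summable[where B = Z] c0) (metis lessThan_Suc_atMost not_less)
      then show False using ns by simp
    qed
    then obtain n where "(\<Sum>k<n. c k) > Z" ..
    moreover have "(\<Sum>k<n. c k) \<le> (\<Sum>k<m. c k)" if "m \<ge> n" for m
      using that c0 by (intro sum_mono2) auto
    ultimately show "eventually (\<lambda>n. Z \<le> (\<Sum>k<n. c k)) sequentially"
      unfolding eventually_sequentially by (meson less_imp_le order_trans)
  qed
  then show ?thesis by (simp only: shift)
qed

text \<open>Stolz-Cesaro replaces the sum by b n / \<rho>, and d n b n has a limit by Karamata's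
  theorem. Multiplied by p, the value is the constant of the theorem.\<close>

lemma d_sum_c_limit: "(\<lambda>n. d n * (\<Sum>k=1..<n. c k)) \<longlonglongrightarrow> (\<gamma> + 1) / \<rho>"
proof -
  have step: "(\<Sum>k=1..<Suc n. c k) = (\<Sum>k=1..<n. c k) + c n" if "n \<ge> 1" for n
    using that by (rule sum.atLeastLessThan_Suc)
  have inc: "eventually (\<lambda>n. (\<Sum>k=1..<n. c k) < (\<Sum>k=1..<Suc n. c k)) sequentially"
    using eventually_ge_at_top[of 1]
    by eventually_elim (simp only: step c_pos less_add_same_cancel1)
  have ev: "eventually (\<lambda>n. (b (Suc n) - b n) / c n = (b (Suc n) - b n) / ((\<Sum>k=1..<Suc n. c k) - (\<Sum>k=1..<n. c k))) sequentially"
    using eventually_ge_at_top[of 1]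
    by eventually_elim (simp only: step add_diff_cancel_left')
  have "(\<lambda>n. b n / (\<Sum>k=1..<n. c k)) \<longlonglongrightarrow> \<rho>"
    by (rule stolz_cesaro[OF inc sum_c_at_top]) (rule Lim_transform_eventually[OF b_increment_limit ev])
  then have "(\<lambda>n. (d n * b n) / (b n / (\<Sum>k=1..<n. c k))) \<longlonglongrightarrow> (\<gamma> + 1) / \<rho>"
    using \<rho>_pos by (intro tendsto_divide d_b_limit) auto
  moreover have "eventually (\<lambda>n. (d n * b n) / (b n / (\<Sum>k=1..<n. c k)) = d n * (\<Sum>k=1..<n. c k)) sequentially"
    using eventually_ge_at_top[of 1]
  proof eventually_elim
    case (elim n) then show ?case using b_pos[OF elim] by simp
  qed
  ultimately show ?thesis by (rule Lim_transform_eventually)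
qed

context
  assumes d_summable: "summable (\<lambda>n. (d n)\<^sup>2)"
begin

text \<open>Since d n b n eventually exceeds (\<gamma> + 1) / 2, the reciprocal of b n is at most a
  constant times d n.\<close>

lemma inverse_b_summable: "summable (\<lambda>n. (1 / b n)\<^sup>2)"
proof -
  have g: "(\<gamma> + 1) / 2 < \<gamma> + 1" "0 < (\<gamma> + 1) / 2" using gamma_bound by auto
  have ev: "eventually (\<lambda>n. norm ((1 / b n)\<^sup>2) \<le> (2 / (\<gamma> + 1))\<^sup>2 * (d n)\<^sup>2) sequentially"
    using order_tendstoD(1)[OF d_b_limit g(1)] eventually_ge_at_top[of 1]
  proof eventually_elim
    case (elim n)
    have "1 / b n \<le> 2 / (\<gamma> + 1) * d n"
      using elim g b_pos[of n] by (simp add: field_simps)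
    then have "(1 / b n)\<^sup>2 \<le> (2 / (\<gamma> + 1) * d n)\<^sup>2"
      using b_pos[of n] elim by (intro power_mono) auto
    then show ?case by (simp only: power_mult_distrib[symmetric]) simp
  qed
  show ?thesis
    by (rule summable_comparison_test_ev[OF ev]) (intro summable_mult d_summable)
qed

lemma b_at_top: "filterlim b at_top sequentially"
proof -
  have "(\<lambda>n. sqrt ((1 / b n)\<^sup>2)) \<longlonglongrightarrow> sqrt 0"
    by (intro tendsto_real_sqrt summable_LIMSEQ_zero inverse_b_summable)
  then have "(\<lambda>n. \<bar>inverse (b n)\<bar>) \<longlonglongrightarrow> 0" by (simp add: inverse_eq_divide)
  then have "(\<lambda>n. inverse (b n)) \<longlonglongrightarrow> 0" by (rule tendsto_rabs_zero_cancel)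
  moreover have "eventually (\<lambda>n. 0 < inverse (b n)) sequentially"
    using eventually_ge_at_top[of 1] by eventually_elim (simp add: b_pos)
  ultimately have "filterlim (\<lambda>n. inverse (inverse (b n))) at_top sequentially"
    by (rule filterlim_inverse_at_top)
  then show ?thesis by simp
qed

text \<open>A summable sequence that eventually decreases is o(1/n): about n / 2 terms between n / 2
  and n are at least as large as the last one, and their sum tends to 0. This is applied to the
  squares of 1 / b n and carried over to \<open>d\<close> by the limit of d n b n.\<close>

lemma n_d_squared_limit: "(\<lambda>n. real n * (d n)\<^sup>2) \<longlonglongrightarrow> 0"
proof -
  define s where "s n = (\<Sum>k<n. (1 / b k)\<^sup>2)" for n
  have s: "s \<longlonglongrightarrow> (\<Sum>k. (1 / b k)\<^sup>2)"
    using summable_LIMSEQ[OF inverse_b_summable] by (simp add: s_def[abs_def])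
  have half: "filterlim (\<lambda>n::nat. Suc (n div 2)) at_top sequentially" by real_asymp
  have lim: "(\<lambda>n. 2 * (s (Suc n) - s (Suc (n div 2)))) \<longlonglongrightarrow> 2 * ((\<Sum>k. (1 / b k)\<^sup>2) - (\<Sum>k. (1 / b k)\<^sup>2))"
    by (intro tendsto_intros filterlim_compose[OF s half] LIMSEQ_Suc s)
  obtain N0 where N0: "\<And>n. n \<ge> N0 \<Longrightarrow> b n < b (Suc n)"
    using b_eventually_increasing by (auto simp: eventually_sequentially)
  define N where "N = max 1 N0"
  have mono: "b m \<le> b n" if "N \<le> m" "m \<le> n" for m n
    using that(2)
  proof (induction rule: dec_induct)
    case (step k)
    then show ?case using N0[of k] that(1) by (simp add: N_def)
  qed simp
  have "(\<lambda>n. real n * (1 / b n)\<^sup>2) \<longlonglongrightarrow> 0"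
  proof (rule tendsto_sandwich)
    show "eventually (\<lambda>n. 0 \<le> real n * (1 / b n)\<^sup>2) sequentially" by simp
    show "eventually (\<lambda>n. real n * (1 / b n)\<^sup>2 \<le> 2 * (s (Suc n) - s (Suc (n div 2)))) sequentially"
      using eventually_ge_at_top[of "2 * N"]
    proof eventually_elim
      case (elim n)
      have split: "s (Suc n) = s (Suc (n div 2)) + (\<Sum>k=Suc (n div 2)..n. (1 / b k)\<^sup>2)"
        unfolding s_def lessThan_atLeast0 atLeastLessThanSuc_atLeastAtMost[symmetric]
        by (rule sum.atLeastLessThan_concat[symmetric]) auto
      have "real (n - n div 2) * (1 / b n)\<^sup>2 = (\<Sum>k=Suc (n div 2)..n. (1 / b n)\<^sup>2)" by simp
      also have "\<dots> \<le> (\<Sum>k=Suc (n div 2)..n. (1 / b k)\<^sup>2)"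
      proof (rule sum_mono)
        fix k assume k: "k \<in> {Suc (n div 2)..n}"
        have "b k \<le> b n" using elim k by (intro mono) auto
        moreover have "0 < b k" using k b_pos[of k] by simp
        ultimately have "1 / b n \<le> 1 / b k" "0 \<le> 1 / b n" by (simp_all add: frac_le)
        then show "(1 / b n)\<^sup>2 \<le> (1 / b k)\<^sup>2" by (rule power_mono)
      qed
      also have "\<dots> = s (Suc n) - s (Suc (n div 2))" using split by simp
      finally have "2 * (real (n - n div 2) * (1 / b n)\<^sup>2) \<le> 2 * (s (Suc n) - s (Suc (n div 2)))" by simp
      moreover have "real n \<le> 2 * real (n - n div 2)" by linarith
      then have "real n * (1 / b n)\<^sup>2 \<le> (2 * real (n - n div 2)) * (1 / b n)\<^sup>2"
        by (intro mult_right_mono zero_le_power2)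
      ultimately show ?case by (simp only: mult.assoc)
    qed
    show "(\<lambda>n. 2 * (s (Suc n) - s (Suc (n div 2)))) \<longlonglongrightarrow> 0" using lim by simp
  qed auto
  from tendsto_mult[OF this tendsto_power[OF d_b_limit, of 2]]
  have "(\<lambda>n. (real n * (1 / b n)\<^sup>2) * (d n * b n)\<^sup>2) \<longlonglongrightarrow> 0" by simp
  moreover have "eventually (\<lambda>n. (real n * (1 / b n)\<^sup>2) * (d n * b n)\<^sup>2 = real n * (d n)\<^sup>2) sequentially"
    using eventually_ge_at_top[of 1]
  proof eventually_elim
    case (elim n) then show ?case using b_pos[OF elim] by (simp add: power_mult_distrib power_divide)
  qed
  ultimately show ?thesis by (rule Lim_transform_eventually)
qed

end

end

end

section \<open>Square-integrable orthogonal noise\<close>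

lemma square_integrable_mult_integrable:
  assumes "square_integrable M f" "square_integrable M g"
  shows "integrable M (\<lambda>x. f x * g x :: real)"
proof (rule Bochner_Integration.integrable_bound)
  show "integrable M (\<lambda>x. (f x)\<^sup>2 + (g x)\<^sup>2)" "(\<lambda>x. f x * g x) \<in> borel_measurable M"
    using assms by (auto simp: square_integrable_def)
  have "\<bar>u * v\<bar> \<le> u\<^sup>2 + v\<^sup>2" for u v :: real
    using sum_squares_bound[of "\<bar>u\<bar>" "\<bar>v\<bar>"] abs_ge_zero[of "u * v"]
    unfolding power2_abs mult.assoc abs_mult by linarith
  then show "AE x in M. norm (f x * g x) \<le> norm ((f x)\<^sup>2 + (g x)\<^sup>2)" by simp
qed

lemma square_integrable_add:
  assumes "square_integrable M f" "square_integrable M g"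
  shows "square_integrable M (\<lambda>x. f x + g x)"
proof -
  have "integrable M (\<lambda>x. (f x)\<^sup>2 + (g x)\<^sup>2 + 2 * (f x * g x))"
    using assms square_integrable_mult_integrable[OF assms]
    by (auto simp: square_integrable_def)
  then show ?thesis
    using assms by (auto simp: square_integrable_def power2_sum mult.assoc)
qed

lemma square_integrable_cmult:
  "square_integrable M f \<Longrightarrow> square_integrable M (\<lambda>x. k * f x)"
  by (auto simp: square_integrable_def power_mult_distrib)

lemma square_integrable_diff:
  assumes "square_integrable M f" "square_integrable M g"
  shows "square_integrable M (\<lambda>x. f x - g x)"
  using square_integrable_add[OF assms(1) square_integrable_cmult[OF assms(2), of "-1"]] by simp

lemma square_integrable_zero: "square_integrable M (\<lambda>x. 0)"
  by (simp add: square_integrable_def)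

lemma square_integrable_sum:
  "(\<And>i. i \<in> I \<Longrightarrow> square_integrable M (f i)) \<Longrightarrow> square_integrable M (\<lambda>x. \<Sum>i\<in>I. f i x)"
  by (induction I rule: infinite_finite_induct)
     (auto intro!: square_integrable_add square_integrable_zero)

lemma square_integrable_bounded_mult:
  assumes "g \<in> borel_measurable M" "\<And>x. \<bar>g x\<bar> \<le> K" "square_integrable M f"
  shows "square_integrable M (\<lambda>x. g x * f x)"
  unfolding square_integrable_def
proof (intro conjI)
  show "integrable M (\<lambda>x. (g x * f x)\<^sup>2)"
  proof (rule Bochner_Integration.integrable_bound)
    show "integrable M (\<lambda>x. K\<^sup>2 * (f x)\<^sup>2)" "(\<lambda>x. (g x * f x)\<^sup>2) \<in> borel_measurable M"
      using assms by (auto simp: square_integrable_def)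
    have "(g x)\<^sup>2 \<le> K\<^sup>2" for x using assms(2)[of x] by (rule abs_le_square_iff[THEN iffD1, OF order_trans]) simp
    then show "AE x in M. norm ((g x * f x)\<^sup>2) \<le> norm (K\<^sup>2 * (f x)\<^sup>2)"
      by (auto simp: power_mult_distrib intro!: mult_right_mono)
  qed
qed (use assms in \<open>auto simp: square_integrable_def\<close>)

text \<open>A passage to the limit without domination. It serves the L2 limits of series and, later,
  the fourth moment of the martingale limit.\<close>

lemma fatou_integral_bound:
  fixes f :: "nat \<Rightarrow> 'a \<Rightarrow> real"
  assumes f: "\<And>n. integrable M (f n)" "\<And>n x. 0 \<le> f n x"
    and g: "g \<in> borel_measurable M"
    and lim: "AE x in M. (\<lambda>n. f n x) \<longlonglongrightarrow> g x"
    and bound: "eventually (\<lambda>n. integral\<^sup>L M (f n) \<le> K) sequentially"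
  shows "integrable M g" "integral\<^sup>L M g \<le> K"
proof -
  obtain n where "integral\<^sup>L M (f n) \<le> K" using bound by (auto simp: eventually_sequentially)
  then have K: "K \<ge> 0" using f by (meson Bochner_Integration.integral_nonneg order_trans)
  have g0: "AE x in M. 0 \<le> g x"
    using lim by eventually_elim (rule LIMSEQ_le_const, auto simp: f)
  have "(\<integral>\<^sup>+x. ennreal (g x) \<partial>M) = (\<integral>\<^sup>+x. liminf (\<lambda>n. ennreal (f n x)) \<partial>M)"
  proof (rule nn_integral_cong_AE)
    show "AE x in M. ennreal (g x) = liminf (\<lambda>n. ennreal (f n x))"
      using lim
    proof eventually_elim
      case (elim x)
      then have "(\<lambda>n. ennreal (f n x)) \<longlonglongrightarrow> ennreal (g x)" by (rule tendsto_ennrealI)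
      then show ?case by (simp add: lim_imp_Liminf)
    qed
  qed
  also have "\<dots> \<le> liminf (\<lambda>n. \<integral>\<^sup>+x. ennreal (f n x) \<partial>M)"
    by (rule nn_integral_liminf) (use f in auto)
  also have "\<dots> \<le> ennreal K"
  proof -
    have "eventually (\<lambda>n. (\<integral>\<^sup>+x. ennreal (f n x) \<partial>M) \<le> ennreal K) sequentially"
      using bound by eventually_elim (simp add: nn_integral_eq_integral f ennreal_leI)
    then have "liminf (\<lambda>n. \<integral>\<^sup>+x. ennreal (f n x) \<partial>M) \<le> liminf (\<lambda>n::nat. ennreal K)"
      by (rule Liminf_mono)
    then show ?thesis by (simp add: Liminf_const)
  qed
  finally have le: "(\<integral>\<^sup>+x. ennreal (g x) \<partial>M) \<le> ennreal K" .
  show int: "integrable M g"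
  proof (rule integrableI_bounded)
    have "(\<integral>\<^sup>+x. ennreal (norm (g x)) \<partial>M) = (\<integral>\<^sup>+x. ennreal (g x) \<partial>M)"
      by (rule nn_integral_cong_AE) (use g0 in \<open>auto elim!: eventually_mono\<close>)
    also have "\<dots> < \<infinity>" using le by (simp add: le_less_trans)
    finally show "(\<integral>\<^sup>+x. ennreal (norm (g x)) \<partial>M) < \<infinity>" .
  qed fact
  show "integral\<^sup>L M g \<le> K"
    using le K by (simp add: nn_integral_eq_integral[OF int g0])
qed

text \<open>Martingale differences in weak form: orthogonality to square-integrable functions of the
  past stands in for a vanishing conditional expectation.\<close>

locale orthogonal_noise = prob_space P for P :: "'a measure" +
  fixes F :: "nat \<Rightarrow> 'a measure" and e :: "nat \<Rightarrow> 'a \<Rightarrow> real"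
  assumes F_sub: "\<And>n. subalgebra P (F n)"
    and F_mono: "\<And>m n. m \<le> n \<Longrightarrow> sets (F m) \<subseteq> sets (F n)"
    and e_adapted: "\<And>n. e n \<in> borel_measurable (F (Suc n))"
    and e_square_integrable: "\<And>n. square_integrable P (e n)"
    and e_second_moment: "\<And>n. (\<integral>\<omega>. (e n \<omega>)\<^sup>2 \<partial>P) \<le> 1"
    and e_orthogonal: "\<And>n g. g \<in> borel_measurable (F n) \<Longrightarrow> square_integrable P g \<Longrightarrow>
       (\<integral>\<omega>. g \<omega> * e n \<omega> \<partial>P) = 0"
begin

lemma adapted_mono:
  assumes "m \<le> n" "f \<in> borel_measurable (F m)" shows "f \<in> borel_measurable (F n)"
proof -
  have "subalgebra (F n) (F m)"
    using F_sub[of n] F_sub[of m] F_mono[OF assms(1)] by (simp add: subalgebra_def)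
  then show ?thesis using assms(2) by (rule measurable_from_subalg)
qed

text \<open>In the square of the sum the cross term vanishes, because \<open>G n\<close> times the
  earlier sum is a function of the past. Constant bounds on the factors keep all products
  square-integrable.\<close>

lemma predictable_transform:
  assumes G: "\<And>j. G j \<in> borel_measurable (F j)" "\<And>j \<omega>. \<bar>G j \<omega>\<bar> \<le> w j"
  shows predictable_transform_adapted: "(\<lambda>\<omega>. \<Sum>j<n. G j \<omega> * e j \<omega>) \<in> borel_measurable (F n)"
    and predictable_transform_square_integrable: "square_integrable P (\<lambda>\<omega>. \<Sum>j<n. G j \<omega> * e j \<omega>)"
    and predictable_transform_second_moment:
      "(\<integral>\<omega>. (\<Sum>j<n. G j \<omega> * e j \<omega>)\<^sup>2 \<partial>P) \<le> (\<Sum>j<n. (w j)\<^sup>2)"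
proof -
  have Ge: "square_integrable P (\<lambda>\<omega>. G j \<omega> * e j \<omega>)" for j
    by (rule square_integrable_bounded_mult[OF measurable_from_subalg[OF F_sub G(1)] G(2) e_square_integrable])
  have ad: "(\<lambda>\<omega>. \<Sum>j<n. G j \<omega> * e j \<omega>) \<in> borel_measurable (F n)" for n
  proof (rule borel_measurable_sum)
    fix j assume "j \<in> {..<n}"
    then show "(\<lambda>\<omega>. G j \<omega> * e j \<omega>) \<in> borel_measurable (F n)"
      by (intro borel_measurable_times adapted_mono[OF _ G(1)] adapted_mono[OF _ e_adapted]) auto
  qed
  show "(\<lambda>\<omega>. \<Sum>j<n. G j \<omega> * e j \<omega>) \<in> borel_measurable (F n)" by (rule ad)
  have si: "square_integrable P (\<lambda>\<omega>. \<Sum>j<n. G j \<omega> * e j \<omega>)" for n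
    by (rule square_integrable_sum[OF Ge])
  show "square_integrable P (\<lambda>\<omega>. \<Sum>j<n. G j \<omega> * e j \<omega>)" by (rule si)
  show "(\<integral>\<omega>. (\<Sum>j<n. G j \<omega> * e j \<omega>)\<^sup>2 \<partial>P) \<le> (\<Sum>j<n. (w j)\<^sup>2)"
  proof (induction n)
    case (Suc n)
    define S where "S \<omega> = (\<Sum>j<n. G j \<omega> * e j \<omega>)" for \<omega>
    have GS: "square_integrable P (\<lambda>\<omega>. G n \<omega> * S \<omega>)"
      using si[of n] square_integrable_bounded_mult[OF measurable_from_subalg[OF F_sub G(1)] G(2)]
      by (simp add: S_def[abs_def])
    have cross: "(\<integral>\<omega>. (G n \<omega> * S \<omega>) * e n \<omega> \<partial>P) = 0"
      using ad[of n] G(1)[of n] GS by (intro e_orthogonal) (auto simp: S_def[abs_def])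
    have cross_int: "integrable P (\<lambda>\<omega>. (G n \<omega> * S \<omega>) * e n \<omega>)"
      by (rule square_integrable_mult_integrable[OF GS e_square_integrable])
    have int: "integrable P (\<lambda>\<omega>. (S \<omega>)\<^sup>2)" "integrable P (\<lambda>\<omega>. (G n \<omega> * e n \<omega>)\<^sup>2)"
      using si[of n] Ge[of n] by (auto simp: S_def[abs_def] square_integrable_def)
    have "(\<integral>\<omega>. (\<Sum>j<Suc n. G j \<omega> * e j \<omega>)\<^sup>2 \<partial>P)
        = (\<integral>\<omega>. (S \<omega>)\<^sup>2 + 2 * ((G n \<omega> * S \<omega>) * e n \<omega>) + (G n \<omega> * e n \<omega>)\<^sup>2 \<partial>P)"
      by (rule Bochner_Integration.integral_cong) (auto simp: S_def power2_sum algebra_simps)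
    also have "\<dots> = (\<integral>\<omega>. (S \<omega>)\<^sup>2 \<partial>P) + (\<integral>\<omega>. (G n \<omega> * e n \<omega>)\<^sup>2 \<partial>P)"
      using int cross_int cross by simp
    also have "(\<integral>\<omega>. (G n \<omega> * e n \<omega>)\<^sup>2 \<partial>P) \<le> (\<integral>\<omega>. (w n)\<^sup>2 * (e n \<omega>)\<^sup>2 \<partial>P)"
    proof (rule integral_mono)
      show "integrable P (\<lambda>\<omega>. (w n)\<^sup>2 * (e n \<omega>)\<^sup>2)"
        using e_square_integrable[of n] by (simp add: square_integrable_def)
      fix \<omega>
      have "(G n \<omega>)\<^sup>2 \<le> (w n)\<^sup>2"
        using G(2)[of n \<omega>] by (rule abs_le_square_iff[THEN iffD1, OF order_trans]) simp
      then show "(G n \<omega> * e n \<omega>)\<^sup>2 \<le> (w n)\<^sup>2 * (e n \<omega>)\<^sup>2"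
        by (simp add: power_mult_distrib mult_right_mono)
    qed fact
    also have "\<dots> \<le> (w n)\<^sup>2 * 1"
      using e_second_moment[of n] by (simp only: integral_mult_right_zero) (intro mult_left_mono; simp)
    finally show ?case using Suc.IH by (simp add: S_def)
  qed simp
qed

text \<open>Chebyshev's inequality for the process stopped when it first leaves the interval \<open>(-k, k)\<close>.\<close>

lemma maximal_inequality:
  assumes k: "k > 0"
  shows "prob {\<omega> \<in> space P. \<exists>i\<le>n. k \<le> \<bar>\<Sum>j<i. w j * e j \<omega>\<bar>} \<le> (\<Sum>j<n. (w j)\<^sup>2) / k\<^sup>2"
proof -
  define U where "U i \<omega> = (\<Sum>j<i. w j * e j \<omega>)" for i \<omega>
  define inside where "inside j \<omega> \<longleftrightarrow> (\<forall>i\<le>j. \<bar>U i \<omega>\<bar> < k)" for j \<omega>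
  \<comment> \<open>Stopping is a predictable factor: whether the interval was left by time j is
    known before \<open>e j\<close> is added. Hence \<open>V\<close> contains the increment that
    causes the exit and is frozen afterwards.\<close>
  define G where "G j \<omega> = (if inside j \<omega> then w j else 0)" for j \<omega>
  define V where "V n \<omega> = (\<Sum>j<n. G j \<omega> * e j \<omega>)" for n \<omega>
  have U_ad: "U i \<in> borel_measurable (F i)" for i
    unfolding U_def[abs_def] by (rule predictable_transform_adapted[where w = "\<lambda>j. \<bar>w j\<bar>"]) auto
  have G_ad: "G j \<in> borel_measurable (F j)" for j
  proof -
    have [measurable]: "U i \<in> borel_measurable (F j)" if "i \<in> {..j}" for i
      using that by (intro adapted_mono[OF _ U_ad]) auto
    have "{\<omega> \<in> space (F j). \<forall>i\<in>{..j}. \<bar>U i \<omega>\<bar> < k} \<in> sets (F j)" by measurable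
    then have "{\<omega> \<in> space (F j). inside j \<omega>} \<in> sets (F j)" by (simp add: inside_def)
    then show ?thesis unfolding G_def[abs_def] by (intro measurable_If) auto
  qed
  have stopped: "(inside n \<omega> \<longrightarrow> V n \<omega> = U n \<omega>) \<and> (\<not> inside n \<omega> \<longrightarrow> k \<le> \<bar>V n \<omega>\<bar>)" for n \<omega>
  proof (induction n)
    case 0 then show ?case using k by (simp add: inside_def U_def V_def)
  next
    case (Suc n)
    have *: "inside (Suc n) \<omega> \<longleftrightarrow> inside n \<omega> \<and> \<bar>U (Suc n) \<omega>\<bar> < k"
      by (auto simp: inside_def le_Suc_eq)
    show ?case
    proof (cases "inside n \<omega>")
      case True
      then have "V (Suc n) \<omega> = U (Suc n) \<omega>" using Suc by (simp add: V_def U_def G_def)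
      then show ?thesis using True * by auto
    next
      case False
      then have "V (Suc n) \<omega> = V n \<omega>" by (simp add: V_def G_def)
      then show ?thesis using False * Suc by auto
    qed
  qed
  have G_bound: "\<bar>G j \<omega>\<bar> \<le> \<bar>w j\<bar>" for j \<omega> by (simp add: G_def)
  have V: "square_integrable P (V n)" "(\<integral>\<omega>. (V n \<omega>)\<^sup>2 \<partial>P) \<le> (\<Sum>j<n. \<bar>w j\<bar>\<^sup>2)"
    unfolding V_def[abs_def]
    using predictable_transform_square_integrable[of G, OF G_ad G_bound]
      predictable_transform_second_moment[of G, OF G_ad G_bound] by blast+
  have Vm: "V n \<in> borel_measurable P" using V(1) by (simp add: square_integrable_def)
  have "prob {\<omega> \<in> space P. \<exists>i\<le>n. k \<le> \<bar>U i \<omega>\<bar>} \<le> prob {\<omega> \<in> space P. k\<^sup>2 \<le> (V n \<omega>)\<^sup>2}"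
  proof (rule finite_measure_mono)
    show "{\<omega> \<in> space P. k\<^sup>2 \<le> (V n \<omega>)\<^sup>2} \<in> events" using Vm by measurable
    show "{\<omega> \<in> space P. \<exists>i\<le>n. k \<le> \<bar>U i \<omega>\<bar>} \<subseteq> {\<omega> \<in> space P. k\<^sup>2 \<le> (V n \<omega>)\<^sup>2}"
    proof safe
      fix \<omega> i assume "i \<le> n" "k \<le> \<bar>U i \<omega>\<bar>"
      then have "\<not> inside n \<omega>" by (auto simp: inside_def not_less)
      then have "k \<le> \<bar>V n \<omega>\<bar>" using stopped by blast
      then show "k\<^sup>2 \<le> (V n \<omega>)\<^sup>2" using k by (simp add: abs_le_square_iff[symmetric])
    qed
  qed
  also have "\<dots> \<le> (\<integral>\<omega>. (V n \<omega>)\<^sup>2 \<partial>P) / k\<^sup>2"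
    by (rule integral_Markov_inequality_measure[where A = "{}"]) (use V k in \<open>auto simp: square_integrable_def\<close>)
  also have "\<dots> \<le> (\<Sum>j<n. (w j)\<^sup>2) / k\<^sup>2"
    using V(2) k by (intro divide_right_mono) auto
  finally show ?thesis by (simp add: U_def)
qed

context
  fixes w :: "nat \<Rightarrow> real"
  assumes w: "summable (\<lambda>j. (w j)\<^sup>2)"
begin

definition "series n \<omega> = (\<Sum>j<n. w j * e j \<omega>)"

definition "tail_bound m = (\<Sum>j. (w (j + m))\<^sup>2)"

lemma tail_bound_tendsto_0: "tail_bound \<longlonglongrightarrow> 0"
  unfolding tail_bound_def[abs_def] by (rule suminf_exist_split2[OF w])

lemma tail_sum_le: "(\<Sum>j<n. (if j < m then 0 else w j)\<^sup>2) \<le> tail_bound m"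
proof (cases "m \<le> n")
  case True
  have "(\<Sum>j<n. (if j < m then 0 else w j)\<^sup>2) = (\<Sum>j\<in>{m..<n}. (w j)\<^sup>2)"
    by (rule sum.mono_neutral_cong_right) auto
  also have "\<dots> = (\<Sum>j<n - m. (w (j + m))\<^sup>2)"
    using sum.shift_bounds_nat_ivl[of "\<lambda>j. (w j)\<^sup>2" 0 m "n - m"] True
    by (simp add: atLeast0LessThan)
  also have "\<dots> \<le> tail_bound m"
    unfolding tail_bound_def by (rule sum_le_suminf) (use w in \<open>auto simp: summable_iff_shift[of "\<lambda>j. (w j)\<^sup>2"]\<close>)
  finally show ?thesis .
next
  case False
  then have "(\<Sum>j<n. (if j < m then 0 else w j)\<^sup>2) = 0" by (intro sum.neutral) auto
  also have "0 \<le> tail_bound m"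
    unfolding tail_bound_def by (rule suminf_nonneg) (use w in \<open>auto simp: summable_iff_shift[of "\<lambda>j. (w j)\<^sup>2"]\<close>)
  finally show ?thesis .
qed

text \<open>With the weights before m set to zero, a tail is again a full transform of the same
  noise, so the bounds above apply to it.\<close>

lemma series_increment:
  "m \<le> n \<Longrightarrow> series n \<omega> - series m \<omega> = (\<Sum>j<n. (if j < m then 0 else w j) * e j \<omega>)"
proof -
  assume mn: "m \<le> n"
  have "(\<Sum>j<n. (if j < m then 0 else w j) * e j \<omega>) = (\<Sum>j<n. w j * e j \<omega> - (if j < m then w j * e j \<omega> else 0))"
    by (rule sum.cong) auto
  also have "\<dots> = series n \<omega> - (\<Sum>j<n. if j < m then w j * e j \<omega> else 0)"
    by (simp add: sum_subtractf series_def)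
  also have "(\<Sum>j<n. if j < m then w j * e j \<omega> else 0) = series m \<omega>"
    unfolding series_def by (rule sum.mono_neutral_cong_right) (use mn in auto)
  finally show ?thesis by simp
qed

lemma series_square_integrable: "square_integrable P (series n)"
  unfolding series_def[abs_def]
  by (rule predictable_transform_square_integrable[where w = "\<lambda>j. \<bar>w j\<bar>"]) auto

lemma series_measurable [measurable]: "series n \<in> borel_measurable P"
  using series_square_integrable[of n] by (simp add: square_integrable_def)

lemma series_increment_second_moment:
  assumes "m \<le> n" shows "(\<integral>\<omega>. (series n \<omega> - series m \<omega>)\<^sup>2 \<partial>P) \<le> tail_bound m"
proof -
  have "(\<integral>\<omega>. (series n \<omega> - series m \<omega>)\<^sup>2 \<partial>P) \<le> (\<Sum>j<n. \<bar>if j < m then 0 else w j\<bar>\<^sup>2)"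
    unfolding series_increment[OF assms]
    by (rule predictable_transform_second_moment) auto
  also have "\<dots> \<le> tail_bound m" using tail_sum_le[of m n] by simp
  finally show ?thesis .
qed

text \<open>The bound of the maximal inequality does not grow with the horizon, since the squared
  weights are summable; continuity of the measure from below removes the horizon.\<close>

lemma tail_exceedance:
  assumes k: "k > 0"
  shows "prob {\<omega> \<in> space P. \<exists>i\<ge>m. k \<le> \<bar>series i \<omega> - series m \<omega>\<bar>} \<le> tail_bound m / k\<^sup>2"
proof -
  define A where "A n = {\<omega> \<in> space P. \<exists>i\<le>n. k \<le> \<bar>\<Sum>j<i. (if j < m then 0 else w j) * e j \<omega>\<bar>}" for n
  have e_meas [measurable]: "e j \<in> borel_measurable P" for j
    using e_square_integrable[of j] by (simp add: square_integrable_def)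
  have A [measurable]: "A n \<in> events" for n unfolding A_def by measurable
  have "(\<lambda>n. prob (A n)) \<longlonglongrightarrow> prob (\<Union>n. A n)"
    by (rule finite_Lim_measure_incseq) (auto simp: incseq_def A_def intro: order_trans)
  moreover have "prob (A n) \<le> tail_bound m / k\<^sup>2" for n
    unfolding A_def using maximal_inequality[OF k] divide_right_mono[OF tail_sum_le]
    by (rule order_trans) simp
  ultimately have "prob (\<Union>n. A n) \<le> tail_bound m / k\<^sup>2"
    by (intro LIMSEQ_le_const2) auto
  moreover have "prob {\<omega> \<in> space P. \<exists>i\<ge>m. k \<le> \<bar>series i \<omega> - series m \<omega>\<bar>} \<le> prob (\<Union>n. A n)"
  proof (rule finite_measure_mono)
    show "{\<omega> \<in> space P. \<exists>i\<ge>m. k \<le> \<bar>series i \<omega> - series m \<omega>\<bar>} \<subseteq> (\<Union>n. A n)"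
    proof safe
      fix \<omega> i assume "\<omega> \<in> space P" "i \<ge> m" "k \<le> \<bar>series i \<omega> - series m \<omega>\<bar>"
      then have "\<omega> \<in> A i" unfolding A_def series_increment[OF \<open>i \<ge> m\<close>] by blast
      then show "\<omega> \<in> (\<Union>n. A n)" by blast
    qed
  qed measurable
  ultimately show ?thesis by simp
qed

text \<open>For fixed k the event that fluctuations of size k occur after every m has probability at
  most the tail bound of each m, hence 0. Letting k run through a null sequence gives the Cauchy
  property.\<close>

lemma series_converges_AE: "AE \<omega> in P. convergent (\<lambda>n. series n \<omega>)"
proof -
  have null: "AE \<omega> in P. \<exists>m. \<forall>i\<ge>m. \<bar>series i \<omega> - series m \<omega>\<bar> < k" if k: "k > 0" for k
  proof -
    define A where "A m = {\<omega> \<in> space P. \<exists>i\<ge>m. k \<le> \<bar>series i \<omega> - series m \<omega>\<bar>}" for m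
    have A [measurable]: "A m \<in> events" for m unfolding A_def by measurable
    have le: "prob (\<Inter>m. A m) \<le> tail_bound m / k\<^sup>2" for m
      using finite_measure_mono[of "\<Inter>m. A m" "A m"] tail_exceedance[OF k, of m]
      unfolding A_def[symmetric] by (auto intro: order_trans)
    have "(\<lambda>m. tail_bound m / k\<^sup>2) \<longlonglongrightarrow> 0 / k\<^sup>2"
      by (intro tendsto_divide tail_bound_tendsto_0) (use k in auto)
    then have "prob (\<Inter>m. A m) \<le> 0 / k\<^sup>2" by (rule LIMSEQ_le_const) (use le in auto)
    then have "prob (\<Inter>m. A m) = 0" by (simp add: measure_le_0_iff)
    then have "AE \<omega> in P. \<omega> \<notin> (\<Inter>m. A m)"
      by (subst (asm) prob_eq_0) auto
    with AE_space show ?thesis by eventually_elim (force simp: A_def not_le)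
  qed
  have "AE \<omega> in P. \<forall>q. \<exists>m. \<forall>i\<ge>m. \<bar>series i \<omega> - series m \<omega>\<bar> < inverse (real (Suc q))"
    unfolding AE_all_countable by (intro allI null) simp
  then show ?thesis
  proof eventually_elim
    case (elim \<omega>)
    have "Cauchy (\<lambda>n. series n \<omega>)"
    proof (rule metric_CauchyI)
      fix r :: real assume "r > 0"
      then obtain q where q: "inverse (real (Suc q)) < r / 2"
        using reals_Archimedean[of "r / 2"] by auto
      obtain m where m: "\<And>i. i \<ge> m \<Longrightarrow> \<bar>series i \<omega> - series m \<omega>\<bar> < inverse (real (Suc q))"
        using elim by blast
      have "dist (series i \<omega>) (series j \<omega>) < r" if "i \<ge> m" "j \<ge> m" for i j
        using m[OF that(1)] m[OF that(2)] q unfolding dist_real_def by linarith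
      then show "\<exists>M. \<forall>i\<ge>M. \<forall>j\<ge>M. dist (series i \<omega>) (series j \<omega>) < r" by blast
    qed
    then show ?case by (simp add: Cauchy_convergent_iff)
  qed
qed

text \<open>Fatou's lemma in n with m fixed bounds the squared distance of \<open>series m\<close>
  from the limit. The case m = 0, where the series is 0, shows that the limit is
  square-integrable.\<close>

lemma series_converges_L2: "converges_L2 P series (\<lambda>\<omega>. lim (\<lambda>n. series n \<omega>))"
proof -
  define L where "L \<omega> = lim (\<lambda>n. series n \<omega>)" for \<omega>
  have Lm [measurable]: "L \<in> borel_measurable P" unfolding L_def[abs_def] by measurable
  have conv: "AE \<omega> in P. (\<lambda>n. series n \<omega>) \<longlonglongrightarrow> L \<omega>"
    using series_converges_AE by eventually_elim (simp add: L_def convergent_LIMSEQ_iff)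
  have fatou: "integrable P (\<lambda>\<omega>. (L \<omega> - series m \<omega>)\<^sup>2)" "(\<integral>\<omega>. (L \<omega> - series m \<omega>)\<^sup>2 \<partial>P) \<le> tail_bound m" for m
  proof -
    have int: "integrable P (\<lambda>\<omega>. (series n \<omega> - series m \<omega>)\<^sup>2)" for n
      using square_integrable_diff[OF series_square_integrable series_square_integrable]
      by (simp add: square_integrable_def)
    have lim: "AE \<omega> in P. (\<lambda>n. (series n \<omega> - series m \<omega>)\<^sup>2) \<longlonglongrightarrow> (L \<omega> - series m \<omega>)\<^sup>2"
      using conv by eventually_elim (intro tendsto_intros)
    have bd: "eventually (\<lambda>n. (\<integral>\<omega>. (series n \<omega> - series m \<omega>)\<^sup>2 \<partial>P) \<le> tail_bound m) sequentially"
      using eventually_ge_at_top[of m] by eventually_elim (rule series_increment_second_moment)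
    show "integrable P (\<lambda>\<omega>. (L \<omega> - series m \<omega>)\<^sup>2)" "(\<integral>\<omega>. (L \<omega> - series m \<omega>)\<^sup>2 \<partial>P) \<le> tail_bound m"
      by (rule fatou_integral_bound[OF int _ _ lim bd]; simp)+
  qed
  have "square_integrable P (\<lambda>\<omega>. L \<omega> - series 0 \<omega>)" using fatou by (simp add: square_integrable_def)
  then have Lsq: "square_integrable P L" by (simp add: series_def)
  have "(\<lambda>n. \<integral>\<omega>. (series n \<omega> - L \<omega>)\<^sup>2 \<partial>P) \<longlonglongrightarrow> 0"
  proof (rule tendsto_sandwich[OF _ _ tendsto_const tail_bound_tendsto_0])
    show "eventually (\<lambda>n. (\<integral>\<omega>. (series n \<omega> - L \<omega>)\<^sup>2 \<partial>P) \<le> tail_bound n) sequentially"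
      using fatou(2) by (simp add: power2_commute)
  qed simp
  then show ?thesis using Lsq series_square_integrable unfolding converges_L2_def L_def[abs_def] by blast
qed

end

end

section \<open>Independence of past and fresh variables\<close>

text \<open>A finite intersection is grouped by first coordinate: \<open>outer\<close> factors it
  over the groups and \<open>inner\<close> factors each group. This merges independence within each
  of the three sequences and between them.\<close>

lemma (in prob_space) indep_sets_Sigma:
  assumes inner: "\<And>j. j \<in> J \<Longrightarrow> indep_sets (\<lambda>i. E (j, i)) (I j)"
    and outer: "indep_sets (\<lambda>j. sigma_sets (space M) (\<Union>i\<in>I j. E (j, i))) J"
  shows "indep_sets E (SIGMA j:J. I j)"
proof (rule indep_setsI)
  fix x assume "x \<in> (SIGMA j:J. I j)"
  then show "E x \<subseteq> events" using inner by (auto simp: indep_sets_def)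
next
  fix A K assume K: "K \<noteq> {}" "K \<subseteq> (SIGMA j:J. I j)" "finite K" and A: "\<forall>x\<in>K. A x \<in> E x"
  define J' where "J' = fst ` K"
  define L where "L j = {i. (j, i) \<in> K}" for j
  define B where "B j = (\<Inter>i\<in>L j. A (j, i))" for j
  have KL: "K = (SIGMA j:J'. L j)" by (auto simp: J'_def L_def intro: image_eqI[rotated])
  have J': "finite J'" "J' \<noteq> {}" "J' \<subseteq> J" using K by (auto simp: J'_def)
  have "L j = snd ` (K \<inter> {j} \<times> UNIV)" for j by (force simp: L_def)
  then have L: "finite (L j)" "L j \<noteq> {}" "L j \<subseteq> I j" if "j \<in> J'" for j
    using that K by (auto simp: L_def J'_def)
  have B_sets: "B j \<in> sigma_sets (space M) (\<Union>i\<in>I j. E (j, i))" if j: "j \<in> J'" for j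
  proof -
    have sub: "(\<Union>i\<in>I j. E (j, i)) \<subseteq> Pow (space M)"
      using inner[of j] J' j sets.space_closed by (fastforce simp: indep_sets_def)
    interpret S: sigma_algebra "space M" "sigma_sets (space M) (\<Union>i\<in>I j. E (j, i))"
      by (rule sigma_algebra_sigma_sets[OF sub])
    show ?thesis unfolding B_def
      by (rule S.finite_INT) (use L[OF j] A KL j in \<open>auto intro!: sigma_sets.Basic\<close>)
  qed
  have "(\<Inter>x\<in>K. A x) = (\<Inter>j\<in>J'. B j)" by (auto simp: KL B_def)
  also have "prob \<dots> = (\<Prod>j\<in>J'. prob (B j))"
    using indep_setsD[OF outer J'(3,2,1), of B] B_sets by auto
  also have "\<dots> = (\<Prod>j\<in>J'. \<Prod>i\<in>L j. prob (A (j, i)))"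
  proof (rule prod.cong[OF refl])
    fix j assume j: "j \<in> J'"
    then have "j \<in> J" using J' by auto
    show "prob (B j) = (\<Prod>i\<in>L j. prob (A (j, i)))"
      unfolding B_def using indep_setsD[OF inner[OF \<open>j \<in> J\<close>] L(3,2,1)[OF j], of "\<lambda>i. A (j, i)"] A j KL
      by auto
  qed
  also have "\<dots> = (\<Prod>x\<in>K. prob (A x))"
    unfolding KL using J' L by (subst prod.Sigma) auto
  finally show "prob (\<Inter>x\<in>K. A x) = (\<Prod>x\<in>K. prob (A x))" .
qed

lemma (in prob_space) indep_set_of_indep_sets:
  assumes "indep_sets G I" "i \<in> I" "j \<in> I" "i \<noteq> j" "A \<subseteq> G i" "B \<subseteq> G j"
  shows "indep_set A B"
proof (rule indep_setI)
  show "A \<subseteq> events" "B \<subseteq> events" using assms by (auto simp: indep_sets_def)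
  fix a b assume "a \<in> A" "b \<in> B"
  then show "prob (a \<inter> b) = prob a * prob b"
    using indep_setsD[OF assms(1), of "{i, j}" "\<lambda>x. if x = i then a else b"] assms
    by (auto simp: Int_commute)
qed

lemma (in prob_space) indep_subalgebra_expectation:
  fixes f h :: "'a \<Rightarrow> real"
  assumes ind: "indep_set (sets G) (sets H)" and space: "space G = space M" "space H = space M"
    and f: "f \<in> borel_measurable G" "integrable M f"
    and h: "h \<in> borel_measurable H" "integrable M h"
  shows indep_subalgebra_integrable: "integrable M (\<lambda>\<omega>. f \<omega> * h \<omega>)"
    and indep_subalgebra_expectation_mult: "(\<integral>\<omega>. f \<omega> * h \<omega> \<partial>M) = (\<integral>\<omega>. f \<omega> \<partial>M) * (\<integral>\<omega>. h \<omega> \<partial>M)"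
proof -
  have sub: "sigma_sets (space M) {g -` A \<inter> space M | A. A \<in> sets borel} \<subseteq> sets K"
    if "g \<in> borel_measurable K" "space K = space M" for g :: "'a \<Rightarrow> real" and K
    using that measurable_sets[OF that(1)]
    by (intro sets.sigma_sets_subset[of _ K, unfolded that(2)]) auto
  have "indep_set (sigma_sets (space M) {f -` A \<inter> space M | A. A \<in> sets borel})
      (sigma_sets (space M) {h -` A \<inter> space M | A. A \<in> sets borel})"
    by (rule indep_set_of_indep_sets[OF ind[unfolded indep_set_def], of True False])
       (use sub[OF f(1) space(1)] sub[OF h(1) space(2)] in auto)
  then have "indep_var borel f borel h"
    using f h by (simp add: indep_var_eq borel_measurable_integrable)
  then show "integrable M (\<lambda>\<omega>. f \<omega> * h \<omega>)" "(\<integral>\<omega>. f \<omega> * h \<omega> \<partial>M) = (\<integral>\<omega>. f \<omega> \<partial>M) * (\<integral>\<omega>. h \<omega> \<partial>M)"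
    using f h by (auto intro: indep_var_integrable indep_var_lebesgue_integral)
qed

lemma Int_stable_preimages: "Int_stable {f -` A \<inter> S | A. A \<in> sets N}"
proof (rule Int_stableI, safe)
  fix A B assume "A \<in> sets N" "B \<in> sets N"
  then show "\<exists>C. f -` A \<inter> S \<inter> (f -` B \<inter> S) = f -` C \<inter> S \<and> C \<in> sets N"
    by (intro exI[of _ "A \<inter> B"]) auto
qed

text \<open>The enlargement is needed because X n is a function of the inputs only up to a null
  event; with it the steps are adapted.\<close>

definition null_augmentation :: "'a measure \<Rightarrow> 'a set set \<Rightarrow> 'a set set" where
  "null_augmentation M \<G> = {A \<in> sets M. \<exists>B\<in>\<G>. AE x in M. x \<in> A \<longleftrightarrow> x \<in> B}"

lemma sigma_algebra_null_augmentation: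
  assumes \<G>: "sigma_algebra (space M) \<G>"
  shows "sigma_algebra (space M) (null_augmentation M \<G>)"
proof -
  interpret \<G>: sigma_algebra "space M" \<G> by fact
  show ?thesis unfolding sigma_algebra_iff2
  proof (intro conjI ballI allI impI)
    show "null_augmentation M \<G> \<subseteq> Pow (space M)"
      using sets.space_closed by (auto simp: null_augmentation_def)
    show "{} \<in> null_augmentation M \<G>"
      unfolding null_augmentation_def by (auto intro!: bexI[of _ "{}"])
    fix A assume "A \<in> null_augmentation M \<G>"
    then obtain B where A: "A \<in> sets M" and B: "B \<in> \<G>" "AE x in M. x \<in> A \<longleftrightarrow> x \<in> B"
      by (auto simp: null_augmentation_def)
    have "AE x in M. x \<in> space M - A \<longleftrightarrow> x \<in> space M - B" using B(2) by eventually_elim auto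
    moreover have "space M - A \<in> sets M" "space M - B \<in> \<G>" using A B(1) by auto
    ultimately show "space M - A \<in> null_augmentation M \<G>" unfolding null_augmentation_def by blast
  next
    fix A :: "nat \<Rightarrow> _" assume "range A \<subseteq> null_augmentation M \<G>"
    then have "\<forall>i. A i \<in> sets M \<and> (\<exists>B\<in>\<G>. AE x in M. x \<in> A i \<longleftrightarrow> x \<in> B)"
      by (auto simp: null_augmentation_def)
    then obtain B where B: "\<And>i. A i \<in> sets M" "\<And>i. B i \<in> \<G>" "\<And>i. AE x in M. x \<in> A i \<longleftrightarrow> x \<in> B i"
      by metis
    have "AE x in M. \<forall>i. x \<in> A i \<longleftrightarrow> x \<in> B i" using B(3) by (simp add: AE_all_countable)
    then have "AE x in M. x \<in> (\<Union>i. A i) \<longleftrightarrow> x \<in> (\<Union>i. B i)" by eventually_elim auto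
    moreover have "(\<Union>i. A i) \<in> sets M" "(\<Union>i. B i) \<in> \<G>" using B by auto
    ultimately show "(\<Union>i. A i) \<in> null_augmentation M \<G>" unfolding null_augmentation_def by blast
  qed
qed

lemma null_augmentation_superset:
  "\<G> \<subseteq> sets M \<Longrightarrow> \<G> \<subseteq> null_augmentation M \<G>"
  unfolding null_augmentation_def by auto

section \<open>The filtration of the inputs, enlarged by null events\<close>

context srrw_rvm
begin

text \<open>The generators of the innovations, recollection indicators and memory times, tagged by
  \<open>0\<close>, \<open>1\<close> and \<open>2\<close>.\<close>

definition generator :: "nat \<times> nat \<Rightarrow> 'a set set" where
  "generator = (\<lambda>(s, i).
     if s = 0 then {\<xi> i -` A \<inter> space P | A. A \<in> sets borel}
     else if s = 1 then {\<alpha> i -` A \<inter> space P | A. A \<in> sets (count_space UNIV)}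
     else {\<beta> i -` A \<inter> space P | A. A \<in> sets (count_space UNIV)})"

definition time_set :: "nat \<Rightarrow> nat set" where
  "time_set s = (if s = 0 then {1..} else {2..})"

definition sources :: "(nat \<times> nat) set" where
  "sources = (SIGMA s:{0, 1, 2}. time_set s)"

definition past :: "nat \<Rightarrow> 'a set set" where
  "past n = sigma_sets (space P) (\<Union>x\<in>{x \<in> sources. snd x \<le> n}. generator x)"

definition fresh :: "nat \<Rightarrow> 'a set set" where
  "fresh n = sigma_sets (space P) (\<Union>x\<in>{x \<in> sources. snd x = n}. generator x)"

lemma sigma_gen_by_generator:
  "sigma_gen_by P borel \<xi> {1..} = sigma_sets (space P) (\<Union>i\<in>time_set 0. generator (0, i))"
  "sigma_gen_by P (count_space UNIV) \<alpha> {2..} = sigma_sets (space P) (\<Union>i\<in>time_set 1. generator (1, i))"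
  "sigma_gen_by P (count_space UNIV) \<beta> {2..} = sigma_sets (space P) (\<Union>i\<in>time_set 2. generator (2, i))"
  unfolding sigma_gen_by_def
  by (rule arg_cong[where f = "sigma_sets (space P)"]; fastforce simp: generator_def time_set_def)+

lemma generators_indep: "indep_sets generator sources"
  unfolding sources_def
proof (rule indep_sets_Sigma)
  have "indep_sets (\<lambda>i. generator (0, i)) {1..}" "indep_sets (\<lambda>i. generator (1, i)) {2..}"
    "indep_sets (\<lambda>i. generator (2, i)) {2..}"
    using xi_indep alpha_indep beta_indep by (simp_all add: indep_vars_def2 generator_def)
  then show "indep_sets (\<lambda>i. generator (s, i)) (time_set s)" if "s \<in> {0, 1, 2}" for s
    using that by (auto simp: time_set_def)
  show "indep_sets (\<lambda>s. sigma_sets (space P) (\<Union>i\<in>time_set s. generator (s, i))) {0, 1, 2}"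
    using seqs_indep unfolding sigma_gen_by_generator
    by (rule indep_sets_mono_sets) (auto simp: numeral_2_eq_2)
qed

lemma generator_events: "x \<in> sources \<Longrightarrow> generator x \<subseteq> events"
  using generators_indep by (auto simp: indep_sets_def)

lemma generator_Int_stable: "Int_stable (generator x)"
  by (cases x) (simp add: generator_def Int_stable_preimages
      Int_stable_preimages[where N = "count_space UNIV", simplified])

text \<open>The inputs up to time n and those at time n + 1 are disjoint blocks of one independent
  family. Each generator is closed under intersection, which lets independence pass to the generated
  sigma-algebras.\<close>

lemma past_fresh_indep: "indep_set (past n) (fresh (Suc n))"
proof -
  define I where "I j = {x \<in> sources. if j then snd x \<le> n else snd x = Suc n}" for j :: bool
  have "indep_sets (\<lambda>j. sigma_sets (space P) (\<Union>x\<in>I j. generator x)) UNIV"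
  proof (rule indep_sets_collect_sigma)
    show "indep_sets generator (\<Union>j\<in>UNIV. I j)"
      by (rule indep_sets_mono_index[OF _ generators_indep]) (auto simp: I_def)
    show "disjoint_family_on I UNIV" by (auto simp: disjoint_family_on_def I_def)
  qed (rule generator_Int_stable)
  then show ?thesis
    by (rule indep_set_of_indep_sets[of _ _ True False]) (auto simp: past_def fresh_def I_def)
qed

lemma past_sigma_algebra: "sigma_algebra (space P) (past n)"
  unfolding past_def using generator_events sets.space_closed[of P]
  by (intro sigma_algebra_sigma_sets) fastforce

lemma past_events: "past n \<subseteq> events"
  using past_fresh_indep[of n] by (auto simp: indep_set_def indep_sets_def split: bool.splits)

lemma past_mono: "m \<le> n \<Longrightarrow> past m \<subseteq> past n"
  unfolding past_def by (intro sigma_sets_mono') auto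

definition F :: "nat \<Rightarrow> 'a measure" where
  "F n = sigma (space P) (null_augmentation P (past n))"

lemma space_F [simp]: "space (F n) = space P"
  by (simp add: F_def space_measure_of_conv)

lemma sets_F: "sets (F n) = null_augmentation P (past n)"
  unfolding F_def
  by (rule sigma_algebra.sets_measure_of_eq[OF sigma_algebra_null_augmentation[OF past_sigma_algebra]])

lemma F_subalgebra: "subalgebra P (F n)"
  by (auto simp: subalgebra_def sets_F null_augmentation_def)

lemma sets_F_mono: "m \<le> n \<Longrightarrow> sets (F m) \<subseteq> sets (F n)"
  using past_mono[of m n] by (auto simp: sets_F null_augmentation_def)

lemma F_measurable_mono: "m \<le> n \<Longrightarrow> f \<in> measurable (F m) N \<Longrightarrow> f \<in> measurable (F n) N"
  using sets_F_mono[of m n] by (auto simp: measurable_def)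

text \<open>This is what the enlargement buys: measurability survives a modification on a null
  set.\<close>

lemma F_measurable_AE_eq:
  assumes f: "f \<in> measurable P N" and g: "g \<in> measurable (F n) N" and eq: "AE \<omega> in P. f \<omega> = g \<omega>"
  shows "f \<in> measurable (F n) N"
proof (rule measurableI)
  fix A assume A: "A \<in> sets N"
  then have "g -` A \<inter> space P \<in> sets (F n)" using measurable_sets[OF g A] by simp
  then obtain B where B: "B \<in> past n" "AE \<omega> in P. \<omega> \<in> g -` A \<inter> space P \<longleftrightarrow> \<omega> \<in> B"
    by (auto simp: sets_F null_augmentation_def)
  have "AE \<omega> in P. \<omega> \<in> f -` A \<inter> space P \<longleftrightarrow> \<omega> \<in> B"
    using B(2) eq by eventually_elim auto
  then show "f -` A \<inter> space (F n) \<in> sets (F n)"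
    using B(1) measurable_sets[OF f A] by (auto simp: sets_F null_augmentation_def)
qed (use measurable_space[OF f] in auto)

text \<open>Exchanging an event for an almost surely equal one in \<open>past n\<close> changes no
  probability, so the enlargement preserves independence.\<close>

lemma F_fresh_indep:
  assumes "A \<in> sets (F n)" "C \<in> fresh (Suc n)"
  shows "prob (A \<inter> C) = prob A * prob C"
proof -
  from assms(1) obtain B where A: "A \<in> events" and B: "B \<in> past n" "AE \<omega> in P. \<omega> \<in> A \<longleftrightarrow> \<omega> \<in> B"
    by (auto simp: sets_F null_augmentation_def)
  have C: "C \<in> events"
    using past_fresh_indep[of n] assms(2) by (auto simp: indep_set_def indep_sets_def split: bool.splits)
  have "B \<in> events" using B past_events by auto
  have "AE \<omega> in P. \<omega> \<in> A \<inter> C \<longleftrightarrow> \<omega> \<in> B \<inter> C" using B(2) by eventually_elim auto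
  then have "prob (A \<inter> C) = prob (B \<inter> C)"
    using A C \<open>B \<in> events\<close> by (intro finite_measure_eq_AE) auto
  also have "\<dots> = prob B * prob C"
    using past_fresh_indep B(1) assms(2) by (rule indep_setD)
  also have "prob B = prob A"
    using A B(2) \<open>B \<in> events\<close> by (intro finite_measure_eq_AE) auto
  finally show ?thesis .
qed

definition Fresh :: "nat \<Rightarrow> 'a measure" where
  "Fresh n = sigma (space P) (\<Union>x\<in>{x \<in> sources. snd x = n}. generator x)"

lemma generators_Pow: "(\<Union>x\<in>{x \<in> sources. Q x}. generator x) \<subseteq> Pow (space P)"
  using generator_events sets.space_closed[of P] by fastforce

lemma space_Fresh [simp]: "space (Fresh n) = space P"
  by (simp add: Fresh_def space_measure_of_conv)

lemma sets_Fresh: "sets (Fresh n) = fresh n"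
  unfolding Fresh_def fresh_def by (rule sets_measure_of[OF generators_Pow])

lemma fresh_events: "fresh n \<subseteq> events"
  unfolding fresh_def using generator_events by (intro sets.sigma_sets_subset) auto

lemma Fresh_subalgebra: "subalgebra P (Fresh n)"
  using fresh_events by (simp add: subalgebra_def sets_Fresh)

lemma xi_generator: "i \<ge> 1 \<Longrightarrow> A \<in> sets borel \<Longrightarrow> (0, i) \<in> sources \<and> \<xi> i -` A \<inter> space P \<in> generator (0, i)"
  and alpha_generator: "i \<ge> 2 \<Longrightarrow> (1, i) \<in> sources \<and> \<alpha> i -` B \<inter> space P \<in> generator (1, i)"
  and beta_generator: "i \<ge> 2 \<Longrightarrow> (2, i) \<in> sources \<and> \<beta> i -` C \<inter> space P \<in> generator (2, i)"
  by (auto simp: sources_def time_set_def generator_def)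

lemma xi_Fresh: "i \<ge> 1 \<Longrightarrow> \<xi> i \<in> borel_measurable (Fresh i)"
  and alpha_Fresh: "i \<ge> 2 \<Longrightarrow> \<alpha> i \<in> measurable (Fresh i) (count_space UNIV)"
  and beta_Fresh: "i \<ge> 2 \<Longrightarrow> \<beta> i \<in> measurable (Fresh i) (count_space UNIV)"
proof -
  show "i \<ge> 1 \<Longrightarrow> \<xi> i \<in> borel_measurable (Fresh i)"
    using xi_generator[of i] by (intro measurableI) (force simp: sets_Fresh fresh_def intro!: sigma_sets.Basic)+
  show "i \<ge> 2 \<Longrightarrow> \<alpha> i \<in> measurable (Fresh i) (count_space UNIV)"
    using alpha_generator[of i] by (intro measurableI) (force simp: sets_Fresh fresh_def intro!: sigma_sets.Basic)+
  show "i \<ge> 2 \<Longrightarrow> \<beta> i \<in> measurable (Fresh i) (count_space UNIV)"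
    using beta_generator[of i] by (intro measurableI) (force simp: sets_Fresh fresh_def intro!: sigma_sets.Basic)+
qed

lemma Fresh_F: "sets (Fresh n) \<subseteq> sets (F n)"
proof -
  have "fresh n \<subseteq> past n" unfolding fresh_def past_def by (intro sigma_sets_mono') auto
  then show ?thesis
    using null_augmentation_superset[OF past_events, of n] by (auto simp: sets_Fresh sets_F)
qed

lemma Fresh_F_measurable: "f \<in> measurable (Fresh n) N \<Longrightarrow> f \<in> measurable (F n) N"
  using Fresh_F[of n] by (auto simp: measurable_def)

lemma F_Fresh_expectation:
  fixes f h :: "'a \<Rightarrow> real"
  assumes f: "f \<in> borel_measurable (F n)" "integrable P f"
    and h: "h \<in> borel_measurable (Fresh (Suc n))" "integrable P h"
  shows "integrable P (\<lambda>\<omega>. f \<omega> * h \<omega>)"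
    and F_Fresh_expectation_mult: "(\<integral>\<omega>. f \<omega> * h \<omega> \<partial>P) = (\<integral>\<omega>. f \<omega> \<partial>P) * (\<integral>\<omega>. h \<omega> \<partial>P)"
proof -
  have ind: "indep_set (sets (F n)) (sets (Fresh (Suc n)))"
    using F_fresh_indep[of _ n] F_subalgebra[of n] Fresh_subalgebra[of "Suc n"]
    by (intro indep_setI) (auto simp: sets_Fresh subalgebra_def)
  show "integrable P (\<lambda>\<omega>. f \<omega> * h \<omega>)" "(\<integral>\<omega>. f \<omega> * h \<omega> \<partial>P) = (\<integral>\<omega>. f \<omega> \<partial>P) * (\<integral>\<omega>. h \<omega> \<partial>P)"
    by (rule indep_subalgebra_expectation[OF ind _ _ f h]; simp)+
qed

end

section \<open>The reinforced walk\<close>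

locale srrw_L2 = srrw_rvm +
  assumes xi_square_integrable: "integrable P (\<lambda>\<omega>. (\<xi> 1 \<omega>)\<^sup>2)"
    and xi_second_moment: "(\<integral>\<omega>. (\<xi> 1 \<omega>)\<^sup>2 \<partial>P) = 1"

sublocale srrw_L2 \<subseteq> memory_sequence p \<gamma> \<mu>
  by unfold_locales (use p_range gamma_gt mu_pos mu_regvar in auto)

context srrw_L2
begin

lemma xi_measurable: "n \<ge> 1 \<Longrightarrow> \<xi> n \<in> borel_measurable P"
  using xi_indep by (auto simp: indep_vars_def2)

lemma alpha_measurable: "n \<ge> 2 \<Longrightarrow> \<alpha> n \<in> measurable P (count_space UNIV)"
  using alpha_indep by (auto simp: indep_vars_def2)

lemma beta_measurable: "n \<ge> 2 \<Longrightarrow> \<beta> n \<in> measurable P (count_space UNIV)"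
  using beta_indep by (auto simp: indep_vars_def2)

lemma xi_transfer:
  fixes \<phi> :: "real \<Rightarrow> real"
  assumes "n \<ge> 1" and [measurable]: "\<phi> \<in> borel_measurable borel"
  shows "integrable P (\<lambda>\<omega>. \<phi> (\<xi> n \<omega>)) \<longleftrightarrow> integrable P (\<lambda>\<omega>. \<phi> (\<xi> 1 \<omega>))"
    and "(\<integral>\<omega>. \<phi> (\<xi> n \<omega>) \<partial>P) = (\<integral>\<omega>. \<phi> (\<xi> 1 \<omega>) \<partial>P)"
proof -
  have "(integrable (distr P borel (\<xi> k)) \<phi> \<longleftrightarrow> integrable P (\<lambda>\<omega>. \<phi> (\<xi> k \<omega>)))
    \<and> (\<integral>x. \<phi> x \<partial>distr P borel (\<xi> k)) = (\<integral>\<omega>. \<phi> (\<xi> k \<omega>) \<partial>P)" if "k \<ge> 1" for k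
    using xi_measurable[OF that] by (simp add: integrable_distr_eq integral_distr)
  note this[OF assms(1)] this[OF order_refl]
  then show "integrable P (\<lambda>\<omega>. \<phi> (\<xi> n \<omega>)) \<longleftrightarrow> integrable P (\<lambda>\<omega>. \<phi> (\<xi> 1 \<omega>))"
    "(\<integral>\<omega>. \<phi> (\<xi> n \<omega>) \<partial>P) = (\<integral>\<omega>. \<phi> (\<xi> 1 \<omega>) \<partial>P)"
    using xi_ident[OF assms(1)] by simp_all
qed

lemma xi_moments:
  assumes "n \<ge> 1"
  shows "integrable P (\<xi> n)" "(\<integral>\<omega>. \<xi> n \<omega> \<partial>P) = 0" "(\<integral>\<omega>. (\<xi> n \<omega>)\<^sup>2 \<partial>P) = 1"
  using xi_transfer[OF assms, of "\<lambda>x. x"] xi_transfer(2)[OF assms, of "\<lambda>x. x\<^sup>2"]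
    xi_integrable xi_mean xi_second_moment by auto

text \<open>\<open>copy n 1\<close> to \<open>copy n n\<close> and \<open>renew n\<close> tell where
  step n + 1 comes from; almost surely exactly one of them is 1.\<close>

definition copy :: "nat \<Rightarrow> nat \<Rightarrow> 'a \<Rightarrow> real" where
  "copy n k \<omega> = of_bool (\<alpha> (Suc n) \<omega> \<and> \<beta> (Suc n) \<omega> = k)"

definition renew :: "nat \<Rightarrow> 'a \<Rightarrow> real" where
  "renew n \<omega> = of_bool (\<not> \<alpha> (Suc n) \<omega>)"

lemma copy_Fresh: "n \<ge> 1 \<Longrightarrow> copy n k \<in> borel_measurable (Fresh (Suc n))"
  and renew_Fresh: "n \<ge> 1 \<Longrightarrow> renew n \<in> borel_measurable (Fresh (Suc n))"
proof -
  assume n: "n \<ge> 1"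
  have [measurable]: "\<alpha> (Suc n) \<in> measurable (Fresh (Suc n)) (count_space UNIV)"
    "\<beta> (Suc n) \<in> measurable (Fresh (Suc n)) (count_space UNIV)"
    using n alpha_Fresh[of "Suc n"] beta_Fresh[of "Suc n"] by auto
  show "copy n k \<in> borel_measurable (Fresh (Suc n))" unfolding copy_def[abs_def] by measurable
  show "renew n \<in> borel_measurable (Fresh (Suc n))" unfolding renew_def[abs_def] by measurable
qed

lemma Fresh_integrable_bounded:
  assumes "f \<in> borel_measurable (Fresh n)" "\<And>\<omega>. \<bar>f \<omega> :: real\<bar> \<le> K"
  shows "integrable P f"
  by (rule integrable_const_bound[where B = K])
     (use assms measurable_from_subalg[OF Fresh_subalgebra] in auto)

lemma copy_integrable: "n \<ge> 1 \<Longrightarrow> integrable P (copy n k)"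
  by (rule Fresh_integrable_bounded[OF copy_Fresh, where K = 1]) (auto simp: copy_def)

lemma alpha_prob:
  assumes "n \<ge> 2"
  shows "prob {\<omega> \<in> space P. \<alpha> n \<omega>} = p" "prob {\<omega> \<in> space P. \<not> \<alpha> n \<omega>} = 1 - p"
proof -
  have pre: "{\<omega> \<in> space P. \<alpha> n \<omega> = v} = \<alpha> n -` {v} \<inter> space P" for v by auto
  have "prob {\<omega> \<in> space P. \<alpha> n \<omega> = v} = measure (distr P (count_space UNIV) (\<alpha> n)) {v}" for v
    unfolding pre using alpha_measurable[OF assms] by (subst measure_distr) auto
  then have "prob {\<omega> \<in> space P. \<alpha> n \<omega> = v} = pmf (bernoulli_pmf p) v" for v
    by (simp add: alpha_distr[OF assms] pmf.rep_eq)
  from this[of True] this[of False] show "prob {\<omega> \<in> space P. \<alpha> n \<omega>} = p" "prob {\<omega> \<in> space P. \<not> \<alpha> n \<omega>} = 1 - p"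
    using p_range by simp_all
qed

text \<open>The prescribed probabilities of the values 1 to n already add up to 1.\<close>

lemma beta_range:
  assumes n: "n \<ge> 1"
  shows "AE \<omega> in P. \<beta> (Suc n) \<omega> \<in> {1..n}"
proof -
  have [measurable]: "\<beta> (Suc n) \<in> measurable P (count_space UNIV)" using n by (intro beta_measurable) auto
  have "prob {\<omega> \<in> space P. \<beta> (Suc n) \<omega> \<in> {1..n}} = prob (\<Union>k\<in>{1..n}. {\<omega> \<in> space P. \<beta> (Suc n) \<omega> = k})"
    by (rule arg_cong[where f = prob]) auto
  also have "\<dots> = (\<Sum>k\<in>{1..n}. prob {\<omega> \<in> space P. \<beta> (Suc n) \<omega> = k})"
    by (rule finite_measure_finite_Union) (auto simp: disjoint_family_on_def)
  also have "\<dots> = (\<Sum>k\<in>{1..n}. \<mu> k / \<nu> n)"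
    by (rule sum.cong[OF refl]) (use beta_distr[of "Suc n"] n in auto)
  also have "\<dots> = 1" using mem_sum_pos[OF n] by (simp add: sum_divide_distrib[symmetric] mem_sum_def)
  finally have "prob {\<omega> \<in> space P. \<beta> (Suc n) \<omega> \<in> {1..n}} = 1" .
  then show ?thesis by (subst (asm) prob_Collect_eq_1) auto
qed

lemma copy_expectation:
  assumes k: "k \<in> {1..n}"
  shows "(\<integral>\<omega>. copy n k \<omega> \<partial>P) = p * (\<mu> k / \<nu> n)"
proof -
  have n: "n \<ge> 1" using k by auto
  have ind: "indep_set (generator (1, Suc n)) (generator (2, Suc n))"
    by (rule indep_set_of_indep_sets[OF generators_indep, of "(1, Suc n)" "(2, Suc n)"])
       (use n in \<open>auto simp: sources_def time_set_def\<close>)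
  have [measurable]: "\<beta> (Suc n) \<in> measurable P (count_space UNIV)"
    "\<alpha> (Suc n) \<in> measurable P (count_space UNIV)"
    using n by (auto intro!: beta_measurable alpha_measurable)
  define A where "A = \<alpha> (Suc n) -` {True} \<inter> space P"
  define B where "B = \<beta> (Suc n) -` {k} \<inter> space P"
  have AB: "A = {\<omega> \<in> space P. \<alpha> (Suc n) \<omega>}" "B = {\<omega> \<in> space P. \<beta> (Suc n) \<omega> = k}"
    by (auto simp: A_def B_def)
  have "(\<integral>\<omega>. copy n k \<omega> \<partial>P) = (\<integral>\<omega>. indicator (A \<inter> B) \<omega> \<partial>P)"
    by (rule Bochner_Integration.integral_cong) (auto simp: copy_def AB)
  also have "\<dots> = prob (A \<inter> B)" by (simp add: A_def B_def)
  also have "\<dots> = prob A * prob B"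
    by (rule indep_setD[OF ind]) (use n alpha_generator[of "Suc n" "{True}"] beta_generator[of "Suc n" "{k}"] in \<open>auto simp: A_def B_def\<close>)
  also have "prob A = p" unfolding AB by (rule alpha_prob) (use n in auto)
  also have "prob B = \<mu> k / \<nu> n" unfolding AB using beta_distr[of "Suc n" k] n k by auto
  finally show ?thesis .
qed

text \<open>The decision to renew and the innovation are both fresh at time n + 1, so independence
  from the past does not separate them; independence of their two generators does.\<close>

lemma renew_expectation:
  fixes \<phi> :: "real \<Rightarrow> real"
  assumes n: "n \<ge> 1" and \<phi> [measurable]: "\<phi> \<in> borel_measurable borel" and int: "integrable P (\<lambda>\<omega>. \<phi> (\<xi> 1 \<omega>))"
  shows "integrable P (\<lambda>\<omega>. renew n \<omega> * \<phi> (\<xi> (Suc n) \<omega>))"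
    and "(\<integral>\<omega>. renew n \<omega> * \<phi> (\<xi> (Suc n) \<omega>) \<partial>P) = (1 - p) * (\<integral>\<omega>. \<phi> (\<xi> 1 \<omega>) \<partial>P)"
proof -
  define G where "G = sigma (space P) (generator (1, Suc n))"
  define H where "H = sigma (space P) (generator (0, Suc n))"
  have src: "(1, Suc n) \<in> sources" "(0, Suc n) \<in> sources"
    using n by (auto simp: sources_def time_set_def)
  have Pow: "generator (1, Suc n) \<subseteq> Pow (space P)" "generator (0, Suc n) \<subseteq> Pow (space P)"
    using generator_events[OF src(1)] generator_events[OF src(2)] sets.space_closed[of P] by blast+
  have GH: "sets G = sigma_sets (space P) (generator (1, Suc n))" "sets H = sigma_sets (space P) (generator (0, Suc n))"
    "space G = space P" "space H = space P"
    using Pow by (auto simp: G_def H_def)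
  have "indep_sets (\<lambda>x. sigma_sets (space P) (generator x)) sources"
    by (rule indep_sets_sigma[OF generators_indep generator_Int_stable])
  then have ind: "indep_set (sets G) (sets H)"
    unfolding GH by (rule indep_set_of_indep_sets[OF _ src]) auto
  have \<alpha>G [measurable]: "\<alpha> (Suc n) \<in> measurable G (count_space UNIV)"
    using alpha_generator[of "Suc n"] n GH by (intro measurableI) (auto intro!: sigma_sets.Basic)
  have \<xi>H [measurable]: "\<xi> (Suc n) \<in> borel_measurable H"
    using xi_generator[of "Suc n"] n GH by (intro measurableI) (auto intro!: sigma_sets.Basic)
  have rG: "renew n \<in> borel_measurable G" unfolding renew_def[abs_def] by measurable
  have \<phi>H: "(\<lambda>\<omega>. \<phi> (\<xi> (Suc n) \<omega>)) \<in> borel_measurable H" by measurable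
  have r: "integrable P (renew n)"
    by (rule Fresh_integrable_bounded[OF renew_Fresh[OF n], where K = 1]) (simp add: renew_def)
  have x: "integrable P (\<lambda>\<omega>. \<phi> (\<xi> (Suc n) \<omega>))" "(\<integral>\<omega>. \<phi> (\<xi> (Suc n) \<omega>) \<partial>P) = (\<integral>\<omega>. \<phi> (\<xi> 1 \<omega>) \<partial>P)"
    using xi_transfer[of "Suc n" \<phi>] int by auto
  show "integrable P (\<lambda>\<omega>. renew n \<omega> * \<phi> (\<xi> (Suc n) \<omega>))"
    by (rule indep_subalgebra_integrable[OF ind GH(3,4) rG r \<phi>H x(1)])
  have "(\<integral>\<omega>. renew n \<omega> \<partial>P) = (\<integral>\<omega>. indicator {\<omega> \<in> space P. \<not> \<alpha> (Suc n) \<omega>} \<omega> \<partial>P)"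
    by (rule Bochner_Integration.integral_cong) (auto simp: renew_def)
  also have "\<dots> = prob {\<omega> \<in> space P. \<not> \<alpha> (Suc n) \<omega>}"
    using alpha_measurable[of "Suc n"] n by simp
  also have "\<dots> = 1 - p" by (rule alpha_prob) (use n in auto)
  finally show "(\<integral>\<omega>. renew n \<omega> * \<phi> (\<xi> (Suc n) \<omega>) \<partial>P) = (1 - p) * (\<integral>\<omega>. \<phi> (\<xi> 1 \<omega>) \<partial>P)"
    using indep_subalgebra_expectation_mult[OF ind GH(3,4) rG r \<phi>H x(1)] x(2) by simp
qed

text \<open>The exceptional null set does not depend on \<phi>, so the quantifier may stand inside.
  The identity, the square and the indicator of x^2 \<noteq> 1 are inserted later.\<close>

lemma step_AE:
  assumes n: "n \<ge> 1"
  shows "AE \<omega> in P. \<forall>\<phi>. \<phi> (X (Suc n) \<omega>) = (\<Sum>k=1..n. copy n k \<omega> * \<phi> (X k \<omega>)) + renew n \<omega> * \<phi> (\<xi> (Suc n) \<omega>)"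
  using X_step[OF n] beta_range[OF n]
proof eventually_elim
  case (elim \<omega>)
  show ?case
  proof (cases "\<alpha> (Suc n) \<omega>")
    case True
    then have "(\<Sum>k=1..n. copy n k \<omega> * \<phi> (X k \<omega>)) = (\<Sum>k=1..n. if \<beta> (Suc n) \<omega> = k then \<phi> (X k \<omega>) else 0)" for \<phi> :: "real \<Rightarrow> real"
      by (intro sum.cong) (auto simp: copy_def)
    then show ?thesis using elim True by (simp add: renew_def)
  next
    case False
    then show ?thesis using elim by (simp add: renew_def copy_def)
  qed
qed

lemma X_adapted: "n \<ge> 1 \<Longrightarrow> X n \<in> borel_measurable (F n)"
proof (induction n rule: less_induct)
  case (less n)
  show ?case
  proof (cases "n = 1")
    case True
    show ?thesis unfolding True
      by (rule F_measurable_AE_eq[OF X_rv Fresh_F_measurable[OF xi_Fresh] X_init]) auto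
  next
    case False
    define m where "m = n - 1"
    have m: "n = Suc m" "m \<ge> 1" using less.prems False by (auto simp: m_def)
    have *: "X k \<in> borel_measurable (F (Suc m))" if "k \<in> {1..m}" for k
      using less.IH[of k] that m by (intro F_measurable_mono[of k "Suc m"]) auto
    show ?thesis unfolding m(1)
    proof (rule F_measurable_AE_eq[OF X_rv])
      show "AE \<omega> in P. X (Suc m) \<omega> = (\<Sum>k=1..m. copy m k \<omega> * X k \<omega>) + renew m \<omega> * \<xi> (Suc m) \<omega>"
        using step_AE[OF m(2)] by eventually_elim (drule spec[where x = "\<lambda>x. x"], assumption)
      show "(\<lambda>\<omega>. (\<Sum>k=1..m. copy m k \<omega> * X k \<omega>) + renew m \<omega> * \<xi> (Suc m) \<omega>) \<in> borel_measurable (F (Suc m))"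
        using * Fresh_F_measurable[OF copy_Fresh[OF m(2)]] Fresh_F_measurable[OF renew_Fresh[OF m(2)]]
          Fresh_F_measurable[OF xi_Fresh[of "Suc m"]]
        by (intro borel_measurable_add borel_measurable_sum borel_measurable_times) auto
    qed simp
  qed
qed

lemma X_adapted_le: "1 \<le> k \<Longrightarrow> k \<le> n \<Longrightarrow> X k \<in> borel_measurable (F n)"
  by (rule F_measurable_mono[OF _ X_adapted]) auto

lemma copy_mult_expectation:
  assumes k: "k \<in> {1..n}" and f: "f \<in> borel_measurable (F n)" "integrable P f"
  shows "integrable P (\<lambda>\<omega>. copy n k \<omega> * f \<omega>)"
    and "(\<integral>\<omega>. copy n k \<omega> * f \<omega> \<partial>P) = p * (\<mu> k / \<nu> n) * (\<integral>\<omega>. f \<omega> \<partial>P)"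
  using F_Fresh_expectation[OF f copy_Fresh copy_integrable, of k] k copy_expectation[OF k]
  by (auto simp: mult.commute)

lemma sum_copy_prob: "n \<ge> 1 \<Longrightarrow> (\<Sum>k=1..n. p * (\<mu> k / \<nu> n)) = p"
  using mem_sum_pos[of n]
  by (simp add: sum_distrib_left[symmetric] sum_divide_distrib[symmetric] mem_sum_def)

text \<open>A copied step has the second moment of an earlier one, a renewed step that of an
  innovation, and the weights p and 1 - p add up to 1.\<close>

lemma X_square_integrable_and_moment:
  "n \<ge> 1 \<Longrightarrow> square_integrable P (X n) \<and> (\<integral>\<omega>. (X n \<omega>)\<^sup>2 \<partial>P) = 1"
proof (induction n rule: less_induct)
  case (less n)
  show ?case
  proof (cases "n = 1")
    case True
    have "AE \<omega> in P. (X 1 \<omega>)\<^sup>2 = (\<xi> 1 \<omega>)\<^sup>2" using X_init by eventually_elim simp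
    then have "integrable P (\<lambda>\<omega>. (X 1 \<omega>)\<^sup>2) \<longleftrightarrow> integrable P (\<lambda>\<omega>. (\<xi> 1 \<omega>)\<^sup>2)"
      "(\<integral>\<omega>. (X 1 \<omega>)\<^sup>2 \<partial>P) = (\<integral>\<omega>. (\<xi> 1 \<omega>)\<^sup>2 \<partial>P)"
      using X_rv[of 1] xi_measurable[of 1]
      by (intro integrable_cong_AE integral_cong_AE borel_measurable_power; simp)+
    then show ?thesis
      using X_rv[of 1] xi_square_integrable xi_second_moment True by (simp add: square_integrable_def)
  next
    case False
    define m where "m = n - 1"
    have m: "n = Suc m" "m \<ge> 1" using less.prems False by (auto simp: m_def)
    have IH: "integrable P (\<lambda>\<omega>. (X k \<omega>)\<^sup>2)" "(\<integral>\<omega>. (X k \<omega>)\<^sup>2 \<partial>P) = 1" if "k \<in> {1..m}" for k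
      using less.IH[of k] that m by (auto simp: square_integrable_def)
    have ad: "(\<lambda>\<omega>. (X k \<omega>)\<^sup>2) \<in> borel_measurable (F m)" if "k \<in> {1..m}" for k
      using that X_adapted_le[of k m] by auto
    define R where "R \<omega> = (\<Sum>k=1..m. copy m k \<omega> * (X k \<omega>)\<^sup>2) + renew m \<omega> * (\<xi> (Suc m) \<omega>)\<^sup>2" for \<omega>
    have sq: "(\<lambda>x::real. x\<^sup>2) \<in> borel_measurable borel" by measurable
    note renew = renew_expectation[OF m(2) sq xi_square_integrable]
    have int: "integrable P R"
      unfolding R_def[abs_def]
      by (intro Bochner_Integration.integrable_add Bochner_Integration.integrable_sum renew copy_mult_expectation ad IH)
    have "(\<integral>\<omega>. R \<omega> \<partial>P) = (\<Sum>k=1..m. \<integral>\<omega>. copy m k \<omega> * (X k \<omega>)\<^sup>2 \<partial>P) + (1 - p) * 1"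
      unfolding R_def[abs_def] using renew xi_second_moment copy_mult_expectation(1)[OF _ ad IH(1)]
      by (subst Bochner_Integration.integral_add) (auto simp: Bochner_Integration.integral_sum)
    also have "(\<Sum>k=1..m. \<integral>\<omega>. copy m k \<omega> * (X k \<omega>)\<^sup>2 \<partial>P) = (\<Sum>k=1..m. p * (\<mu> k / \<nu> m))"
      by (rule sum.cong[OF refl]) (simp only: copy_mult_expectation(2)[OF _ ad IH(1)] IH(2) mult_1_right)
    also have "\<dots> = p" by (rule sum_copy_prob[OF m(2)])
    finally have one: "(\<integral>\<omega>. R \<omega> \<partial>P) = 1" by simp
    have eq: "AE \<omega> in P. (X (Suc m) \<omega>)\<^sup>2 = R \<omega>"
      using step_AE[OF m(2)] unfolding R_def by eventually_elim (drule spec[where x = "\<lambda>x. x\<^sup>2"], assumption)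
    have Xm: "X (Suc m) \<in> borel_measurable P" by (rule X_rv) simp
    have "integrable P (\<lambda>\<omega>. (X (Suc m) \<omega>)\<^sup>2)" "(\<integral>\<omega>. (X (Suc m) \<omega>)\<^sup>2 \<partial>P) = 1"
      using int one integrable_cong_AE[OF _ _ eq] integral_cong_AE[OF _ _ eq] Xm
      by (auto simp: borel_measurable_integrable)
    then show ?thesis using Xm m(1) by (simp add: square_integrable_def)
  qed
qed

lemmas X_square_integrable = X_square_integrable_and_moment[THEN conjunct1]
lemmas X_second_moment = X_square_integrable_and_moment[THEN conjunct2]

section \<open>Martingale differences of the walk\<close>

definition Y :: "nat \<Rightarrow> 'a \<Rightarrow> real" where
  "Y n \<omega> = (\<Sum>k=1..n. \<mu> k * X k \<omega>)"

text \<open>At \<open>n = 0\<close> the quotient is \<open>0 / 0 = 0\<close>, so that \<open>noise 0\<close> is \<open>X 1\<close>.\<close>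

definition noise :: "nat \<Rightarrow> 'a \<Rightarrow> real" where
  "noise n \<omega> = X (Suc n) \<omega> - p * (Y n \<omega> / \<nu> n)"

lemma Y_adapted: "Y n \<in> borel_measurable (F n)"
  unfolding Y_def[abs_def] using X_adapted_le
  by (intro borel_measurable_sum borel_measurable_times) auto

lemma Y_square_integrable: "square_integrable P (Y n)"
  unfolding Y_def[abs_def]
  by (intro square_integrable_sum square_integrable_cmult X_square_integrable) auto

text \<open>The weak form of E(X (n+1) | F n) = p Y n / \<nu> n: index k is copied with probability
  p \<mu> k / \<nu> n, independently of the past, and a renewal has mean 0.\<close>

lemma step_expectation:
  assumes g: "g \<in> borel_measurable (F n)" "square_integrable P g"
  shows "(\<integral>\<omega>. g \<omega> * X (Suc n) \<omega> \<partial>P) = p * ((\<integral>\<omega>. g \<omega> * Y n \<omega> \<partial>P) / \<nu> n)"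
proof (cases "n = 0")
  \<comment> \<open>Here the step is a fresh innovation of mean 0, and Y 0 = 0 on the right.\<close>
  case True
  have gm: "g \<in> borel_measurable P" using g by (simp add: square_integrable_def)
  have one: "square_integrable P (\<lambda>\<omega>. 1)" by (simp add: square_integrable_def)
  have gi: "integrable P g" using square_integrable_mult_integrable[OF g(2) one] by simp
  have "(\<integral>\<omega>. g \<omega> * X (Suc n) \<omega> \<partial>P) = (\<integral>\<omega>. g \<omega> * \<xi> (Suc n) \<omega> \<partial>P)"
    using X_init gm X_rv[of 1] xi_measurable[of 1] True
    by (intro integral_cong_AE) (auto elim!: eventually_mono)
  also have "\<dots> = (\<integral>\<omega>. g \<omega> \<partial>P) * (\<integral>\<omega>. \<xi> (Suc n) \<omega> \<partial>P)"
    by (rule F_Fresh_expectation_mult[OF g(1) gi xi_Fresh xi_moments(1)]) auto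
  finally show ?thesis using xi_moments(2)[of "Suc n"] True by (simp add: Y_def)
next
  case False
  then have n: "n \<ge> 1" by simp
  have gm: "g \<in> borel_measurable P" using g by (simp add: square_integrable_def)
  have one: "square_integrable P (\<lambda>\<omega>. 1)" by (simp add: square_integrable_def)
  have gi: "integrable P g" using square_integrable_mult_integrable[OF g(2) one] by simp
  have gX: "integrable P (\<lambda>\<omega>. g \<omega> * X k \<omega>)" "(\<lambda>\<omega>. g \<omega> * X k \<omega>) \<in> borel_measurable (F n)" if "k \<in> {1..n}" for k
    using that g square_integrable_mult_integrable[OF g(2) X_square_integrable] X_adapted_le[of k n]
    by auto
  have id: "(\<lambda>x::real. x) \<in> borel_measurable borel" by simp
  define h where "h \<omega> = renew n \<omega> * \<xi> (Suc n) \<omega>" for \<omega>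
  have h: "integrable P h" "(\<integral>\<omega>. h \<omega> \<partial>P) = 0"
    using renew_expectation[OF n id xi_integrable] xi_mean by (auto simp: h_def[abs_def])
  have hF: "h \<in> borel_measurable (Fresh (Suc n))"
    unfolding h_def[abs_def] using renew_Fresh[OF n] xi_Fresh[of "Suc n"] by auto
  note gh = F_Fresh_expectation[OF g(1) gi hF h(1)]
  note cp = copy_mult_expectation[OF _ gX(2) gX(1)]
  have eq: "AE \<omega> in P. g \<omega> * X (Suc n) \<omega> = (\<Sum>k=1..n. copy n k \<omega> * (g \<omega> * X k \<omega>)) + g \<omega> * h \<omega>"
    using step_AE[OF n]
  proof eventually_elim
    case (elim \<omega>)
    from elim[rule_format, of "\<lambda>x. x"]
    show ?case by (simp add: h_def distrib_left sum_distrib_left mult.left_commute)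
  qed
  have int: "integrable P (\<lambda>\<omega>. (\<Sum>k=1..n. copy n k \<omega> * (g \<omega> * X k \<omega>)) + g \<omega> * h \<omega>)"
    by (intro Bochner_Integration.integrable_add Bochner_Integration.integrable_sum gh cp)
  have "(\<integral>\<omega>. g \<omega> * X (Suc n) \<omega> \<partial>P) = (\<integral>\<omega>. (\<Sum>k=1..n. copy n k \<omega> * (g \<omega> * X k \<omega>)) + g \<omega> * h \<omega> \<partial>P)"
    by (rule integral_cong_AE[OF _ borel_measurable_integrable[OF int] eq]) (use gm X_rv[of "Suc n"] in auto)
  also have "\<dots> = (\<Sum>k=1..n. \<integral>\<omega>. copy n k \<omega> * (g \<omega> * X k \<omega>) \<partial>P)"
    using gh cp h(2) by (subst Bochner_Integration.integral_add) (auto simp: Bochner_Integration.integral_sum)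
  also have "\<dots> = (\<Sum>k=1..n. p * (\<mu> k / \<nu> n) * (\<integral>\<omega>. g \<omega> * X k \<omega> \<partial>P))"
    by (rule sum.cong[OF refl]) (rule cp(2))
  also have "\<dots> = p * ((\<Sum>k=1..n. \<mu> k * (\<integral>\<omega>. g \<omega> * X k \<omega> \<partial>P)) / \<nu> n)"
    by (simp add: sum_distrib_left sum_divide_distrib mult.assoc)
  also have "(\<Sum>k=1..n. \<mu> k * (\<integral>\<omega>. g \<omega> * X k \<omega> \<partial>P)) = (\<integral>\<omega>. (\<Sum>k=1..n. \<mu> k * (g \<omega> * X k \<omega>)) \<partial>P)"
    using gX(1) by (subst Bochner_Integration.integral_sum) auto
  also have "\<dots> = (\<integral>\<omega>. g \<omega> * Y n \<omega> \<partial>P)"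
    by (simp add: Y_def sum_distrib_left mult.left_commute)
  finally show ?thesis .
qed

lemma noise_square_integrable: "square_integrable P (noise n)"
  unfolding noise_def[abs_def]
  using square_integrable_diff[OF X_square_integrable[of "Suc n"] square_integrable_cmult[OF Y_square_integrable[of n], of "p / \<nu> n"]]
  by simp

lemma noise_orthogonal:
  assumes g: "g \<in> borel_measurable (F n)" "square_integrable P g"
  shows "(\<integral>\<omega>. g \<omega> * noise n \<omega> \<partial>P) = 0"
proof -
  have "integrable P (\<lambda>\<omega>. g \<omega> * X (Suc n) \<omega>)" "integrable P (\<lambda>\<omega>. g \<omega> * Y n \<omega>)"
    by (auto intro!: square_integrable_mult_integrable g X_square_integrable Y_square_integrable)
  moreover have "(\<integral>\<omega>. g \<omega> * noise n \<omega> \<partial>P) = (\<integral>\<omega>. g \<omega> * X (Suc n) \<omega> - p / \<nu> n * (g \<omega> * Y n \<omega>) \<partial>P)"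
    by (rule Bochner_Integration.integral_cong) (auto simp: noise_def algebra_simps)
  ultimately show ?thesis using step_expectation[OF g] by simp
qed

text \<open>Pythagoras: X (n+1), of second moment 1, is the orthogonal sum of the noise and its
  predictable part.\<close>

lemma noise_second_moment: "(\<integral>\<omega>. (noise n \<omega>)\<^sup>2 \<partial>P) \<le> 1"
proof -
  define m where "m \<omega> = p / \<nu> n * Y n \<omega>" for \<omega>
  have m: "m \<in> borel_measurable (F n)" "square_integrable P m"
    unfolding m_def[abs_def] using Y_adapted[of n] square_integrable_cmult[OF Y_square_integrable[of n], of "p / \<nu> n"]
    by simp_all
  have i: "integrable P (\<lambda>\<omega>. (noise n \<omega>)\<^sup>2)" "integrable P (\<lambda>\<omega>. m \<omega> * noise n \<omega>)" "integrable P (\<lambda>\<omega>. (m \<omega>)\<^sup>2)"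
    using noise_square_integrable[of n] m square_integrable_mult_integrable[OF m(2) noise_square_integrable[of n]]
    by (auto simp: square_integrable_def)
  have "1 = (\<integral>\<omega>. (X (Suc n) \<omega>)\<^sup>2 \<partial>P)" by (simp add: X_second_moment)
  also have "\<dots> = (\<integral>\<omega>. (noise n \<omega>)\<^sup>2 + 2 * (m \<omega> * noise n \<omega>) + (m \<omega>)\<^sup>2 \<partial>P)"
    by (rule Bochner_Integration.integral_cong) (auto simp: noise_def m_def power2_eq_square algebra_simps)
  also have "\<dots> = (\<integral>\<omega>. (noise n \<omega>)\<^sup>2 \<partial>P) + (\<integral>\<omega>. (m \<omega>)\<^sup>2 \<partial>P)"
    using i noise_orthogonal[OF m] by simp
  finally have "(\<integral>\<omega>. (noise n \<omega>)\<^sup>2 \<partial>P) + (\<integral>\<omega>. (m \<omega>)\<^sup>2 \<partial>P) = 1" by simp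
  moreover have "0 \<le> (\<integral>\<omega>. (m \<omega>)\<^sup>2 \<partial>P)" by simp
  ultimately show ?thesis by linarith
qed

lemma noise_adapted: "noise n \<in> borel_measurable (F (Suc n))"
  unfolding noise_def[abs_def]
  using X_adapted[of "Suc n"] F_measurable_mono[OF _ Y_adapted[of n], of "Suc n"] by auto

end

sublocale srrw_L2 \<subseteq> noise: orthogonal_noise P F noise
  by unfold_locales
    (use F_subalgebra sets_F_mono noise_adapted noise_square_integrable noise_second_moment noise_orthogonal in auto)

context srrw_L2
begin

lemma mart_Y: "mart p \<mu> X n \<omega> = a n * Y n \<omega>"
  by (simp add: mart_def Y_def)

lemma Y_Suc: "Y (Suc n) \<omega> = Y n \<omega> + \<mu> (Suc n) * X (Suc n) \<omega>"
  by (simp add: Y_def)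

text \<open>The factor \<open>a\<close> is built so that the predictable part of the increment of Y
  cancels: a (n+1) (1 + p \<mu> (n+1) / \<nu> n) = a n.\<close>

lemma mart_eq_sum_noise: "mart p \<mu> X n \<omega> = (\<Sum>j<n. d (Suc j) * noise j \<omega>)"
proof (induction n)
  case 0 then show ?case by (simp add: mart_def)
next
  case (Suc n)
  have "mart p \<mu> X (Suc n) \<omega> = mart p \<mu> X n \<omega> + d (Suc n) * noise n \<omega>"
  proof (cases "n = 0")
    case True then show ?thesis by (simp add: mart_Y Y_def d_def noise_def)
  next
    case False
    then have "a n = a (Suc n) * (1 + p * (\<mu> (Suc n) / \<nu> n))" using coeff_a_Suc[of n] by simp
    then have "mart p \<mu> X n \<omega> = a (Suc n) * (1 + p * (\<mu> (Suc n) / \<nu> n)) * Y n \<omega>" by (simp add: mart_Y)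
    then show ?thesis
      by (simp add: mart_Y Y_Suc d_def noise_def algebra_simps)
  qed
  then show ?case using Suc by simp
qed

text \<open>The predictable part of X (k+1) is p Y k / \<nu> k = p c k M k. It is 0 for k = 0, hence
  the lower limit 1 in the second sum.\<close>

lemma walk_decomposition:
  "walk X n \<omega> = (\<Sum>j<n. noise j \<omega>) + p * (\<Sum>k=1..<n. c k * mart p \<mu> X k \<omega>)"
proof (induction n)
  case 0 then show ?case by (simp add: walk_def)
next
  case (Suc n)
  have "walk X (Suc n) \<omega> = walk X n \<omega> + noise n \<omega> + p * (Y n \<omega> / \<nu> n)"
    by (simp add: walk_def noise_def)
  moreover have "p * (Y n \<omega> / \<nu> n) = p * ((\<Sum>k=1..<Suc n. c k * mart p \<mu> X k \<omega>) - (\<Sum>k=1..<n. c k * mart p \<mu> X k \<omega>))"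
  proof (cases "n = 0")
    case True then show ?thesis by (simp add: Y_def)
  next
    case False
    then have "(\<Sum>k=1..<Suc n. c k * mart p \<mu> X k \<omega>) = (\<Sum>k=1..<n. c k * mart p \<mu> X k \<omega>) + c n * mart p \<mu> X n \<omega>"
      by (intro sum.atLeastLessThan_Suc) auto
    moreover have "c n * mart p \<mu> X n \<omega> = Y n \<omega> / \<nu> n"
      using coeff_a_pos[of n] by (simp add: c_def mart_Y)
    ultimately show ?thesis by simp
  qed
  ultimately show ?case using Suc by (simp add: algebra_simps)
qed

lemma mart_square_integrable: "square_integrable P (mart p \<mu> X n)"
  unfolding mart_Y[abs_def] by (rule square_integrable_cmult[OF Y_square_integrable])

lemma walk_square_integrable: "square_integrable P (walk X n)"
  unfolding walk_def[abs_def] by (intro square_integrable_sum X_square_integrable) auto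

end

section \<open>Convergence of the martingale and of the scaled walk\<close>

locale srrw_supercritical = srrw_L2 +
  assumes v_bounded: "bounded (range (coeff_v p \<mu>))"
    and p_ge_crit: "p_crit \<gamma> \<le> p"
begin

text \<open>The critical value of p is the one at which \<rho> = 1/2, so in fact \<rho> \<ge> 1/2
  here.\<close>

lemma rho_pos: "\<rho> > 0"
proof -
  have "\<gamma> + 1/2 \<le> p * (\<gamma> + 1)"
    using p_ge_crit gamma_bound by (simp add: p_crit_def divide_le_eq)
  then show ?thesis by (simp add: \<rho>_def)
qed

lemma d_summable: "summable (\<lambda>n. (d n)\<^sup>2)"
proof -
  obtain B where B: "\<And>n. \<bar>coeff_v p \<mu> n\<bar> \<le> B"
    using v_bounded by (auto simp: bounded_iff)
  have le: "(\<Sum>k=1..n. (d k)\<^sup>2) \<le> B\<^sup>2" for n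
  proof -
    have "(\<Sum>k=1..n. (d k)\<^sup>2) = (coeff_v p \<mu> n)\<^sup>2"
      by (simp add: coeff_v_def d_def power_mult_distrib sum_nonneg)
    also have "\<dots> \<le> B\<^sup>2" using B[of n] by (rule abs_le_square_iff[THEN iffD1, OF order_trans]) simp
    finally show ?thesis .
  qed
  \<comment> \<open>The sum in \<open>coeff_v\<close> starts at index 1, whereas d 0 involves the
    unconstrained \<mu> 0; the shifted series avoids it.\<close>
  have "summable (\<lambda>n. (d (Suc n))\<^sup>2)"
  proof (rule bounded_imp_summable)
    fix n
    have "(\<Sum>k\<le>n. (d (Suc k))\<^sup>2) = (\<Sum>k=1..Suc n. (d k)\<^sup>2)"
      using sum.shift_bounds_cl_Suc_ivl[of "\<lambda>k. (d k)\<^sup>2" 0 n] by (simp add: atMost_atLeast0)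
    then show "(\<Sum>k\<le>n. (d (Suc k))\<^sup>2) \<le> B\<^sup>2" using le[of "Suc n"] by (simp only:)
  qed simp
  then show ?thesis by (simp only: summable_Suc_iff[of "\<lambda>n. (d n)\<^sup>2"])
qed

abbreviation M :: "nat \<Rightarrow> 'a \<Rightarrow> real" where "M \<equiv> mart p \<mu> X"
abbreviation Minf :: "'a \<Rightarrow> real" where "Minf \<equiv> mart_lim p \<mu> X"
definition \<kappa> :: real where "\<kappa> = p * (\<gamma> + 1) / \<rho>"

lemma d_Suc_summable: "summable (\<lambda>n. (d (Suc n))\<^sup>2)"
  using d_summable by (simp only: summable_Suc_iff[of "\<lambda>n. (d n)\<^sup>2"])

lemma inverse_b_Suc_summable: "summable (\<lambda>n. (1 / b (Suc n))\<^sup>2)"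
  using inverse_b_summable[OF rho_pos d_summable] by (simp only: summable_Suc_iff[of "\<lambda>n. (1 / b n)\<^sup>2"])

lemma series_mart: "noise.series (\<lambda>j. d (Suc j)) = M"
  by (intro ext) (simp add: noise.series_def[OF d_Suc_summable] mart_eq_sum_noise)

lemma mart_converges_AE: "AE \<omega> in P. (\<lambda>n. M n \<omega>) \<longlonglongrightarrow> Minf \<omega>"
  using noise.series_converges_AE[OF d_Suc_summable]
  by eventually_elim (simp add: series_mart mart_lim_def convergent_LIMSEQ_iff)

lemma mart_converges_L2: "converges_L2 P M Minf"
  using noise.series_converges_L2[OF d_Suc_summable]
  by (simp add: series_mart mart_lim_def[abs_def])

lemma noise_sum_converges_AE: "AE \<omega> in P. (\<lambda>n. d n * (\<Sum>j<n. noise j \<omega>)) \<longlonglongrightarrow> 0"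
  using noise.series_converges_AE[OF inverse_b_Suc_summable]
proof eventually_elim
  case (elim \<omega>)
  then have conv: "convergent (\<lambda>n. \<Sum>k<n. 1 / b (Suc k) * noise k \<omega>)"
    by (simp add: noise.series_def[OF inverse_b_Suc_summable])
  have "b (Suc k) * (1 / b (Suc k) * noise k \<omega>) = noise k \<omega>" for k
    using b_pos[of "Suc k"] by simp
  then have "(\<lambda>n. (\<Sum>k<n. noise k \<omega>) / b n) \<longlonglongrightarrow> 0"
    using kronecker[OF b_eventually_increasing[OF rho_pos] b_at_top[OF rho_pos d_summable] conv] by (simp only:)
  from tendsto_mult[OF d_b_limit this]
  have "(\<lambda>n. d n * b n * ((\<Sum>k<n. noise k \<omega>) / b n)) \<longlonglongrightarrow> 0" by simp
  moreover have "eventually (\<lambda>n. d n * b n * ((\<Sum>k<n. noise k \<omega>) / b n) = d n * (\<Sum>k<n. noise k \<omega>)) sequentially"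
    using eventually_ge_at_top[of 1]
  proof eventually_elim
    case (elim n) then show ?case using b_pos[OF elim] by simp
  qed
  ultimately show ?case by (rule Lim_transform_eventually)
qed

lemma scaled_walk: "a n * \<mu> n * walk X n \<omega>
    = d n * (\<Sum>j<n. noise j \<omega>) + p * d n * (\<Sum>k=1..<n. c k * M k \<omega>)"
  by (simp add: walk_decomposition d_def algebra_simps)

lemma sum_c_pos: "eventually (\<lambda>n. (\<Sum>k=1..<n. c k) > 0) sequentially"
  using eventually_ge_at_top[of 2]
  by eventually_elim (rule sum_pos, auto intro: c_pos)

text \<open>Used twice: along a path for the values M k, and for the mean square distances of M k
  from the limit.\<close>

lemma weighted_average_limit:
  assumes "m \<longlonglongrightarrow> L"
  shows "(\<lambda>n. d n * (\<Sum>k=1..<n. c k * m k)) \<longlonglongrightarrow> (\<gamma> + 1) / \<rho> * L"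
proof -
  have "(\<lambda>n. (d n * (\<Sum>k=1..<n. c k)) * ((\<Sum>k=1..<n. c k * m k) / (\<Sum>k=1..<n. c k))) \<longlonglongrightarrow> (\<gamma> + 1) / \<rho> * L"
    by (intro tendsto_mult d_sum_c_limit rho_pos weighted_average_tendsto sum_c_at_top assms c_pos)
  moreover have "eventually (\<lambda>n. (d n * (\<Sum>k=1..<n. c k)) * ((\<Sum>k=1..<n. c k * m k) / (\<Sum>k=1..<n. c k))
      = d n * (\<Sum>k=1..<n. c k * m k)) sequentially"
    using sum_c_pos by eventually_elim simp
  ultimately show ?thesis by (rule Lim_transform_eventually)
qed

lemma walk_converges_AE: "AE \<omega> in P. (\<lambda>n. a n * \<mu> n * walk X n \<omega>) \<longlonglongrightarrow> \<kappa> * Minf \<omega>"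
  using noise_sum_converges_AE mart_converges_AE
proof eventually_elim
  case (elim \<omega>)
  have "(\<lambda>n. d n * (\<Sum>j<n. noise j \<omega>) + p * (d n * (\<Sum>k=1..<n. c k * M k \<omega>))) \<longlonglongrightarrow> 0 + p * ((\<gamma> + 1) / \<rho> * Minf \<omega>)"
    using elim by (intro tendsto_intros weighted_average_limit)
  moreover have "0 + p * ((\<gamma> + 1) / \<rho> * Minf \<omega>) = \<kappa> * Minf \<omega>" by (simp add: \<kappa>_def)
  ultimately show ?case unfolding scaled_walk by (simp only: mult.assoc)
qed

text \<open>The error splits into the noise, a weighted sum of the deviations M k - Minf, and the
  error of the deterministic coefficient of Minf. Cauchy-Schwarz with weights c k turns the square
  of the second part into a weighted sum of squares, whose expectation
  \<open>weighted_average_limit\<close> handles.\<close>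

lemma walk_error_bound:
  shows "(\<integral>\<omega>. (a n * \<mu> n * walk X n \<omega> - \<kappa> * Minf \<omega>)\<^sup>2 \<partial>P)
    \<le> 3 * (real n * (d n)\<^sup>2 + p\<^sup>2 * ((d n * (\<Sum>k=1..<n. c k)) * (d n * (\<Sum>k=1..<n. c k * (\<integral>\<omega>. (M k \<omega> - Minf \<omega>)\<^sup>2 \<partial>P))))
      + (p * (d n * (\<Sum>k=1..<n. c k)) - \<kappa>)\<^sup>2 * (\<integral>\<omega>. (Minf \<omega>)\<^sup>2 \<partial>P))"
proof -
  define C where "C = (\<Sum>k=1..<n. c k)"
  define W where "W \<omega> = (\<Sum>j<n. noise j \<omega>)" for \<omega>
  define D where "D k \<omega> = M k \<omega> - Minf \<omega>" for k \<omega>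
  have MD: "square_integrable P Minf" "square_integrable P (M k)" for k
    using mart_converges_L2 by (auto simp: converges_L2_def)
  have int: "integrable P (\<lambda>\<omega>. (W \<omega>)\<^sup>2)" "integrable P (\<lambda>\<omega>. (D k \<omega>)\<^sup>2)" "integrable P (\<lambda>\<omega>. (Minf \<omega>)\<^sup>2)" for k
  proof -
    show "integrable P (\<lambda>\<omega>. (W \<omega>)\<^sup>2)"
      using noise.predictable_transform_square_integrable[of "\<lambda>_ _. 1" "\<lambda>_. 1" n]
      by (simp add: W_def[abs_def] square_integrable_def)
    show "integrable P (\<lambda>\<omega>. (D k \<omega>)\<^sup>2)"
      using square_integrable_diff[OF MD(2,1)] by (simp add: D_def square_integrable_def)
    show "integrable P (\<lambda>\<omega>. (Minf \<omega>)\<^sup>2)" using MD(1) by (simp add: square_integrable_def)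
  qed
  have W: "(\<integral>\<omega>. (W \<omega>)\<^sup>2 \<partial>P) \<le> real n"
    using noise.predictable_transform_second_moment[of "\<lambda>_ _. 1" "\<lambda>_. 1" n]
    by (simp add: W_def)
  have c0: "c k \<ge> 0" if "k \<in> {1..<n}" for k using that c_pos[of k] by auto
  have pointwise: "(a n * \<mu> n * walk X n \<omega> - \<kappa> * Minf \<omega>)\<^sup>2
    \<le> 3 * ((d n)\<^sup>2 * (W \<omega>)\<^sup>2 + p\<^sup>2 * ((d n)\<^sup>2 * C * (\<Sum>k=1..<n. c k * (D k \<omega>)\<^sup>2)) + (p * (d n * C) - \<kappa>)\<^sup>2 * (Minf \<omega>)\<^sup>2)" for \<omega>
  proof -
    define u where "u = d n * W \<omega>"
    define v where "v = p * d n * (\<Sum>k=1..<n. c k * D k \<omega>)"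
    define z where "z = (p * (d n * C) - \<kappa>) * Minf \<omega>"
    have "(\<Sum>k=1..<n. c k * M k \<omega>) = (\<Sum>k=1..<n. c k * D k \<omega>) + C * Minf \<omega>"
      by (simp add: D_def C_def algebra_simps sum_subtractf sum_distrib_left)
    then have "a n * \<mu> n * walk X n \<omega> - \<kappa> * Minf \<omega> = u + v + z"
      unfolding scaled_walk by (simp add: u_def v_def z_def W_def algebra_simps)
    moreover have "(u + v + z)\<^sup>2 \<le> 3 * (u\<^sup>2 + v\<^sup>2 + z\<^sup>2)"
    proof -
      have "0 \<le> (u - v)\<^sup>2 + (v - z)\<^sup>2 + (u - z)\<^sup>2" by simp
      then show ?thesis by (simp add: power2_eq_square algebra_simps)
    qed
    moreover have "(\<Sum>k=1..<n. c k * D k \<omega>)\<^sup>2 \<le> C * (\<Sum>k=1..<n. c k * (D k \<omega>)\<^sup>2)"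
    proof -
      have "(\<Sum>k=1..<n. c k * D k \<omega>)\<^sup>2 = (\<Sum>k=1..<n. sqrt (c k) * (sqrt (c k) * D k \<omega>))\<^sup>2"
        by (rule arg_cong[where f = "\<lambda>x. x\<^sup>2"], rule sum.cong) (use c0 in \<open>auto simp: mult.assoc[symmetric]\<close>)
      also have "\<dots> \<le> (\<Sum>k=1..<n. (sqrt (c k))\<^sup>2) * (\<Sum>k=1..<n. (sqrt (c k) * D k \<omega>)\<^sup>2)"
        by (rule Cauchy_Schwarz_ineq_sum)
      also have "\<dots> = C * (\<Sum>k=1..<n. c k * (D k \<omega>)\<^sup>2)"
        using c0 by (simp add: C_def power_mult_distrib)
      finally show ?thesis .
    qed
    then have "v\<^sup>2 \<le> (p\<^sup>2 * (d n)\<^sup>2) * (C * (\<Sum>k=1..<n. c k * (D k \<omega>)\<^sup>2))"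
      unfolding v_def power_mult_distrib by (rule mult_left_mono) simp
    ultimately show ?thesis
      by (simp add: u_def z_def power_mult_distrib mult.assoc)
  qed
  have "(\<integral>\<omega>. (a n * \<mu> n * walk X n \<omega> - \<kappa> * Minf \<omega>)\<^sup>2 \<partial>P) \<le>
     (\<integral>\<omega>. 3 * ((d n)\<^sup>2 * (W \<omega>)\<^sup>2 + p\<^sup>2 * ((d n)\<^sup>2 * C * (\<Sum>k=1..<n. c k * (D k \<omega>)\<^sup>2)) + (p * (d n * C) - \<kappa>)\<^sup>2 * (Minf \<omega>)\<^sup>2) \<partial>P)"
  proof (rule integral_mono[OF _ _ pointwise])
    show "integrable P (\<lambda>\<omega>. (a n * \<mu> n * walk X n \<omega> - \<kappa> * Minf \<omega>)\<^sup>2)"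
      using square_integrable_diff[OF square_integrable_cmult[OF walk_square_integrable] square_integrable_cmult[OF MD(1)]]
      by (simp add: square_integrable_def)
  qed (intro Bochner_Integration.integrable_mult_right Bochner_Integration.integrable_add
      Bochner_Integration.integrable_sum int)
  also have "\<dots> = 3 * ((d n)\<^sup>2 * (\<integral>\<omega>. (W \<omega>)\<^sup>2 \<partial>P) + p\<^sup>2 * ((d n)\<^sup>2 * C * (\<Sum>k=1..<n. c k * (\<integral>\<omega>. (D k \<omega>)\<^sup>2 \<partial>P)))
      + (p * (d n * C) - \<kappa>)\<^sup>2 * (\<integral>\<omega>. (Minf \<omega>)\<^sup>2 \<partial>P))"
    using int by (simp add: Bochner_Integration.integral_sum)
  also have "\<dots> \<le> 3 * ((d n)\<^sup>2 * real n + p\<^sup>2 * ((d n)\<^sup>2 * C * (\<Sum>k=1..<n. c k * (\<integral>\<omega>. (D k \<omega>)\<^sup>2 \<partial>P)))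
      + (p * (d n * C) - \<kappa>)\<^sup>2 * (\<integral>\<omega>. (Minf \<omega>)\<^sup>2 \<partial>P))"
    using W by (intro mult_left_mono add_right_mono) auto
  finally show ?thesis by (simp add: C_def D_def power2_eq_square mult_ac)
qed

lemma walk_converges_L2: "converges_L2 P (\<lambda>n \<omega>. a n * \<mu> n * walk X n \<omega>) (\<lambda>\<omega>. \<kappa> * Minf \<omega>)"
  unfolding converges_L2_def
proof (intro conjI allI)
  show "square_integrable P (\<lambda>\<omega>. a n * \<mu> n * walk X n \<omega>)" for n
    by (rule square_integrable_cmult[OF walk_square_integrable])
  show "square_integrable P (\<lambda>\<omega>. \<kappa> * Minf \<omega>)"
    using mart_converges_L2 by (intro square_integrable_cmult) (simp add: converges_L2_def)
  have t: "(\<lambda>k. \<integral>\<omega>. (M k \<omega> - Minf \<omega>)\<^sup>2 \<partial>P) \<longlonglongrightarrow> 0"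
    using mart_converges_L2 by (simp add: converges_L2_def)
  have "(\<lambda>n. 3 * (real n * (d n)\<^sup>2 + p\<^sup>2 * ((d n * (\<Sum>k=1..<n. c k)) * (d n * (\<Sum>k=1..<n. c k * (\<integral>\<omega>. (M k \<omega> - Minf \<omega>)\<^sup>2 \<partial>P))))
      + (p * (d n * (\<Sum>k=1..<n. c k)) - \<kappa>)\<^sup>2 * (\<integral>\<omega>. (Minf \<omega>)\<^sup>2 \<partial>P)))
    \<longlonglongrightarrow> 3 * (0 + p\<^sup>2 * ((\<gamma> + 1) / \<rho> * ((\<gamma> + 1) / \<rho> * 0)) + (p * ((\<gamma> + 1) / \<rho>) - \<kappa>)\<^sup>2 * (\<integral>\<omega>. (Minf \<omega>)\<^sup>2 \<partial>P))"
    by (intro tendsto_intros n_d_squared_limit d_sum_c_limit weighted_average_limit t rho_pos d_summable)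
  then have lim: "(\<lambda>n. 3 * (real n * (d n)\<^sup>2 + p\<^sup>2 * ((d n * (\<Sum>k=1..<n. c k)) * (d n * (\<Sum>k=1..<n. c k * (\<integral>\<omega>. (M k \<omega> - Minf \<omega>)\<^sup>2 \<partial>P))))
      + (p * (d n * (\<Sum>k=1..<n. c k)) - \<kappa>)\<^sup>2 * (\<integral>\<omega>. (Minf \<omega>)\<^sup>2 \<partial>P))) \<longlonglongrightarrow> 0"
    by (simp add: \<kappa>_def)
  show "(\<lambda>n. \<integral>\<omega>. (a n * \<mu> n * walk X n \<omega> - \<kappa> * Minf \<omega>)\<^sup>2 \<partial>P) \<longlonglongrightarrow> 0"
  proof (rule tendsto_sandwich[OF _ _ tendsto_const lim])
    show "eventually (\<lambda>n. (\<integral>\<omega>. (a n * \<mu> n * walk X n \<omega> - \<kappa> * Minf \<omega>)\<^sup>2 \<partial>P)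
      \<le> 3 * (real n * (d n)\<^sup>2 + p\<^sup>2 * ((d n * (\<Sum>k=1..<n. c k)) * (d n * (\<Sum>k=1..<n. c k * (\<integral>\<omega>. (M k \<omega> - Minf \<omega>)\<^sup>2 \<partial>P))))
      + (p * (d n * (\<Sum>k=1..<n. c k)) - \<kappa>)\<^sup>2 * (\<integral>\<omega>. (Minf \<omega>)\<^sup>2 \<partial>P))) sequentially"
      by (intro always_eventually allI walk_error_bound)
  qed simp
qed

end

section \<open>Kurtosis of the limit\<close>

lemma (in prob_space) expectation_square_le:
  assumes "square_integrable M f"
  shows "integrable M f" "(expectation f)\<^sup>2 \<le> (\<integral>x. (f x)\<^sup>2 \<partial>M)"
proof -
  have one: "square_integrable M (\<lambda>x. 1)" by (simp add: square_integrable_def)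
  show int: "integrable M f" using square_integrable_mult_integrable[OF assms one] by simp
  show "(expectation f)\<^sup>2 \<le> (\<integral>x. (f x)\<^sup>2 \<partial>M)"
    using variance_eq[OF int, folded square_integrable_def] variance_positive[of f] assms
    unfolding square_integrable_def by linarith
qed

text \<open>A nondegenerate Gaussian of mean 0 has kurtosis exactly 3; a point mass of mean 0 would
  have second moment 0.\<close>

lemma (in prob_space) not_gaussian_if_platykurtic:
  assumes platy: "platykurtic M Y" and mean: "expectation Y = 0"
  shows "\<not> gaussian M Y"
proof
  assume "gaussian M Y"
  then consider m where "AE \<omega> in M. Y \<omega> = m"
    | m \<sigma> where "\<sigma> > 0" "distributed M lborel Y (\<lambda>x. ennreal (normal_density m \<sigma> x))"
    by (auto simp: gaussian_def)
  then show False
  proof cases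
    case 1
    have [measurable]: "Y \<in> borel_measurable M" using platy by (simp add: platykurtic_def)
    have "expectation Y = (\<integral>\<omega>. m \<partial>M)" by (rule integral_cong_AE) (use 1 in auto)
    then have "m = 0" using mean by (simp add: prob_space)
    have "(\<integral>\<omega>. (Y \<omega>)\<^sup>2 \<partial>M) = (\<integral>\<omega>. 0 \<partial>M)"
      by (rule integral_cong_AE) (use 1 \<open>m = 0\<close> in auto)
    then show False using platy by (simp add: platykurtic_def)
  next
    case 2
    have "m = 0" using normal_distributed_expectation[OF 2] mean by simp
    have moment: "(\<integral>\<omega>. (Y \<omega>) ^ (2 * k) \<partial>M) = fact (2 * k) / ((2 / \<sigma>\<^sup>2) ^ k * fact k)" for k
      using distributed_integral[OF 2(2), of "\<lambda>x. x ^ (2 * k)"] integral_normal_moment_even[OF 2(1), of m k]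
      by (simp add: \<open>m = 0\<close>)
    have "(\<integral>\<omega>. (Y \<omega>)\<^sup>2 \<partial>M) = \<sigma>\<^sup>2"
      using moment[of 1] 2(1) by simp
    moreover have "(\<integral>\<omega>. (Y \<omega>) ^ 4 \<partial>M) = 3 * (\<sigma>\<^sup>2)\<^sup>2"
      using moment[of 2] 2(1) by (simp add: fact_numeral field_simps power2_eq_square)
    ultimately have "kurtosis M Y = 3" using 2(1) by (simp add: kurtosis_def)
    then show False using platy by (simp add: platykurtic_def)
  qed
qed

text \<open>One half of the continuity of the L2 norm. Young's inequality with parameter h costs a
  factor 1 + h and an error that vanishes as n grows; h tends to 0 afterwards.\<close>

lemma converges_L2_second_moment_bound:
  assumes conv: "converges_L2 M f g" and le: "eventually (\<lambda>n. x \<le> (\<integral>\<omega>. (f n \<omega>)\<^sup>2 \<partial>M)) sequentially"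
  shows "x \<le> (\<integral>\<omega>. (g \<omega>)\<^sup>2 \<partial>M)"
proof -
  define A where "A = (\<integral>\<omega>. (g \<omega>)\<^sup>2 \<partial>M)"
  have sq: "square_integrable M (f n)" "square_integrable M g" for n
    using conv by (auto simp: converges_L2_def)
  have bound: "(\<integral>\<omega>. (f n \<omega>)\<^sup>2 \<partial>M) \<le> (1 + h) * A + (1 + 1 / h) * (\<integral>\<omega>. (f n \<omega> - g \<omega>)\<^sup>2 \<partial>M)" if h: "h > 0" for h n
  proof -
    have ptw: "u\<^sup>2 \<le> (1 + h) * v\<^sup>2 + (1 + 1 / h) * (u - v)\<^sup>2" for u v :: real
    proof -
      have "(1 + h) * v\<^sup>2 + (1 + 1 / h) * (u - v)\<^sup>2 - u\<^sup>2 = (h * v - (u - v))\<^sup>2 / h"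
        using h by (simp add: field_simps power2_eq_square)
      also have "\<dots> \<ge> 0" using h by simp
      finally show ?thesis by simp
    qed
    have int: "integrable M (\<lambda>\<omega>. (f n \<omega>)\<^sup>2)" "integrable M (\<lambda>\<omega>. (g \<omega>)\<^sup>2)" "integrable M (\<lambda>\<omega>. (f n \<omega> - g \<omega>)\<^sup>2)"
      using sq square_integrable_diff[OF sq] by (auto simp: square_integrable_def)
    have "(\<integral>\<omega>. (f n \<omega>)\<^sup>2 \<partial>M) \<le> (\<integral>\<omega>. (1 + h) * (g \<omega>)\<^sup>2 + (1 + 1 / h) * (f n \<omega> - g \<omega>)\<^sup>2 \<partial>M)"
      by (rule integral_mono[OF _ _ ptw]) (use int in auto)
    then show ?thesis using int by (simp add: A_def)
  qed
  have "x \<le> (1 + h) * A" if h: "h > 0" for h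
  proof -
    have "(\<lambda>n. (1 + h) * A + (1 + 1 / h) * (\<integral>\<omega>. (f n \<omega> - g \<omega>)\<^sup>2 \<partial>M)) \<longlonglongrightarrow> (1 + h) * A + (1 + 1 / h) * 0"
      using conv by (intro tendsto_intros) (simp add: converges_L2_def)
    moreover have "eventually (\<lambda>n. x \<le> (1 + h) * A + (1 + 1 / h) * (\<integral>\<omega>. (f n \<omega> - g \<omega>)\<^sup>2 \<partial>M)) sequentially"
      using le by eventually_elim (rule order_trans[OF _ bound[OF h]])
    ultimately show ?thesis
      using tendsto_lowerbound[of _ _ sequentially x] by force
  qed
  then have "x \<le> (1 + inverse (real (Suc n))) * A" for n by simp
  moreover have "(\<lambda>n. (1 + inverse (real (Suc n))) * A) \<longlonglongrightarrow> (1 + 0) * A"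
    by (intro tendsto_intros LIMSEQ_inverse_real_of_nat)
  ultimately have "x \<le> (1 + 0) * A" by (intro LIMSEQ_le_const) auto
  then show ?thesis by (simp add: A_def)
qed

text \<open>\<open>A\<close> and \<open>B\<close> are the second and fourth moments of the martingale; a step multiplies it by
  \<open>1 - t\<close> and adds a sign times \<open>sqrt D\<close>.\<close>

lemma kurtosis_deficit_step:
  fixes A B D t :: real
  assumes t: "0 \<le> t" "t \<le> 1" and A: "0 \<le> A" "A\<^sup>2 \<le> B" and D: "0 \<le> D" "t\<^sup>2 * B \<le> D * A"
  defines "A' \<equiv> (1 - t)\<^sup>2 * A + 2 * (1 - t) * t * A + D"
    and "B' \<equiv> (1 - t) ^ 4 * B + 4 * (1 - t) ^ 3 * t * B + 6 * (1 - t)\<^sup>2 * D * A + 4 * (1 - t) * t * D * A + D\<^sup>2"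
  shows "A \<le> A'" "3 * A\<^sup>2 - B \<le> 3 * A'\<^sup>2 - B'"
proof -
  \<comment> \<open>From A^2 \<le> B and t^2 B \<le> D A, divided by A.\<close>
  have tA: "t\<^sup>2 * A \<le> D"
  proof (cases "A = 0")
    case False
    have "t\<^sup>2 * A * A \<le> t\<^sup>2 * B" using mult_left_mono[OF A(2), of "t\<^sup>2"] by (simp add: power2_eq_square mult.assoc)
    then have "t\<^sup>2 * A * A \<le> D * A" using D by simp
    then show ?thesis using False A by simp
  qed (use D in simp)
  have "A' - A = D - t\<^sup>2 * A" by (simp add: A'_def power2_eq_square algebra_simps)
  then show "A \<le> A'" using tA by simp
  \<comment> \<open>The increment is expanded in three quantities known to be nonnegative: D A - t^2
    B, B - A^2 and D^2 - (t^2 A)^2. The coefficient 6 - 5 t^2 is positive as t \<le> 1.\<close>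
  have "(3 * A'\<^sup>2 - B') - (3 * A\<^sup>2 - B) = 8 * t * (1 - t) * (D * A - t\<^sup>2 * B) + t\<^sup>2 * (6 - 5 * t\<^sup>2) * (B - A\<^sup>2)
      + 2 * (D\<^sup>2 - (t\<^sup>2 * A)\<^sup>2)"
    unfolding A'_def B'_def by algebra
  also have "0 \<le> \<dots>"
  proof (intro add_nonneg_nonneg)
    show "0 \<le> 8 * t * (1 - t) * (D * A - t\<^sup>2 * B)" using t D by simp
    have "t\<^sup>2 \<le> 1" using t by (simp add: power_le_one)
    then show "0 \<le> t\<^sup>2 * (6 - 5 * t\<^sup>2) * (B - A\<^sup>2)" using A by (intro mult_nonneg_nonneg) auto
    have "(t\<^sup>2 * A)\<^sup>2 \<le> D\<^sup>2" using tA A by (intro power_mono) auto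
    then show "0 \<le> 2 * (D\<^sup>2 - (t\<^sup>2 * A)\<^sup>2)" by simp
  qed
  finally show "3 * A\<^sup>2 - B \<le> 3 * A'\<^sup>2 - B'" by (simp only: diff_ge_0_iff_ge)
qed

section \<open>Mean of the limit, and its moments for Rademacher innovations\<close>

context srrw_supercritical
begin

lemma mart_lim_mean: "(\<integral>\<omega>. Minf \<omega> \<partial>P) = 0"
proof -
  have one: "square_integrable P (\<lambda>\<omega>. 1)" "(\<lambda>\<omega>. 1) \<in> borel_measurable (F n)" for n
    by (auto simp: square_integrable_def)
  have noise0: "(\<integral>\<omega>. noise n \<omega> \<partial>P) = 0" for n
    using noise_orthogonal[OF one(2,1)] by simp
  have M0: "(\<integral>\<omega>. M n \<omega> \<partial>P) = 0" for n
    unfolding mart_eq_sum_noise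
    using expectation_square_le(1)[OF noise_square_integrable] noise0
    by (subst Bochner_Integration.integral_sum) auto
  have sq: "square_integrable P Minf" using mart_converges_L2 by (simp add: converges_L2_def)
  have "(expectation Minf)\<^sup>2 \<le> (\<integral>\<omega>. (M n \<omega> - Minf \<omega>)\<^sup>2 \<partial>P)" for n
    using expectation_square_le(2)[OF square_integrable_diff[OF mart_square_integrable[of n] sq]] M0[of n]
      expectation_square_le(1)[OF mart_square_integrable[of n]] expectation_square_le(1)[OF sq]
    by simp
  moreover have "(\<lambda>n. \<integral>\<omega>. (M n \<omega> - Minf \<omega>)\<^sup>2 \<partial>P) \<longlonglongrightarrow> 0"
    using mart_converges_L2 by (simp add: converges_L2_def)
  ultimately have "(expectation Minf)\<^sup>2 \<le> 0" by (intro LIMSEQ_le_const) auto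
  then show ?thesis by simp
qed

context
  assumes rademacher: "symmetric_rademacher P (\<xi> 1)"
begin

lemma xi_square_AE:
  assumes "n \<ge> 1" shows "AE \<omega> in P. (\<xi> n \<omega>)\<^sup>2 = 1"
proof -
  have [measurable]: "\<xi> 1 \<in> borel_measurable P" "\<xi> n \<in> borel_measurable P"
    using xi_measurable assms by auto
  have "prob {\<omega> \<in> space P. (\<xi> 1 \<omega>)\<^sup>2 = 1} = prob ({\<omega> \<in> space P. \<xi> 1 \<omega> = 1} \<union> {\<omega> \<in> space P. \<xi> 1 \<omega> = -1})"
    by (rule arg_cong[where f = prob]) (auto simp: power2_eq_1_iff)
  also have "\<dots> = 1"
    using rademacher by (subst finite_measure_Union) (auto simp: symmetric_rademacher_def)
  finally have "prob {\<omega> \<in> space P. (\<xi> 1 \<omega>)\<^sup>2 = 1} = 1" .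
  moreover have "{\<omega> \<in> space P. (\<xi> 1 \<omega>)\<^sup>2 = 1} \<in> events" by measurable
  ultimately have "AE \<omega> in P. (\<xi> 1 \<omega>)\<^sup>2 = 1" by (simp only: prob_Collect_eq_1)
  moreover have "(AE x in distr P borel (\<xi> k). x\<^sup>2 = 1) \<longleftrightarrow> (AE \<omega> in P. (\<xi> k \<omega>)\<^sup>2 = 1)" if "k \<ge> 1" for k
    using xi_measurable[OF that] by (subst AE_distr_iff) auto
  from this[OF order_refl] this[OF assms]
  have "(AE \<omega> in P. (\<xi> 1 \<omega>)\<^sup>2 = 1) \<longleftrightarrow> (AE \<omega> in P. (\<xi> n \<omega>)\<^sup>2 = 1)"
    by (simp only: xi_ident[OF assms])
  ultimately show ?thesis by (simp only:)
qed

lemma X_square_AE: "n \<ge> 1 \<Longrightarrow> AE \<omega> in P. (X n \<omega>)\<^sup>2 = 1"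
proof (induction n rule: less_induct)
  case (less n)
  show ?case
  proof (cases "n = 1")
    case True
    show ?thesis using X_init xi_square_AE[of 1] True by auto
  next
    case False
    define m where "m = n - 1"
    have m: "n = Suc m" "m \<ge> 1" using less.prems False by (auto simp: m_def)
    have "AE \<omega> in P. \<forall>k\<in>{1..m}. (X k \<omega>)\<^sup>2 = 1"
      by (rule AE_finite_allI) (use less.IH m in auto)
    moreover have "AE \<omega> in P. (\<xi> (Suc m) \<omega>)\<^sup>2 = 1" by (rule xi_square_AE) simp
    ultimately show ?thesis using step_AE[OF m(2)]
    proof eventually_elim
      case (elim \<omega>)
      \<comment> \<open>For the indicator of x^2 \<noteq> 1 every term on the right of
        \<open>step_AE\<close> vanishes.\<close>
      have "of_bool ((X (Suc m) \<omega>)\<^sup>2 \<noteq> 1) = (0::real)"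
        using spec[OF elim(3), of "\<lambda>x. of_bool (x\<^sup>2 \<noteq> 1)"] elim(1,2) by simp
      then show ?case by (simp add: m)
    qed
  qed
qed

text \<open>The steps are signs almost surely. The bound makes all moments of the martingale finite
  and later compares its fourth moment with its second.\<close>

lemma Y_bounded_AE: "AE \<omega> in P. \<bar>Y n \<omega>\<bar> \<le> \<nu> n"
proof -
  have "AE \<omega> in P. \<forall>k\<in>{1..n}. (X k \<omega>)\<^sup>2 = 1"
    by (rule AE_finite_allI) (use X_square_AE in auto)
  then show ?thesis
  proof eventually_elim
    case (elim \<omega>)
    have "\<bar>\<mu> k * X k \<omega>\<bar> = \<mu> k" if "k \<in> {1..n}" for k
      using bspec[OF elim that] memory_pos[of k] that by (auto simp: power2_eq_1_iff)
    then have "(\<Sum>k=1..n. \<bar>\<mu> k * X k \<omega>\<bar>) = \<nu> n" by (simp add: mem_sum_def)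
    then show ?case using sum_abs[of "\<lambda>k. \<mu> k * X k \<omega>" "{1..n}"] by (simp add: Y_def)
  qed
qed

lemma mart_measurable: "M n \<in> borel_measurable P"
  using mart_square_integrable[of n] by (simp add: square_integrable_def)

lemma mart_power_integrable: "integrable P (\<lambda>\<omega>. M n \<omega> ^ j)"
proof (rule integrable_const_bound)
  show "AE \<omega> in P. norm (M n \<omega> ^ j) \<le> (a n * \<nu> n) ^ j"
    using Y_bounded_AE[of n]
  proof eventually_elim
    case (elim \<omega>)
    then have "\<bar>M n \<omega>\<bar> \<le> a n * \<nu> n"
      using coeff_a_pos[of n] by (simp add: mart_Y abs_mult)
    then show ?case by (simp add: power_abs power_mono)
  qed
qed (use mart_measurable in simp)

text \<open>When the steps are signs, powers of X reduce to 1 or X, so these are the only mixed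
  moments in the expansion of a power of M (n+1).\<close>

lemma mart_power_X:
  shows "integrable P (\<lambda>\<omega>. M n \<omega> ^ j * X (Suc n) \<omega>)"
    and "n \<ge> 1 \<Longrightarrow> (\<integral>\<omega>. M n \<omega> ^ j * X (Suc n) \<omega> \<partial>P) = p * c n * (\<integral>\<omega>. M n \<omega> ^ Suc j \<partial>P)"
proof -
  have g: "(\<lambda>\<omega>. M n \<omega> ^ j) \<in> borel_measurable (F n)" "square_integrable P (\<lambda>\<omega>. M n \<omega> ^ j)"
  proof -
    show "(\<lambda>\<omega>. M n \<omega> ^ j) \<in> borel_measurable (F n)"
      using Y_adapted[of n] by (simp add: mart_Y)
    show "square_integrable P (\<lambda>\<omega>. M n \<omega> ^ j)"
      using mart_power_integrable[of n "j * 2"] mart_measurable[of n]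
      by (simp add: square_integrable_def power_mult[symmetric])
  qed
  show "integrable P (\<lambda>\<omega>. M n \<omega> ^ j * X (Suc n) \<omega>)"
    by (rule square_integrable_mult_integrable[OF g(2) X_square_integrable]) simp
  assume n: "n \<ge> 1"
  have Y: "Y n \<omega> = M n \<omega> / a n" for \<omega> using coeff_a_pos[of n] by (simp add: mart_Y)
  have "(\<integral>\<omega>. M n \<omega> ^ j * X (Suc n) \<omega> \<partial>P) = p * ((\<integral>\<omega>. M n \<omega> ^ j * Y n \<omega> \<partial>P) / \<nu> n)"
    by (rule step_expectation[OF g])
  also have "(\<integral>\<omega>. M n \<omega> ^ j * Y n \<omega> \<partial>P) = (\<integral>\<omega>. M n \<omega> ^ Suc j \<partial>P) / a n"
    by (simp add: Y mult.commute)
  finally show "(\<integral>\<omega>. M n \<omega> ^ j * X (Suc n) \<omega> \<partial>P) = p * c n * (\<integral>\<omega>. M n \<omega> ^ Suc j \<partial>P)"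
    by (simp add: c_def)
qed

text \<open>M (n+1) = r M n + D X (n+1) with r = 1 - t. As the square of X (n+1) is 1, the second
  and fourth powers yield a recursion in A and B alone, to which
  \<open>kurtosis_deficit_step\<close> applies with the square of \<open>D\<close> in the place of
  its own D.\<close>

lemma mart_moment_step:
  assumes n: "n \<ge> 1"
  defines "A \<equiv> (\<integral>\<omega>. M n \<omega> ^ 2 \<partial>P)" and "B \<equiv> (\<integral>\<omega>. M n \<omega> ^ 4 \<partial>P)"
    and "A' \<equiv> (\<integral>\<omega>. M (Suc n) \<omega> ^ 2 \<partial>P)" and "B' \<equiv> (\<integral>\<omega>. M (Suc n) \<omega> ^ 4 \<partial>P)"
  shows "A \<le> A'" "3 * A\<^sup>2 - B \<le> 3 * A'\<^sup>2 - B'"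
proof -
  define r where "r = a (Suc n) / a n"
  define D where "D = d (Suc n)"
  define k where "k = p * c n"
  define t where "t = 1 - r"
  have gf: "1 + p * (\<mu> (Suc n) / \<nu> n) > 0" "a (Suc n) * (1 + p * (\<mu> (Suc n) / \<nu> n)) = a n"
    using growth_factor_pos[OF n] coeff_a_Suc[OF n] by auto
  have \<nu>: "\<nu> n > 0" by (rule mem_sum_pos[OF n])
  \<comment> \<open>The weak conditional mean of D X (n+1) is t M n, which compensates the
    contraction by 1 - t.\<close>
  have tD: "t = D * k"
  proof -
    have "a n - a (Suc n) = a (Suc n) * (p * (\<mu> (Suc n) / \<nu> n))" using gf(2) by (simp add: algebra_simps)
    then have "t = a (Suc n) * (p * (\<mu> (Suc n) / \<nu> n)) / a n"
      using coeff_a_pos[of n] by (simp add: t_def r_def field_simps)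
    then show ?thesis by (simp add: D_def k_def d_def c_def mult_ac)
  qed
  have k0: "k \<ge> 0" and D0: "D \<ge> 0" using p_bounds c_pos[OF n] d_pos[of "Suc n"] by (auto simp: k_def D_def)
  have t: "0 \<le> t" "t \<le> 1"
  proof -
    show "0 \<le> t" using tD k0 D0 by simp
    have "r > 0" using coeff_a_pos[of n] coeff_a_pos[of "Suc n"] by (simp add: r_def)
    then show "t \<le> 1" by (simp add: t_def)
  qed
  have step: "M (Suc n) \<omega> = r * M n \<omega> + D * X (Suc n) \<omega>" for \<omega>
    using coeff_a_pos[of n] by (simp add: mart_Y Y_Suc r_def D_def d_def algebra_simps)
  have X2: "AE \<omega> in P. (X (Suc n) \<omega>)\<^sup>2 = 1" by (rule X_square_AE) simp
  note int = mart_power_integrable[of n] mart_power_X(1)[of n]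
  note mX = mart_power_X(2)[OF n, folded k_def]
  have Xm: "X (Suc n) \<in> borel_measurable P" by (rule X_rv) simp
  note meas = mart_measurable Xm
  have A': "A' = r\<^sup>2 * A + 2 * r * t * A + D\<^sup>2"
  proof -
    have "A' = (\<integral>\<omega>. r\<^sup>2 * M n \<omega> ^ 2 + 2 * r * D * (M n \<omega> ^ 1 * X (Suc n) \<omega>) + D\<^sup>2 \<partial>P)"
      unfolding A'_def
    proof (rule integral_cong_AE)
      show "AE \<omega> in P. M (Suc n) \<omega> ^ 2 = r\<^sup>2 * M n \<omega> ^ 2 + 2 * r * D * (M n \<omega> ^ 1 * X (Suc n) \<omega>) + D\<^sup>2"
        using X2
      proof eventually_elim
        case (elim \<omega>)
        show ?case unfolding step power_one_right using elim by algebra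
      qed
    qed (use meas in measurable)
    also have "\<dots> = r\<^sup>2 * A + 2 * r * D * (k * A) + D\<^sup>2"
      using int(1)[of 2] int(2)[of 1] mX[of 1] by (simp add: A_def numeral_2_eq_2 prob_space)
    finally show ?thesis by (simp add: tD)
  qed
  have B': "B' = r ^ 4 * B + 4 * r ^ 3 * t * B + 6 * r\<^sup>2 * D\<^sup>2 * A + 4 * r * t * D\<^sup>2 * A + (D\<^sup>2)\<^sup>2"
  proof -
    have "B' = (\<integral>\<omega>. r ^ 4 * M n \<omega> ^ 4 + 4 * r ^ 3 * D * (M n \<omega> ^ 3 * X (Suc n) \<omega>) + 6 * r\<^sup>2 * D\<^sup>2 * M n \<omega> ^ 2
        + 4 * r * D ^ 3 * (M n \<omega> ^ 1 * X (Suc n) \<omega>) + D ^ 4 \<partial>P)"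
      unfolding B'_def
    proof (rule integral_cong_AE)
      show "AE \<omega> in P. M (Suc n) \<omega> ^ 4 = r ^ 4 * M n \<omega> ^ 4 + 4 * r ^ 3 * D * (M n \<omega> ^ 3 * X (Suc n) \<omega>) + 6 * r\<^sup>2 * D\<^sup>2 * M n \<omega> ^ 2
        + 4 * r * D ^ 3 * (M n \<omega> ^ 1 * X (Suc n) \<omega>) + D ^ 4"
        using X2
      proof eventually_elim
        case (elim \<omega>)
        show ?case unfolding step power_one_right using elim by algebra
      qed
    qed (use meas in measurable)
    also have "\<dots> = r ^ 4 * B + 4 * r ^ 3 * D * (k * B) + 6 * r\<^sup>2 * D\<^sup>2 * A + 4 * r * D ^ 3 * (k * A) + D ^ 4"
      using int(1)[of 2] int(1)[of 4] int(2)[of 1] int(2)[of 3] mX[of 1] mX[of 3]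
      by (simp add: A_def B_def numeral_2_eq_2[symmetric] prob_space)
    finally show ?thesis unfolding tD by algebra
  qed
  have A0: "0 \<le> A" by (simp add: A_def)
  have AB: "A\<^sup>2 \<le> B"
  proof -
    have "square_integrable P (\<lambda>\<omega>. M n \<omega> ^ 2)"
      using int(1)[of 4] mart_measurable[of n] by (simp add: square_integrable_def)
    from expectation_square_le(2)[OF this] show ?thesis by (simp add: A_def B_def)
  qed
  \<comment> \<open>k M n equals p Y n / \<nu> n, which is at most 1 in absolute value because the
    steps are signs.\<close>
  have kB: "k\<^sup>2 * B \<le> A"
  proof -
    have "k\<^sup>2 * B = (\<integral>\<omega>. k\<^sup>2 * M n \<omega> ^ 4 \<partial>P)" by (simp add: B_def)
    also have "\<dots> \<le> A" unfolding A_def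
    proof (rule integral_mono_AE)
      show "AE \<omega> in P. k\<^sup>2 * M n \<omega> ^ 4 \<le> M n \<omega> ^ 2"
        using Y_bounded_AE[of n]
      proof eventually_elim
        case (elim \<omega>)
        have "k * M n \<omega> = p * (Y n \<omega> / \<nu> n)"
          using coeff_a_pos[of n] by (simp add: k_def c_def mart_Y)
        then have "\<bar>k * M n \<omega>\<bar> = p * (\<bar>Y n \<omega>\<bar> / \<nu> n)" using p_bounds \<nu> by (simp add: abs_mult)
        also have "\<dots> \<le> 1 * 1" using elim \<nu> p_bounds by (intro mult_mono) auto
        finally have "(k * M n \<omega>)\<^sup>2 \<le> 1" by (simp add: abs_square_le_1)
        then have "(k * M n \<omega>)\<^sup>2 * M n \<omega> ^ 2 \<le> 1 * M n \<omega> ^ 2" by (intro mult_right_mono) auto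
        then show ?case by (simp add: power_mult_distrib mult.assoc power_add[symmetric])
      qed
    qed (use int in auto)
    finally show ?thesis .
  qed
  have tB: "t\<^sup>2 * B \<le> D\<^sup>2 * A"
    using mult_left_mono[OF kB, of "D\<^sup>2"] by (simp add: tD power_mult_distrib mult.assoc)
  have r: "r = 1 - t" by (simp add: t_def)
  show "A \<le> A'" "3 * A\<^sup>2 - B \<le> 3 * A'\<^sup>2 - B'"
    using kurtosis_deficit_step[OF t A0 AB zero_le_power2 tB] by (simp_all add: A' B' r)
qed

lemma mart_1_moments: "(\<integral>\<omega>. M 1 \<omega> ^ 2 \<partial>P) = \<mu> 1 ^ 2" "(\<integral>\<omega>. M 1 \<omega> ^ 4 \<partial>P) = \<mu> 1 ^ 4"
proof -
  have X1: "AE \<omega> in P. (X 1 \<omega>)\<^sup>2 = 1" by (rule X_square_AE) simp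
  have M1: "M 1 \<omega> = \<mu> 1 * X 1 \<omega>" for \<omega> by (simp add: mart_def coeff_a_def)
  have "(\<integral>\<omega>. M 1 \<omega> ^ (2 * j) \<partial>P) = (\<integral>\<omega>. \<mu> 1 ^ (2 * j) \<partial>P)" for j
  proof (rule integral_cong_AE)
    show "AE \<omega> in P. M 1 \<omega> ^ (2 * j) = \<mu> 1 ^ (2 * j)"
      using X1 by eventually_elim (simp only: M1 power_mult_distrib power_mult power_one mult_1_right)
  qed (use mart_measurable[of 1] in auto)
  from this[of 1] this[of 2] show "(\<integral>\<omega>. M 1 \<omega> ^ 2 \<partial>P) = \<mu> 1 ^ 2" "(\<integral>\<omega>. M 1 \<omega> ^ 4 \<partial>P) = \<mu> 1 ^ 4"
    by (simp_all add: prob_space)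
qed

lemma mart_lim_platykurtic: "platykurtic P Minf"
proof -
  define A where "A n = (\<integral>\<omega>. M n \<omega> ^ 2 \<partial>P)" for n
  define B where "B n = (\<integral>\<omega>. M n \<omega> ^ 4 \<partial>P)" for n
  define Ainf where "Ainf = (\<integral>\<omega>. (Minf \<omega>)\<^sup>2 \<partial>P)"
  \<comment> \<open>A bound for every B n: second moments stay below that of the limit, and the
    deficit never falls below its value at n = 1, where M 1 is \<mu> 1 times a sign and 3 - 1 =
    2.\<close>
  define K where "K = 3 * Ainf\<^sup>2 - 2 * \<mu> 1 ^ 4"
  have \<mu>1: "\<mu> 1 > 0" by (rule memory_pos) simp
  have sq: "square_integrable P Minf" using mart_converges_L2 by (simp add: converges_L2_def)
  then have Mm: "Minf \<in> borel_measurable P" by (simp add: square_integrable_def)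
  have mono: "A m \<le> A n" if "1 \<le> m" "m \<le> n" for m n
    using that(2)
  proof (induction rule: dec_induct)
    case (step i)
    then show ?case using mart_moment_step(1)[of i] that(1) by (simp add: A_def)
  qed simp
  have deficit: "2 * \<mu> 1 ^ 4 \<le> 3 * (A n)\<^sup>2 - B n" if "1 \<le> n" for n
    using that
  proof (induction rule: dec_induct)
    case base
    show ?case by (simp only: A_def B_def mart_1_moments) (simp add: power_mult[symmetric])
  next
    case (step i)
    then show ?case using mart_moment_step(2)[of i] by (simp add: A_def B_def)
  qed
  have A_le: "A n \<le> Ainf" if "1 \<le> n" for n
    unfolding Ainf_def
  proof (rule converges_L2_second_moment_bound[OF mart_converges_L2])
    show "eventually (\<lambda>m. A n \<le> (\<integral>\<omega>. (M m \<omega>)\<^sup>2 \<partial>P)) sequentially"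
      using eventually_ge_at_top[of n] by eventually_elim (use mono[OF that] in \<open>simp add: A_def\<close>)
  qed
  have "\<mu> 1 ^ 2 \<le> Ainf" using A_le[of 1] mart_1_moments(1) by (simp add: A_def)
  then have pos: "Ainf > 0" using \<mu>1 by (smt (verit) zero_less_power)
  have B_le: "B n \<le> K" if "1 \<le> n" for n
  proof -
    have "0 \<le> A n" by (simp add: A_def)
    then have "(A n)\<^sup>2 \<le> Ainf\<^sup>2" using A_le[OF that] by (intro power_mono) auto
    then show ?thesis using deficit[OF that] by (simp add: K_def)
  qed
  have lim: "AE \<omega> in P. (\<lambda>n. M n \<omega> ^ 4) \<longlonglongrightarrow> Minf \<omega> ^ 4"
    using mart_converges_AE by eventually_elim (intro tendsto_intros)
  have ev: "eventually (\<lambda>n. (\<integral>\<omega>. M n \<omega> ^ 4 \<partial>P) \<le> K) sequentially"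
    using eventually_ge_at_top[of 1] by eventually_elim (use B_le in \<open>simp add: B_def\<close>)
  have fourth: "integrable P (\<lambda>\<omega>. Minf \<omega> ^ 4)" "(\<integral>\<omega>. Minf \<omega> ^ 4 \<partial>P) \<le> K"
    by (rule fatou_integral_bound[OF mart_power_integrable _ _ lim ev]; use Mm in simp)+
  have "K < 3 * Ainf\<^sup>2" using \<mu>1 by (simp add: K_def)
  then have "kurtosis P Minf < 3"
    using fourth(2) pos by (simp add: kurtosis_def Ainf_def[symmetric] divide_less_eq)
  then show ?thesis using Mm fourth(1) pos by (simp add: platykurtic_def Ainf_def)
qed

end

end

theorem theorem2p7:
  fixes P :: "'a measure"
    and p \<gamma> :: real
    and \<mu> :: "nat \<Rightarrow> real"
    and \<xi> :: "nat \<Rightarrow> 'a \<Rightarrow> real"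
    and \<alpha> :: "nat \<Rightarrow> 'a \<Rightarrow> bool"
    and \<beta> :: "nat \<Rightarrow> 'a \<Rightarrow> nat"
    and X :: "nat \<Rightarrow> 'a \<Rightarrow> real"
  assumes model: "srrw_rvm P p \<gamma> \<mu> \<xi> \<alpha> \<beta> X"
    and xi_sq_integrable: "integrable P (\<lambda>\<omega>. (\<xi> 1 \<omega>)\<^sup>2)"
    and xi_second_moment: "(\<integral>\<omega>. (\<xi> 1 \<omega>)\<^sup>2 \<partial>P) = 1"
    and v_bounded: "bounded (range (coeff_v p \<mu>))"
    and p_ge_crit: "p_crit \<gamma> \<le> p"
  shows "converges_AE P (mart p \<mu> X) (mart_lim p \<mu> X)
    \<and> converges_L2 P (mart p \<mu> X) (mart_lim p \<mu> X)
    \<and> converges_L2 P (\<lambda>n \<omega>. coeff_a p \<mu> n * \<mu> n * walk X n \<omega>)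
         (\<lambda>\<omega>. p * (\<gamma> + 1) / (p * (\<gamma> + 1) - \<gamma>) * mart_lim p \<mu> X \<omega>)
    \<and> converges_AE P (\<lambda>n \<omega>. coeff_a p \<mu> n * \<mu> n * walk X n \<omega>)
         (\<lambda>\<omega>. p * (\<gamma> + 1) / (p * (\<gamma> + 1) - \<gamma>) * mart_lim p \<mu> X \<omega>)
    \<and> (symmetric_rademacher P (\<xi> 1) \<longrightarrow>
         platykurtic P (mart_lim p \<mu> X) \<and> \<not> gaussian P (mart_lim p \<mu> X))"
proof -
  interpret srrw_supercritical P p \<gamma> \<mu> \<xi> \<alpha> \<beta> X
    using assms by (intro srrw_supercritical.intro srrw_L2.intro srrw_L2_axioms.intro srrw_supercritical_axioms.intro)
  have "platykurtic P Minf \<and> \<not> gaussian P Minf" if "symmetric_rademacher P (\<xi> 1)"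
    using mart_lim_platykurtic[OF that] not_gaussian_if_platykurtic mart_lim_mean by blast
  then show ?thesis
    using mart_converges_AE mart_converges_L2 walk_converges_AE walk_converges_L2
    unfolding converges_AE_def \<kappa>_def \<rho>_def by blast
qed

end
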